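(* There exist an absolute constant $c>0$, an absolute constant $\delta_0\in(0,1)$ and, for every $2\le p<\infty$, constants $C_p,c_p>0$ depending only on $p$, such that for all $0\le\beta\le 1$ and all $0<\delta\le\delta_0$, $$D_{p,\delta,\beta}\le C_p\,|\log\delta|^{c}\left(\delta^{-(2-\beta)\left(\frac12-\frac1p\right)}+\delta^{-\left(1-\frac{2+\beta}{p}\right)}\right).$$ Moreover this bound is sharp up to the factor $|\log\delta|^{c}$, i.e. $$D_{p,\delta,\beta}\ge c_p\left(\delta^{-(2-\beta)\left(\frac12-\frac1p\right)}+\delta^{-\left(1-\frac{2+\beta}{p}\right)}\right).$$
   Context: For small $\delta>0$ and $0\le\beta\le1$, let $\mathcal N_{\mathbb P_1}(\delta^\beta)=\{(\xi_1,\xi_2)\in\mathbb R^2: |\xi_1|\le 1,\ |\xi_2-\xi_1^2|\le\delta^\beta\}$ be the $\delta^\beta$-neighborhood of the unit parabola $\mathbb P_1=\{(\xi,\xi^2):|\xi|\le1\}$. Let $\mathcal P(\delta)$ be the partition of $\mathcal N_{\mathbb P_1}(\delta^\beta)$ into the disjoint sets (small caps) $\gamma=\{(\xi_1,\xi_2)\in\mathcal N_{\mathbb P_1}(\delta^\beta):\xi_1\in I\}$, where $I$ ranges over a partition of $[-1,1]$ into intervals of length $\delta$ (the last one being allowed to be shorter if $2/\delta$ is not an integer). For a function $f$ on $\mathbb R^2$ and $\gamma\subset\mathbb R^2$, set $f_\gamma=(\chi_\gamma\widehat f)^{\vee}$, where $\chi_\gamma$ is the indicator function of $\gamma$ and $^\vee$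 is the inverse Fourier transform. $D_{p,\delta,\beta}$ denotes the best constant such that $$\|f\|_{L^p(\mathbb R^2)}\le D_{p,\delta,\beta}\Big(\sum_{\gamma\in\mathcal P(\delta)}\|f_\gamma\|_{L^p(\mathbb R^2)}^p\Big)^{1/p}$$ for all functions $f$ on $\mathbb R^2$ whose Fourier transform is supported in $\mathcal N_{\mathbb P_1}(\delta^\beta)$. *)

theory Defs
  imports "HOL-Analysis.Analysis"
begin

type_synonym plane = "real \<times> real"

section \<open>The Fourier transform on the plane\<close>

text \<open>Normalisation: the kernel is \<open>exp (- 2 \<pi> i x \<bullet> \<xi>)\<close>. Another normalisation only rescales the
  physical variable, which does not affect the decoupling constant below.\<close>

definition fourier :: "(plane \<Rightarrow> complex) \<Rightarrow> plane \<Rightarrow> complex" where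
  "fourier f \<xi> = (LINT x|lborel. f x * cis (- 2 * pi * (x \<bullet> \<xi>)))"

definition inv_fourier :: "(plane \<Rightarrow> complex) \<Rightarrow> plane \<Rightarrow> complex" where
  "inv_fourier F x = (LINT \<xi>|lborel. F \<xi> * cis (2 * pi * (x \<bullet> \<xi>)))"

text \<open>In the next definition \<open>D i j\<close> is the partial derivative of \<open>\<phi>\<close> of order \<open>i\<close> in the first and
  \<open>j\<close> in the second variable.\<close>

definition schwartz :: "(plane \<Rightarrow> complex) \<Rightarrow> bool" where
  "schwartz \<phi> \<longleftrightarrow> (\<exists>D :: nat \<Rightarrow> nat \<Rightarrow> plane \<Rightarrow> complex. D 0 0 = \<phi> \<and>
     (\<forall>i j x. (D i j has_derivative
         (\<lambda>h. fst h *\<^sub>R D (Suc i) j x + snd h *\<^sub>R D i (Suc j) x)) (at x)) \<and>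
     (\<forall>i j n. bounded (range (\<lambda>x. norm x ^ n *\<^sub>R D i j x))))"

definition temperate_fun :: "(plane \<Rightarrow> complex) \<Rightarrow> bool" where
  "temperate_fun f \<longleftrightarrow> f \<in> borel_measurable borel \<and>
     (\<exists>n. integrable lborel (\<lambda>x. f x /\<^sub>R (1 + norm x) ^ n))"

text \<open>\<open>F\<close> is the Fourier transform of \<open>f\<close> in the sense of tempered distributions. For integrable \<open>f\<close>
  this says that \<open>F = fourier f\<close> almost everywhere, for square-integrable \<open>f\<close> that \<open>F\<close> is the
  Plancherel transform of \<open>f\<close>.\<close>

definition has_fourier_transform :: "(plane \<Rightarrow> complex) \<Rightarrow> (plane \<Rightarrow> complex) \<Rightarrow> bool" where
  "has_fourier_transform f F \<longleftrightarrow> temperate_fun f \<and> temperate_fun F \<and>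
     (\<forall>\<phi>. schwartz \<phi> \<longrightarrow>
        (LINT x|lborel. f x * fourier \<phi> x) = (LINT \<xi>|lborel. F \<xi> * \<phi> \<xi>))"

section \<open>\<open>L\<^sup>p\<close> norms\<close>

text \<open>Powers of extended nonnegative reals; only used for exponents \<open>a > 0\<close>.\<close>

definition epowr :: "ennreal \<Rightarrow> real \<Rightarrow> ennreal" where
  "epowr x a = (if x = \<infinity> then \<infinity> else ennreal (enn2real x powr a))"

definition Lp_norm :: "real \<Rightarrow> (plane \<Rightarrow> complex) \<Rightarrow> ennreal" where
  "Lp_norm p f = epowr (\<integral>\<^sup>+ x. ennreal (norm (f x) powr p) \<partial>lborel) (1 / p)"

section \<open>Small caps of the parabola\<close>

definition parabola_nbhd :: "real \<Rightarrow> plane set" where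
  "parabola_nbhd r = {(\<xi>1, \<xi>2). \<bar>\<xi>1\<bar> \<le> 1 \<and> \<bar>\<xi>2 - \<xi>1\<^sup>2\<bar> \<le> r}"

text \<open>For \<open>k < \<lceil>2 / \<delta>\<rceil>\<close> these intervals partition \<open>[-1, 1]\<close>; all have length \<open>\<delta>\<close>, except that the last
  one is shorter when \<open>2 / \<delta>\<close> is not an integer. Which of two neighbours contains their common
  endpoint is immaterial, since the corresponding part of the plane is a null set.\<close>

definition cap_interval :: "real \<Rightarrow> nat \<Rightarrow> real set" where
  "cap_interval \<delta> k =
     (if k = 0 then {-1..-1 + \<delta>} else {-1 + real k * \<delta><..-1 + real (Suc k) * \<delta>}) \<inter> {-1..1}"

definition small_caps :: "real \<Rightarrow> real \<Rightarrow> plane set set" where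
  "small_caps \<delta> \<beta> =
     (\<lambda>k. {(\<xi>1, \<xi>2) \<in> parabola_nbhd (\<delta> powr \<beta>). \<xi>1 \<in> cap_interval \<delta> k}) ` {..<nat \<lceil>2 / \<delta>\<rceil>}"

text \<open>With \<open>F\<close> the Fourier transform of \<open>f\<close>, this is \<open>f\<^sub>\<gamma>\<close>.\<close>

definition cap_part :: "(plane \<Rightarrow> complex) \<Rightarrow> plane set \<Rightarrow> plane \<Rightarrow> complex" where
  "cap_part F \<gamma> = inv_fourier (\<lambda>\<xi>. indicator \<gamma> \<xi> * F \<xi>)"

section \<open>The decoupling constant\<close>

text \<open>The infimum is taken in \<open>[0, \<infinity>]\<close>, so it is \<open>\<infinity>\<close> if no finite constant is admissible.\<close>

definition decoupling_const :: "real \<Rightarrow> real \<Rightarrow> real \<Rightarrow> ennreal" where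
  "decoupling_const p \<delta> \<beta> = Inf {D. \<forall>f F.
     has_fourier_transform f F \<and> (\<forall>\<xi>. \<xi> \<notin> parabola_nbhd (\<delta> powr \<beta>) \<longrightarrow> F \<xi> = 0) \<longrightarrow>
     Lp_norm p f \<le> D * epowr (\<Sum>\<gamma>\<in>small_caps \<delta> \<beta>. epowr (Lp_norm p (cap_part F \<gamma>)) p) (1 / p)}"

end

theory Submission
  imports Defs "HOL-Probability.Probability"
begin

text \<open>Write \<open>w = \<delta> powr \<beta>\<close>. The two terms in the bound correspond to the exponents \<open>(2 - \<beta>) (1/2 - 1/p)\<close>
and \<open>1 - (2 + \<beta>)/p\<close>. Both are linear in \<open>1/p\<close> and they agree at \<open>p = 4\<close>, for every \<open>\<beta>\<close>. So the upper bound
follows by interpolation from the exponents 2, 4 and \<open>\<infinity>\<close>, where the constants have to be \<open>O(1)\<close>, \<open>O(\<delta>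
powr (- (2 - \<beta>) / 4) \<bar>ln \<delta>\<bar> powr (1/4))\<close> and \<open>O(1/\<delta>)\<close>. The first is orthogonality, the last is the
triangle inequality over the \<open>O(1/\<delta>)\<close> caps, and the heart of the matter is the exponent 4.

There the fourth power of \<open>f = \<Sum> f\<^sub>\<gamma>\<close> expands into the integrals of \<open>f\<^sub>1 f\<^sub>2 cnj (f\<^sub>3 f\<^sub>4)\<close> over
quadruples of caps. Such an integral vanishes unless the sum of the first two caps meets the sum of
the last two. Because \<open>w \<ge> \<delta>\<close>, a cap is essentially an axis-parallel rectangle with sides \<open>\<delta>\<close> and \<open>w\<close> at a
point \<open>(c, c\<^sup>2)\<close>, so that for an interacting quadruple \<open>c\<^sub>2\<close> is determined by the other centers up to
\<open>O(1)\<close> choices, and \<open>2 (c\<^sub>1 - c\<^sub>3) (c\<^sub>1 - c\<^sub>4) = c\<^sub>1\<^sup>2 + c\<^sub>2\<^sup>2 - c\<^sub>3\<^sup>2 - c\<^sub>4\<^sup>2 + O(\<delta>) = O(w)\<close>. In units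
of \<open>\<delta>\<close> this asks for pairs of integers with product \<open>O(w/\<delta>\<^sup>2)\<close>, of which there are \<open>O(w/\<delta>\<^sup>2 \<bar>ln \<delta>\<bar>)\<close>; this
is where the logarithm comes from (\<open>card_cap_quadruples\<close>). As this count holds for each fixed cap, the
inequality between arithmetic and geometric means finishes the estimate (\<open>almost_orthogonal_L4\<close>,
\<open>cap_strong_bound_4\<close>).

Decoupling is an inequality for functions with restricted Fourier support, so it cannot be
interpolated as it stands. It is replaced by bounds for the operator that maps a family \<open>g\<close> to
\<open>\<Sum> K\<^sub>\<gamma> * g\<^sub>\<gamma>\<close>, where the Fourier transform of the kernel \<open>K\<^sub>\<gamma>\<close> is 1 on \<open>\<gamma>\<close> and is supported near \<open>\<gamma>\<close>, and
where the \<open>L\<^sup>1\<close> norm of \<open>K\<^sub>\<gamma>\<close> is an absolute constant (\<open>cap_kernel\<close>); one recovers \<open>f\<close> from \<open>g\<^sub>\<gamma> = f\<^sub>\<gamma>\<close>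
(\<open>decoupling_of_strong_bound\<close>). Since the constant may depend on \<open>p\<close>, the real interpolation method
suffices (\<open>marcinkiewicz\<close>, \<open>marcinkiewicz_infinity\<close>), with the bounds for 2 and 4 themselves used
directly at these two exponents.

For the lower bound, put a tent into each cap whose center satisfies \<open>\<bar>c\<bar> \<le> s/2\<close>, where
\<open>\<delta> powr (\<beta>/2) \<le> s \<le> 1\<close>. The pieces are in phase on a box with sides of order \<open>1/s\<close> and \<open>1/s\<^sup>2\<close>, and each
has the same \<open>L\<^sup>p\<close> norm; comparing the two sides shows that the \<open>p\<close>-th power of the constant is at least
of order \<open>s powr (p - 4) * \<delta> powr (2 + \<beta> - p)\<close> (\<open>tent_example\<close>). The choices \<open>s = \<delta> powr (\<beta>/2)\<close> and \<open>s = 1\<close>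
give the two terms: in the first case the caps fill one flat piece of the neighborhood, in the
second they run along the whole parabola.\<close>

section \<open>Gaussians and their Fourier transforms\<close>

lemma cis_measurable [measurable]: "cis \<in> borel_measurable borel"
  by (intro borel_measurable_continuous_onI continuous_intros)

lemma fst_snd_borel_measurable [measurable]:
  "(fst :: 'a::second_countable_topology \<times> 'b::second_countable_topology \<Rightarrow> 'a) \<in> borel \<rightarrow>\<^sub>M borel"
  "(snd :: 'a::second_countable_topology \<times> 'b::second_countable_topology \<Rightarrow> 'b) \<in> borel \<rightarrow>\<^sub>M borel"
  by (intro borel_measurable_continuous_onI continuous_intros)+

lemma integrable_product_lborel:
  fixes f :: "'a::euclidean_space \<Rightarrow> complex" and g :: "'b::euclidean_space \<Rightarrow> complex"
  assumes f: "integrable lborel f" and g: "integrable lborel g"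
  shows "integrable lborel (\<lambda>z. f (fst z) * g (snd z))"
proof -
  have [measurable]: "f \<in> borel_measurable borel" "g \<in> borel_measurable borel"
    using f g by (auto dest: borel_measurable_integrable)
  have "integrable (lborel \<Otimes>\<^sub>M lborel) (\<lambda>z. f (fst z) * g (snd z))"
    by (rule lborel_pair.Fubini_integrable) (use f g in \<open>auto simp: norm_mult\<close>)
  then show ?thesis by (simp add: lborel_prod)
qed

lemma integral_product_lborel:
  fixes f :: "'a::euclidean_space \<Rightarrow> complex" and g :: "'b::euclidean_space \<Rightarrow> complex"
  assumes f: "integrable lborel f" and g: "integrable lborel g"
  shows "(LINT z|lborel. f (fst z) * g (snd z)) = (LINT x|lborel. f x) * (LINT y|lborel. g y)"
proof -
  have "integrable (lborel \<Otimes>\<^sub>M lborel) (\<lambda>z. f (fst z) * g (snd z))"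
    using integrable_product_lborel[OF f g] by (simp add: lborel_prod)
  from lborel_pair.integral_fst'[OF this] show ?thesis
    by (simp add: lborel_prod)
qed

text \<open>Interchanging the order of integration against an oscillating factor, which is bounded, needs
integrability of the two amplitudes only.\<close>

lemma integral_swap_bounded_kernel:
  fixes a :: "'a::euclidean_space \<Rightarrow> complex" and b :: "'b::euclidean_space \<Rightarrow> complex"
  assumes a: "integrable lborel a" and b: "integrable lborel b"
    and k[measurable]: "(\<lambda>z. k (fst z) (snd z)) \<in> borel_measurable borel"
    and bound: "\<And>x y. norm (k x y :: complex) \<le> C"
  shows "(LINT x|lborel. a x * (LINT y|lborel. b y * k x y))
       = (LINT y|lborel. b y * (LINT x|lborel. a x * k x y))"
proof -
  have ab: "integrable lborel (\<lambda>z. a (fst z) * b (snd z))"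
    by (rule integrable_product_lborel[OF a b])
  then have [measurable]: "(\<lambda>z. a (fst z) * b (snd z)) \<in> borel_measurable borel"
    by (auto dest: borel_measurable_integrable)
  have "integrable lborel (\<lambda>z. a (fst z) * b (snd z) * k (fst z) (snd z))"
  proof (rule Bochner_Integration.integrable_bound[OF integrable_mult_right[OF ab, of "complex_of_real C"]])
    show "AE x in lborel. norm (a (fst x) * b (snd x) * k (fst x) (snd x))
        \<le> norm (complex_of_real C * (a (fst x) * b (snd x)))"
    proof (intro always_eventually allI)
      fix z :: "'a \<times> 'b"
      have "norm (a (fst z) * b (snd z)) * norm (k (fst z) (snd z)) \<le> norm (a (fst z) * b (snd z)) * \<bar>C\<bar>"
        using bound[of "fst z" "snd z"] by (intro mult_left_mono) auto
      then show "norm (a (fst z) * b (snd z) * k (fst z) (snd z))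
          \<le> norm (complex_of_real C * (a (fst z) * b (snd z)))"
        by (simp only: norm_mult norm_of_real mult_ac)
    qed
  qed measurable
  then have "integrable (lborel \<Otimes>\<^sub>M lborel) (case_prod (\<lambda>x y. a x * b y * k x y))"
    by (simp add: lborel_prod case_prod_unfold)
  from lborel_pair.Fubini_integral[OF this, symmetric]
  have "(LINT x|lborel. LINT y|lborel. a x * (b y * k x y))
      = (LINT y|lborel. LINT x|lborel. b y * (a x * k x y))"
    by (simp only: mult_ac)
  then show ?thesis
    by (simp only: Bochner_Integration.integral_mult_right_zero)
qed

text \<open>A rescaling of the characteristic function of the standard normal distribution.\<close>

lemma gaussian_real_fourier:
  fixes e u :: real
  assumes e: "e > 0"
  shows "integrable lborel (\<lambda>t. exp (- (pi * e * t\<^sup>2)))"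
    and "(LINT t|lborel. complex_of_real (exp (- (pi * e * t\<^sup>2))) * cis (2 * pi * (t * u)))
      = complex_of_real (exp (- (pi * u\<^sup>2 / e)) / sqrt e)"
proof -
  define c where "c = sqrt (2 * pi * e)"
  have c: "c > 0" "c\<^sup>2 = 2 * pi * e" using e by (auto simp: c_def)
  have csq: "c = sqrt (2*pi) * sqrt e" by (simp add: c_def real_sqrt_mult)
  have dens: "std_normal_density (0 + c * t) = exp (- (pi * e * t\<^sup>2)) / sqrt (2*pi)" for t
    by (simp add: normal_density_def power_mult_distrib c)
  have "integrable lborel std_normal_density"
    by simp
  then have "integrable lborel (\<lambda>t. std_normal_density (0 + c * t))"
    by (rule lborel_integrable_real_affine) (use c in simp)
  then have "integrable lborel (\<lambda>t. sqrt (2*pi) * (exp (- (pi * e * t\<^sup>2)) / sqrt (2*pi)))"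
    unfolding dens by (rule integrable_mult_right)
  then show "integrable lborel (\<lambda>t. exp (- (pi * e * t\<^sup>2)))" by simp
  define s where "s = 2 * pi * u / c"
  have "complex_of_real (exp (- (s\<^sup>2) / 2)) = char std_normal_distribution s"
    by (simp add: char_std_normal_distribution)
  also have "\<dots> = (LINT x|lborel. std_normal_density x *\<^sub>R iexp (s * x))"
    unfolding char_def by (rule integral_density) (auto simp: normal_density_nonneg)
  also have "\<dots> = \<bar>c\<bar> *\<^sub>R (LINT t|lborel. std_normal_density (0 + c * t) *\<^sub>R iexp (s * (0 + c * t)))"
    by (rule lborel_integral_real_affine) (use c in simp)
  also have "\<dots> = c *\<^sub>R (LINT t|lborel. (1 / sqrt (2*pi))
      * (complex_of_real (exp (- (pi * e * t\<^sup>2))) * cis (2 * pi * (t * u))))"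
    unfolding dens using c by (simp add: s_def cis_conv_exp scaleR_conv_of_real field_simps)
  also have "\<dots> = sqrt e * (LINT t|lborel. (complex_of_real (exp (- (pi * e * t\<^sup>2)))
      * cis (2 * pi * (t * u))))"
    unfolding Bochner_Integration.integral_mult_right_zero using csq by (simp add: scaleR_conv_of_real)
  finally have "(LINT t|lborel. (complex_of_real (exp (- (pi * e * t\<^sup>2))) * cis (2 * pi * (t * u))))
    = complex_of_real (exp (- (s\<^sup>2) / 2) / sqrt e)" using e by (simp add: field_simps)
  moreover have "s\<^sup>2 / 2 = pi * u\<^sup>2 / e"
    unfolding s_def power_divide c power_mult_distrib using e by (simp add: power2_eq_square)
  ultimately show "(LINT t|lborel. complex_of_real (exp (- (pi * e * t\<^sup>2))) * cis (2 * pi * (t * u)))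
      = complex_of_real (exp (- (pi * u\<^sup>2 / e)) / sqrt e)" by simp
qed

text \<open>The parameter multiplies the exponent, so that the Fourier transform of \<open>gaussian e\<close> is an
approximate identity as \<open>e\<close> tends to 0.\<close>

definition gaussian :: "real \<Rightarrow> plane \<Rightarrow> real" where
  "gaussian e x = exp (- (pi * e * (x \<bullet> x)))"

lemma gaussian_measurable [measurable]: "gaussian e \<in> borel_measurable borel"
  unfolding gaussian_def[abs_def] by measurable

lemma gaussian_pos [simp]: "0 < gaussian e x" "0 \<le> gaussian e x"
  by (auto simp: gaussian_def)

lemma gaussian_le_1: "0 \<le> e \<Longrightarrow> gaussian e x \<le> 1"
  by (simp add: gaussian_def)

lemma gaussian_eq: "complex_of_real (gaussian e x) =
    complex_of_real (exp (- (pi * e * (fst x)\<^sup>2))) * complex_of_real (exp (- (pi * e * (snd x)\<^sup>2)))"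
proof -
  have "- (pi * e * (x \<bullet> x)) = - (pi * e * (fst x)\<^sup>2) + - (pi * e * (snd x)\<^sup>2)"
    by (simp add: inner_prod_def power2_eq_square algebra_simps)
  then show ?thesis
    unfolding gaussian_def by (simp only: exp_add of_real_mult)
qed

lemma integrable_gaussian_cis:
  assumes "e > 0"
  shows "integrable lborel (\<lambda>x. complex_of_real (gaussian e x) * cis (r * (x \<bullet> \<xi>)))"
proof (rule Bochner_Integration.integrable_bound)
  show "integrable lborel (\<lambda>x::plane. complex_of_real (exp (- (pi * e * (fst x)\<^sup>2)))
      * complex_of_real (exp (- (pi * e * (snd x)\<^sup>2))))"
    by (rule integrable_product_lborel) (use gaussian_real_fourier(1)[OF assms] in auto)
qed (auto simp: gaussian_eq norm_mult)

lemma integrable_gaussian: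
  assumes "e > 0" shows "integrable lborel (gaussian e)"
  using integrable_norm[OF integrable_gaussian_cis[OF assms, of 0 0]] by simp

lemma gaussian_fourier:
  assumes e: "e > 0"
  shows "(LINT x|lborel. complex_of_real (gaussian e x) * cis (2 * pi * (x \<bullet> \<xi>)))
    = complex_of_real (gaussian (1 / e) \<xi> / e)"
proof -
  let ?g = "\<lambda>u t. complex_of_real (exp (- (pi * e * t\<^sup>2))) * cis (2 * pi * (t * u))"
  have I: "integrable lborel (?g u)" for u
    by (rule Bochner_Integration.integrable_bound[OF gaussian_real_fourier(1)[OF e]])
      (auto simp: norm_mult)
  have "(LINT x|lborel. complex_of_real (gaussian e x) * cis (2 * pi * (x \<bullet> \<xi>)))
      = (LINT x|lborel. ?g (fst \<xi>) (fst x) * ?g (snd \<xi>) (snd x))"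
  proof (intro Bochner_Integration.integral_cong refl)
    fix x :: plane
    have "cis (2 * pi * (x \<bullet> \<xi>)) = cis (2 * pi * (fst x * fst \<xi>)) * cis (2 * pi * (snd x * snd \<xi>))"
      by (simp add: cis_mult inner_prod_def ring_distribs)
    then show "complex_of_real (gaussian e x) * cis (2 * pi * (x \<bullet> \<xi>)) = ?g (fst \<xi>) (fst x)
        * ?g (snd \<xi>) (snd x)"
      by (simp only: gaussian_eq mult_ac)
  qed
  also have "\<dots> = (LINT t|lborel. ?g (fst \<xi>) t) * (LINT t|lborel. ?g (snd \<xi>) t)"
    by (rule integral_product_lborel[OF I I])
  also have "\<dots> = complex_of_real (gaussian (1 / e) \<xi> / e)"
  proof -
    have "- (pi * (1 / e) * (\<xi> \<bullet> \<xi>)) = - (pi * (fst \<xi>)\<^sup>2 / e) + - (pi * (snd \<xi>)\<^sup>2 / e)"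
      by (simp add: inner_prod_def power2_eq_square algebra_simps add_divide_distrib)
    then have "gaussian (1 / e) \<xi> = exp (- (pi * (fst \<xi>)\<^sup>2 / e)) * exp (- (pi * (snd \<xi>)\<^sup>2 / e))"
      unfolding gaussian_def by (simp only: exp_add)
    moreover have "sqrt e * sqrt e = e" using e by simp
    ultimately show ?thesis
      unfolding gaussian_real_fourier(2)[OF e] by (simp flip: of_real_mult)
  qed
  finally show ?thesis .
qed

section \<open>Fourier inversion\<close>

lemma norm_gaussian [simp]: "norm (complex_of_real (gaussian e x)) = gaussian e x"
  by simp

lemma gaussian_minus [simp]: "gaussian e (- x) = gaussian e x"
  by (simp add: gaussian_def)

lemma gaussian_diff_commute: "gaussian e (x - y) = gaussian e (y - x)"
  using gaussian_minus[of e "x - y"] by simp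

lemma integrable_plane_affine:
  fixes f :: "plane \<Rightarrow> 'b::{banach, second_countable_topology}"
  assumes f: "integrable lborel f" and c: "c \<noteq> 0"
  shows "integrable lborel (\<lambda>x. f (t + c *\<^sub>R x))"
proof -
  have "integrable (density (distr lborel borel (\<lambda>x. t + c *\<^sub>R x)) (\<lambda>_. ennreal (\<bar>c\<bar>^DIM(plane)))) f"
    using f lborel_affine[OF c, of t] by simp
  then have "integrable (distr lborel borel (\<lambda>x::plane. t + c *\<^sub>R x)) (\<lambda>x. \<bar>c\<bar>^DIM(plane) *\<^sub>R f x)"
    using borel_measurable_integrable[OF f] by (subst (asm) integrable_density) auto
  then have "integrable lborel (\<lambda>x. \<bar>c\<bar>^DIM(plane) *\<^sub>R f (t + c *\<^sub>R x))"
    using borel_measurable_integrable[OF f] by (subst (asm) integrable_distr_eq) auto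
  then have "integrable lborel (\<lambda>x. (1 / \<bar>c\<bar>^DIM(plane)) *\<^sub>R \<bar>c\<bar>^DIM(plane) *\<^sub>R f (t + c *\<^sub>R x))"
    by (rule integrable_scaleR_right)
  moreover have "(1 / k) *\<^sub>R k *\<^sub>R v = v" if "k \<noteq> 0" for k and v :: 'b
    using that by simp
  moreover have "\<bar>c\<bar>^DIM(plane) \<noteq> 0" using c by simp
  ultimately show ?thesis by (simp only: not_False_eq_True)
qed

lemma integral_plane_affine:
  fixes f :: "plane \<Rightarrow> 'b::{banach, second_countable_topology}"
  assumes f[measurable]: "f \<in> borel_measurable borel" and c: "c \<noteq> 0"
  shows "(LINT x|lborel. f x) = c\<^sup>2 *\<^sub>R (LINT x|lborel. f (t + c *\<^sub>R x))"
proof -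
  have "(LINT x|lborel. f x) = integral\<^sup>L (density (distr lborel borel (\<lambda>x. t + c *\<^sub>R x))
      (\<lambda>_. ennreal (\<bar>c\<bar>^DIM(plane)))) f"
    using lborel_affine[OF c, of t] by simp
  also have "\<dots> = integral\<^sup>L (distr lborel borel (\<lambda>x::plane. t + c *\<^sub>R x)) (\<lambda>x. \<bar>c\<bar>^DIM(plane) *\<^sub>R f x)"
    by (subst integral_density) auto
  also have "\<dots> = c\<^sup>2 *\<^sub>R (LINT x|lborel. f (t + c *\<^sub>R x))"
    by (subst integral_distr) (auto simp: power2_eq_square)
  finally show ?thesis .
qed

lemma integral_gaussian: "e > 0 \<Longrightarrow> (LINT x|lborel. gaussian e x) = 1 / e"
  using gaussian_fourier[of e 0]
  by (simp add: gaussian_def flip: of_real_eq_iff[where 'a=complex])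

text \<open>In the rescaled variable \<open>(\<xi> - \<eta>) / sqrt e\<close> the Gaussian weight is fixed, and dominated
convergence applies.\<close>

lemma gaussian_average_tendsto:
  fixes h :: "plane \<Rightarrow> complex"
  assumes cont: "continuous_on UNIV h" and bound: "\<And>x. norm (h x) \<le> M"
    and e: "\<And>n. e n > 0" "e \<longlonglongrightarrow> 0"
  shows "(\<lambda>n. LINT \<xi>|lborel. h \<xi> * complex_of_real (gaussian (1 / e n) (\<xi> - \<eta>) / e n))
    \<longlonglongrightarrow> h \<eta>"
proof -
  have [measurable]: "h \<in> borel_measurable borel"
    using cont by (rule borel_measurable_continuous_onI)
  have eq: "(LINT \<xi>|lborel. h \<xi> * complex_of_real (gaussian (1 / e n) (\<xi> - \<eta>) / e n))
      = (LINT x|lborel. h (\<eta> + sqrt (e n) *\<^sub>R x) * complex_of_real (gaussian 1 x))" for n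
  proof -
    have "(LINT \<xi>|lborel. h \<xi> * complex_of_real (gaussian (1 / e n) (\<xi> - \<eta>) / e n))
      = (sqrt (e n))\<^sup>2 *\<^sub>R (LINT x|lborel. h (\<eta> + sqrt (e n) *\<^sub>R x) *
          complex_of_real (gaussian (1 / e n) ((\<eta> + sqrt (e n) *\<^sub>R x) - \<eta>) / e n))"
      by (rule integral_plane_affine) (use e(1)[of n] in auto)
    also have "\<dots> = e n *\<^sub>R (LINT x|lborel. (1 / e n) *\<^sub>R
        (h (\<eta> + sqrt (e n) *\<^sub>R x) * complex_of_real (gaussian 1 x)))"
      using e(1)[of n] by (simp add: gaussian_def scaleR_conv_of_real field_simps)
    also have "\<dots> = (LINT x|lborel. h (\<eta> + sqrt (e n) *\<^sub>R x) * complex_of_real (gaussian 1 x))"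
      using e(1)[of n] by (simp only: integral_scaleR_right) simp
    finally show ?thesis .
  qed
  have "(\<lambda>n. LINT x|lborel. h (\<eta> + sqrt (e n) *\<^sub>R x) * complex_of_real (gaussian 1 x))
      \<longlonglongrightarrow> (LINT x|lborel. h \<eta> * complex_of_real (gaussian 1 x))"
  proof (rule integral_dominated_convergence[where w="\<lambda>x. M * gaussian 1 x"])
    show "integrable lborel (\<lambda>x. M * gaussian 1 x)"
      using integrable_gaussian by simp
    show "AE x in lborel. (\<lambda>n. h (\<eta> + sqrt (e n) *\<^sub>R x) * complex_of_real (gaussian 1 x))
        \<longlonglongrightarrow> h \<eta> * complex_of_real (gaussian 1 x)"
    proof (intro always_eventually allI tendsto_mult tendsto_const)
      fix x
      have "(\<lambda>n. \<eta> + sqrt (e n) *\<^sub>R x) \<longlonglongrightarrow> \<eta> + sqrt 0 *\<^sub>R x"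
        by (intro tendsto_intros e)
      then show "(\<lambda>n. h (\<eta> + sqrt (e n) *\<^sub>R x)) \<longlonglongrightarrow> h \<eta>"
        using cont by (intro isCont_tendsto_compose[of _ h])
            (simp_all add: continuous_on_eq_continuous_at del: split_paired_All)
    qed
    show "AE x in lborel. norm (h (\<eta> + sqrt (e n) *\<^sub>R x) * complex_of_real (gaussian 1 x))
        \<le> M * gaussian 1 x" for n
      by (intro always_eventually allI) (simp add: norm_mult bound mult_right_mono)
  qed measurable
  also have "(LINT x|lborel. h \<eta> * complex_of_real (gaussian 1 x)) = h \<eta>"
    using integral_gaussian[of 1] by simp
  finally show ?thesis unfolding eq .
qed

lemma integrable_mult_cis:
  fixes F :: "'a::euclidean_space \<Rightarrow> complex"
  assumes F: "integrable lborel F" and g[measurable]: "g \<in> borel_measurable borel"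
  shows "integrable lborel (\<lambda>\<xi>. F \<xi> * cis (g \<xi>))"
  using borel_measurable_integrable[OF F]
  by (intro Bochner_Integration.integrable_bound[OF F]) (auto simp: norm_mult)

lemma inv_fourier_measurable [measurable]:
  assumes F: "integrable lborel F" shows "inv_fourier F \<in> borel_measurable borel"
proof -
  have [measurable]: "F \<in> borel_measurable borel" using F by auto
  show ?thesis unfolding inv_fourier_def[abs_def] by measurable
qed

lemma norm_inv_fourier_le:
  assumes F: "integrable lborel F" shows "norm (inv_fourier F x) \<le> (LINT \<xi>|lborel. norm (F \<xi>))"
  unfolding inv_fourier_def by (rule order_trans[OF integral_norm_bound]) (simp add: norm_mult)

lemma integrable_gaussian_mult:
  assumes e: "e > 0" and f[measurable]: "f \<in> borel_measurable borel" and b: "\<And>x. norm (f x :: complex) \<le> M"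
  shows "integrable lborel (\<lambda>x. f x * complex_of_real (gaussian e x))"
proof (rule Bochner_Integration.integrable_bound)
  show "integrable lborel (\<lambda>x. M * gaussian e x)" using integrable_gaussian[OF e] by simp
  show "AE x in lborel. norm (f x * complex_of_real (gaussian e x)) \<le> norm (M * gaussian e x)"
    using b by (intro always_eventually allI) (auto simp: norm_mult abs_mult intro!: mult_right_mono
        order_trans[OF b])
qed measurable

text \<open>Regularizing \<open>inv_fourier F\<close> by a Gaussian makes its Fourier integral converge, at the price of
averaging \<open>F\<close>. All facts about inversion below come from this identity as \<open>e\<close> tends to 0.\<close>

lemma inv_fourier_gaussian:
  assumes F: "integrable lborel F" and e: "e > 0"
  shows "(LINT x|lborel. inv_fourier F x * (complex_of_real (gaussian e x) * cis (- 2 * pi * (x \<bullet> \<eta>))))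
    = (LINT \<xi>|lborel. F \<xi> * complex_of_real (gaussian (1 / e) (\<xi> - \<eta>) / e))"
proof -
  let ?g = "\<lambda>x. complex_of_real (gaussian e x) * cis (- 2 * pi * (x \<bullet> \<eta>))"
  have "(LINT x|lborel. inv_fourier F x * ?g x)
      = (LINT x|lborel. ?g x * (LINT \<xi>|lborel. F \<xi> * cis (2 * pi * (x \<bullet> \<xi>))))"
    by (simp add: inv_fourier_def mult_ac)
  also have "\<dots> = (LINT \<xi>|lborel. F \<xi> * (LINT x|lborel. ?g x * cis (2 * pi * (x \<bullet> \<xi>))))"
    by (rule integral_swap_bounded_kernel[where C=1])
      (use F integrable_gaussian_cis[OF e, of "- 2 * pi" \<eta>] in auto)
  also have "(\<lambda>\<xi>. LINT x|lborel. ?g x * cis (2 * pi * (x \<bullet> \<xi>)))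
      = (\<lambda>\<xi>. complex_of_real (gaussian (1 / e) (\<xi> - \<eta>) / e))"
  proof
    fix \<xi>
    have "?g x * cis (2 * pi * (x \<bullet> \<xi>)) = complex_of_real (gaussian e x) * cis (2 * pi * (x \<bullet> (\<xi> - \<eta>)))" for x
    proof -
      have "cis (- 2 * pi * (x \<bullet> \<eta>)) * cis (2 * pi * (x \<bullet> \<xi>)) = cis (2 * pi * (x \<bullet> (\<xi> - \<eta>)))"
        unfolding cis_mult by (simp add: inner_diff_right algebra_simps)
      then show ?thesis by (simp only: mult.assoc)
    qed
    then show "(LINT x|lborel. ?g x * cis (2 * pi * (x \<bullet> \<xi>)))
        = complex_of_real (gaussian (1 / e) (\<xi> - \<eta>) / e)"
      using gaussian_fourier[OF e, of "\<xi> - \<eta>"] by (simp only:)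
  qed
  finally show ?thesis .
qed

lemma gaussian_tendsto_1:
  assumes "e \<longlonglongrightarrow> 0" shows "(\<lambda>n. gaussian (e n) x) \<longlonglongrightarrow> 1"
proof -
  have "(\<lambda>n. exp (- (pi * e n * (x \<bullet> x)))) \<longlonglongrightarrow> exp (- (pi * 0 * (x \<bullet> x)))"
    by (intro tendsto_intros assms)
  then show ?thesis by (simp add: gaussian_def)
qed

lemma integral_gaussian_regularisation:
  fixes H :: "plane \<Rightarrow> complex"
  assumes H: "integrable lborel H" and e: "\<And>n. e n > 0" "e \<longlonglongrightarrow> 0"
  shows "(\<lambda>n. LINT x|lborel. H x * complex_of_real (gaussian (e n) x)) \<longlonglongrightarrow> (LINT x|lborel. H x)"
proof (rule integral_dominated_convergence[where w="\<lambda>x. norm (H x)"])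
  have [measurable]: "H \<in> borel_measurable borel" using H by auto
  show "(\<lambda>x. H x * complex_of_real (gaussian (e n) x)) \<in> borel_measurable lborel" for n
    by measurable
  show "integrable lborel (\<lambda>x. norm (H x))" "H \<in> borel_measurable lborel" using H by auto
  show "AE x in lborel. (\<lambda>n. H x * complex_of_real (gaussian (e n) x)) \<longlonglongrightarrow> H x"
  proof (intro always_eventually allI)
    fix x
    have "(\<lambda>n. H x * complex_of_real (gaussian (e n) x)) \<longlonglongrightarrow> H x * complex_of_real 1"
      by (intro tendsto_intros gaussian_tendsto_1 e)
    then show "(\<lambda>n. H x * complex_of_real (gaussian (e n) x)) \<longlonglongrightarrow> H x" by simp
  qed
  show "AE x in lborel. norm (H x * complex_of_real (gaussian (e n) x)) \<le> norm (H x)" for n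
    using gaussian_le_1[of "e n"] e(1)[of n]
    by (intro always_eventually allI) (auto simp: norm_mult intro!: mult_left_le)
qed

lemma fourier_inv_fourier:
  assumes F: "integrable lborel F" and cont: "continuous_on UNIV F" and bound: "\<And>x. norm (F x) \<le> M"
    and G: "integrable lborel (inv_fourier F)"
  shows "fourier (inv_fourier F) \<eta> = F \<eta>"
proof -
  define e where "e n = 1 / real (Suc n)" for n
  have e: "e n > 0" "e \<longlonglongrightarrow> 0" for n
    unfolding e_def[abs_def] using LIMSEQ_inverse_real_of_nat by (auto simp: inverse_eq_divide)
  have "integrable lborel (\<lambda>x. inv_fourier F x * cis (- 2 * pi * (x \<bullet> \<eta>)))"
    by (rule integrable_mult_cis[OF G]) measurable
  from integral_gaussian_regularisation[OF this e]
  have "(\<lambda>n. LINT x|lborel. inv_fourier F x * (complex_of_real (gaussian (e n) x) * cis (- 2 * pi * (x \<bullet> \<eta>))))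
      \<longlonglongrightarrow> fourier (inv_fourier F) \<eta>"
    unfolding fourier_def by (simp only: mult_ac)
  then have "(\<lambda>n. LINT \<xi>|lborel. F \<xi> * complex_of_real (gaussian (1 / e n) (\<xi> - \<eta>) / e n))
      \<longlonglongrightarrow> fourier (inv_fourier F) \<eta>"
    unfolding inv_fourier_gaussian[OF F e(1)] .
  moreover have "(\<lambda>n. LINT \<xi>|lborel. F \<xi> * complex_of_real (gaussian (1 / e n) (\<xi> - \<eta>) / e n))
      \<longlonglongrightarrow> F \<eta>"
    by (rule gaussian_average_tendsto[OF cont bound e])
  ultimately show ?thesis by (rule LIMSEQ_unique)
qed

section \<open>Uniqueness of the Fourier transform\<close>

text \<open>A translated Gaussian is a superposition of characters.\<close>

lemma fourier_zero_imp_gaussian_average_zero: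
  assumes u: "integrable lborel u" and zero: "\<And>\<eta>. fourier u \<eta> = 0" and e: "e > 0"
  shows "(LINT x|lborel. u x * complex_of_real (gaussian (1 / e) (x - y) / e)) = 0"
proof -
  let ?g = "\<lambda>\<eta>. complex_of_real (gaussian e \<eta>) * cis (2 * pi * (\<eta> \<bullet> y))"
  have G: "complex_of_real (gaussian (1 / e) (x - y) / e)
      = (LINT \<eta>|lborel. ?g \<eta> * cis (- 2 * pi * (x \<bullet> \<eta>)))" for x
  proof -
    have "?g \<eta> * cis (- 2 * pi * (x \<bullet> \<eta>)) = complex_of_real (gaussian e \<eta>) * cis (2 * pi * (\<eta> \<bullet> (y - x)))"
        for \<eta>
    proof -
      have "cis (2 * pi * (\<eta> \<bullet> y)) * cis (- 2 * pi * (x \<bullet> \<eta>)) = cis (2 * pi * (\<eta> \<bullet> (y - x)))"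
        unfolding cis_mult by (simp add: inner_diff_right algebra_simps inner_commute)
      then show ?thesis by (simp only: mult.assoc)
    qed
    then show ?thesis
      using gaussian_fourier[OF e, of "y - x"] by (simp only: gaussian_diff_commute[of _ x y])
  qed
  have "(LINT x|lborel. u x * complex_of_real (gaussian (1 / e) (x - y) / e))
      = (LINT \<eta>|lborel. ?g \<eta> * (LINT x|lborel. u x * cis (- 2 * pi * (x \<bullet> \<eta>))))"
    unfolding G by (rule integral_swap_bounded_kernel[where C=1])
      (use u integrable_gaussian_cis[OF e, of "2 * pi" y] in auto)
  also have "\<dots> = 0" using zero by (simp add: fourier_def)
  finally show ?thesis .
qed

text \<open>The Gaussian averages of \<open>h\<close> are orthogonal to \<open>u\<close> by the preceding lemma, and converge to \<open>h\<close>
boundedly.\<close>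

lemma fourier_zero_imp_test_zero:
  assumes u: "integrable lborel u" and zero: "\<And>\<eta>. fourier u \<eta> = 0"
    and h: "integrable lborel h" and cont: "continuous_on UNIV h" and bound: "\<And>x. norm (h x) \<le> M"
  shows "(LINT x|lborel. u x * h x) = 0"
proof -
  define e where "e n = 1 / real (Suc n)" for n
  have e: "e n > 0" "e \<longlonglongrightarrow> 0" for n
    unfolding e_def[abs_def] using LIMSEQ_inverse_real_of_nat by (auto simp: inverse_eq_divide)
  have [measurable]: "u \<in> borel_measurable borel" "h \<in> borel_measurable borel" using u h by auto
  let ?G = "\<lambda>n x y. complex_of_real (gaussian (1 / e n) (y - x) / e n)"
  have M: "0 \<le> M" using bound[of undefined] norm_ge_zero order_trans by blast
  have "(\<lambda>n. LINT x|lborel. u x * (LINT y|lborel. h y * ?G n x y)) \<longlonglongrightarrow> (LINT x|lborel. u x * h x)"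
  proof (rule integral_dominated_convergence[where w="\<lambda>x. norm (u x) * M"])
    show "integrable lborel (\<lambda>x. norm (u x) * M)" using u by simp
    show "AE x in lborel. (\<lambda>n. u x * (LINT y|lborel. h y * ?G n x y)) \<longlonglongrightarrow> u x * h x"
      by (intro always_eventually allI tendsto_mult tendsto_const gaussian_average_tendsto[OF cont bound e])
    show "AE x in lborel. norm (u x * (LINT y|lborel. h y * ?G n x y)) \<le> norm (u x) * M" for n
    proof (intro always_eventually allI)
      fix x
      have shift: "integrable lborel (\<lambda>y. gaussian (1 / e n) (y - x))"
        using integrable_plane_affine[OF integrable_gaussian[of "1 / e n"], of 1 "- x"] e(1)[of n] by simp
      have "norm (LINT y|lborel. h y * ?G n x y) \<le> (LINT y|lborel. norm (h y * ?G n x y))"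
        by (rule integral_norm_bound)
      also have "\<dots> \<le> (LINT y|lborel. M * gaussian (1 / e n) (y - x) / e n)"
      proof (rule integral_mono)
        show "integrable lborel (\<lambda>y. M * gaussian (1 / e n) (y - x) / e n)"
          using shift by simp
        show "norm (h y * ?G n x y) \<le> M * gaussian (1 / e n) (y - x) / e n" for y
          using e(1)[of n] bound[of y] by (auto simp: norm_mult norm_divide intro!: divide_right_mono
              mult_right_mono)
        then show "integrable lborel (\<lambda>y. norm (h y * ?G n x y))"
          using e(1)[of n] M
          by (intro Bochner_Integration.integrable_bound[OF
              \<open>integrable lborel (\<lambda>y. M * gaussian (1 / e n) (y - x) / e n)\<close>])
            (auto intro!: always_eventually)
      qed
      also have "\<dots> = M * (LINT y|lborel. gaussian (1 / e n) (y - x)) / e n" by simp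
      also have "(LINT y|lborel. gaussian (1 / e n) (y - x)) = e n"
        using integral_plane_affine[of "gaussian (1 / e n)" 1 "- x"] integral_gaussian[of "1 / e n"]
            e(1)[of n]
        by simp
      finally have "norm (LINT y|lborel. h y * ?G n x y) \<le> M" using e(1)[of n] by simp
      then show "norm (u x * (LINT y|lborel. h y * ?G n x y)) \<le> norm (u x) * M"
        by (simp only: norm_mult mult_left_mono norm_ge_zero)
    qed
  qed measurable
  moreover have "(LINT x|lborel. u x * (LINT y|lborel. h y * ?G n x y)) = 0" for n
  proof -
    have "(LINT x|lborel. u x * (LINT y|lborel. h y * ?G n x y))
        = (LINT y|lborel. h y * (LINT x|lborel. u x * ?G n x y))"
    proof (rule integral_swap_bounded_kernel[where C="1 / e n"])
      show "norm (?G n x y) \<le> 1 / e n" for x y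
        using gaussian_le_1[of "1 / e n" "y - x"] e(1)[of n] by (auto simp: norm_divide divide_right_mono)
    qed (use u h in auto)
    also have "\<dots> = (LINT y|lborel. h y * 0)"
    proof (intro Bochner_Integration.integral_cong refl arg_cong[where f="\<lambda>z. h _ * z"])
      fix y
      have "(LINT x|lborel. u x * ?G n x y)
          = (LINT x|lborel. u x * complex_of_real (gaussian (1 / e n) (x - y) / e n))"
        by (intro Bochner_Integration.integral_cong refl) (subst gaussian_diff_commute, rule refl)
      also have "\<dots> = 0"
        by (rule fourier_zero_imp_gaussian_average_zero[OF u zero e(1)])
      finally show "(LINT x|lborel. u x * ?G n x y) = 0" .
    qed
    finally show ?thesis by (simp only: mult_zero_right Bochner_Integration.integral_zero)
  qed
  ultimately show ?thesis by (simp only: LIMSEQ_const_iff)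
qed

text \<open>The indicator of an open set is an increasing limit of continuous functions.\<close>

lemma fourier_zero_imp_open_integral_zero:
  assumes u: "integrable lborel u" and zero: "\<And>\<eta>. fourier u \<eta> = 0"
    and U: "open U" "bounded (U :: plane set)"
  shows "(LINT x|lborel. u x * indicator U x) = 0"
proof -
  define h where "h n x = min 1 (real n * infdist x (- U))" for n x
  have ne: "- U \<noteq> {}" using U(2) by (metis double_compl Compl_empty_eq not_bounded_UNIV)
  have cl: "closed (- U)" using U(1) by (rule closed_Compl)
  have cont: "continuous_on UNIV (h n)" for n
    unfolding h_def by (intro continuous_intros)
  have h01: "0 \<le> h n x" "h n x \<le> 1" "x \<notin> U \<Longrightarrow> h n x = 0" for n x
    by (auto simp: h_def infdist_nonneg)
  have [measurable]: "h n \<in> borel_measurable borel" for n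
    using cont by (rule borel_measurable_continuous_onI)
  have [measurable]: "u \<in> borel_measurable borel" using u by auto
  have [measurable]: "U \<in> sets borel" using U(1) by simp
  have intU: "integrable lborel (\<lambda>x. indicator U x :: real)"
    using emeasure_bounded_finite[OF U(2)] by (simp add: integrable_indicator_iff)
  have inth: "integrable lborel (\<lambda>x. complex_of_real (h n x))" for n
    by (rule Bochner_Integration.integrable_bound[OF intU])
      (use h01 in \<open>auto simp: indicator_def intro!: always_eventually\<close>)
  have lim: "(\<lambda>n. h n x) \<longlonglongrightarrow> indicator U x" for x
  proof (cases "x \<in> U")
    case True
    then have pos: "infdist x (- U) > 0"
      using infdist_pos_not_in_closed[OF cl ne] by simp
    then obtain N where N: "1 / infdist x (- U) < real N" using reals_Archimedean2 by blast
    have "h n x = 1" if "n \<ge> N" for n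
    proof -
      have "1 / infdist x (- U) \<le> real n" using N that by linarith
      then show ?thesis using pos by (simp add: h_def divide_simps mult.commute)
    qed
    then show ?thesis using True
      by (intro tendsto_eventually eventually_sequentiallyI[of N]) auto
  qed (use h01 in simp)
  have "(\<lambda>n. LINT x|lborel. u x * complex_of_real (h n x))
      \<longlonglongrightarrow> (LINT x|lborel. u x * complex_of_real (indicator U x))"
  proof (rule integral_dominated_convergence[where w="\<lambda>x. norm (u x)"])
    show "AE x in lborel. (\<lambda>n. u x * complex_of_real (h n x)) \<longlonglongrightarrow> u x * complex_of_real (indicator U x)"
      by (intro always_eventually allI tendsto_intros lim)
    show "AE x in lborel. norm (u x * complex_of_real (h n x)) \<le> norm (u x)" for n
      using h01 by (intro always_eventually allI) (auto simp: norm_mult intro!: mult_left_le)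
  qed (use u in auto)
  moreover have "(LINT x|lborel. u x * complex_of_real (h n x)) = 0" for n
    by (rule fourier_zero_imp_test_zero[OF u zero inth, where M=1])
      (use cont h01 in \<open>auto intro!: continuous_intros\<close>)
  ultimately have "(LINT x|lborel. u x * complex_of_real (indicator U x)) = 0"
    by (simp only: LIMSEQ_const_iff)
  moreover have "complex_of_real (indicator U x) = indicator U x" for x
    by (simp add: indicator_def)
  ultimately show ?thesis by simp
qed

text \<open>Uniqueness for integrable functions: the integrals of \<open>u\<close> over boxes vanish, and boxes generate
the Borel sets.\<close>

lemma fourier_zero_imp_AE_zero:
  assumes u: "integrable lborel u" and zero: "\<And>\<eta>. fourier u \<eta> = 0"
  shows "AE x in lborel. u x = 0"
proof (rule sigma_finite_measure.density_zero[OF sigma_finite_lborel u])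
  have [measurable]: "u \<in> borel_measurable borel" using u by auto
  have intA: "integrable lborel (\<lambda>x. u x * indicator A x)" if [measurable]: "A \<in> sets borel" for A
    by (rule Bochner_Integration.integrable_bound[OF u])
      (auto simp: norm_mult indicator_def)
  have box: "(LINT x|lborel. u x * indicator (box a b) x) = 0" for a b :: plane
    by (rule fourier_zero_imp_open_integral_zero[OF u zero]) (auto simp: open_box bounded_box)
  have UNIV: "(LINT x|lborel. u x) = 0"
    using zero[of 0] by (simp add: fourier_def)
  fix A :: "plane set" assume "A \<in> sets lborel"
  have "Int_stable (range (\<lambda>(a, b). box a b :: plane set))"
    by (auto simp: Int_stable_def box_Int_box)
  moreover have "range (\<lambda>(a, b). box a b) \<subseteq> Pow (UNIV :: plane set)" by simp
  moreover have "A \<in> sigma_sets UNIV (range (\<lambda>(a, b). box a b))"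
    using \<open>A \<in> sets lborel\<close> by (simp add: borel_eq_box)
  ultimately have "(LINT x|lborel. u x * indicator A x) = 0"
  proof (induct rule: sigma_sets_induct_disjoint)
    case (basic A)
    then show ?case using box by auto
  next
    case empty
    show ?case by simp
  next
    case (compl A)
    then have [measurable]: "A \<in> sets borel" by (simp add: borel_eq_box)
    have "(LINT x|lborel. u x * indicator (UNIV - A) x) = (LINT x|lborel. u x - u x * indicator A x)"
      by (intro Bochner_Integration.integral_cong) (auto simp: indicator_def)
    also have "\<dots> = 0" using UNIV compl u intA[of A] by simp
    finally show ?case .
  next
    case (union A)
    then have [measurable]: "A i \<in> sets borel" for i by (auto simp: borel_eq_box)
    have "(\<lambda>x. indicator (\<Union>i. A i) x *\<^sub>R u x) = (\<lambda>x. u x * indicator (\<Union>i. A i) x)"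
      by (auto simp: indicator_def)
    then have "set_integrable lborel (\<Union>i. A i) u"
      using intA[of "\<Union>i. A i"] by (simp only: set_integrable_def) simp
    then have "(LINT x:(\<Union>i. A i)|lborel. u x) = (\<Sum>i. (LINT x:A i|lborel. u x))"
      using union(1) by (intro lebesgue_integral_countable_add) (auto simp: disjoint_family_on_def)
    moreover have "(LINT x:B|lborel. u x) = (LINT x|lborel. u x * indicator B x)" for B
      unfolding set_lebesgue_integral_def by (intro Bochner_Integration.integral_cong)
          (auto simp: indicator_def)
    ultimately show ?case using union(3) by simp
  qed
  moreover have "(LINT x:A|lborel. u x) = (LINT x|lborel. u x * indicator A x)"
    unfolding set_lebesgue_integral_def by (intro Bochner_Integration.integral_cong)
        (auto simp: indicator_def)
  ultimately show "(LINT x:A|lborel. u x) = 0" by simp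
qed

text \<open>Hermite polynomials up to normalization: the factors in front of \<open>exp (- \<pi> t\<^sup>2)\<close> in its
successive derivatives. They provide the family of derivatives that a Schwartz function has to come
with.\<close>

fun gauss_poly :: "nat \<Rightarrow> real poly" where
  "gauss_poly 0 = 1"
| "gauss_poly (Suc n) = pderiv (gauss_poly n) - [:0, 2 * pi:] * gauss_poly n"

definition gauss_deriv :: "nat \<Rightarrow> real \<Rightarrow> real" where
  "gauss_deriv n t = poly (gauss_poly n) t * exp (- (pi * t\<^sup>2))"

lemma DERIV_gauss_deriv: "(gauss_deriv n has_real_derivative gauss_deriv (Suc n) t) (at t)"
proof -
  have "((\<lambda>t. poly (gauss_poly n) t * exp (- (pi * t\<^sup>2))) has_real_derivative
      (poly (pderiv (gauss_poly n)) t * exp (- (pi * t\<^sup>2))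
        + poly (gauss_poly n) t * (exp (- (pi * t\<^sup>2)) * (- (pi * (2 * t)))))) (at t)"
    by (auto intro!: derivative_eq_intros)
  then show ?thesis
    unfolding gauss_deriv_def[abs_def] by (simp add: algebra_simps)
qed

lemma poly_bound: "\<exists>C k. \<forall>t::real. \<bar>poly P t\<bar> \<le> C * (1 + \<bar>t\<bar>) ^ k"
proof (induction P)
  case 0
  show ?case by (rule exI[of _ 0]) simp
next
  case (pCons a P)
  then obtain C k where C: "\<bar>poly P t\<bar> \<le> C * (1 + \<bar>t\<bar>) ^ k" for t by blast
  have "\<bar>poly (pCons a P) t\<bar> \<le> (\<bar>a\<bar> + C) * (1 + \<bar>t\<bar>) ^ Suc k" for t
  proof -
    have "\<bar>poly (pCons a P) t\<bar> \<le> \<bar>a\<bar> + \<bar>t\<bar> * \<bar>poly P t\<bar>"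
      by (simp add: abs_mult[symmetric])
    also have "\<dots> \<le> \<bar>a\<bar> * (1 + \<bar>t\<bar>) ^ Suc k + (1 + \<bar>t\<bar>) * (C * (1 + \<bar>t\<bar>) ^ k)"
    proof (rule add_mono)
      show "\<bar>a\<bar> \<le> \<bar>a\<bar> * (1 + \<bar>t\<bar>) ^ Suc k"
        using one_le_power[of "1 + \<bar>t\<bar>" "Suc k"] by (intro mult_le_cancel_left1[THEN iffD2]) auto
      show "\<bar>t\<bar> * \<bar>poly P t\<bar> \<le> (1 + \<bar>t\<bar>) * (C * (1 + \<bar>t\<bar>) ^ k)"
        using C[of t] by (intro mult_mono) auto
    qed
    finally show ?thesis by (simp add: algebra_simps)
  qed
  then show ?case by blast
qed

lemma gauss_deriv_bound: "\<exists>C. \<forall>t. (1 + \<bar>t\<bar>) ^ n * \<bar>gauss_deriv m t\<bar> \<le> C"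
proof -
  obtain C k where C: "\<bar>poly (gauss_poly m) t\<bar> \<le> C * (1 + \<bar>t\<bar>) ^ k" for t using poly_bound by blast
  have C0: "0 \<le> C" using C[of 0] by auto
  let ?N = "real (n + k)"
  have "(1 + \<bar>t\<bar>) ^ n * \<bar>gauss_deriv m t\<bar> \<le> C * exp (?N\<^sup>2)" for t
  proof -
    have "(1 + \<bar>t\<bar>) ^ n * \<bar>gauss_deriv m t\<bar> = (1 + \<bar>t\<bar>) ^ n * \<bar>poly (gauss_poly m) t\<bar> * exp (- (pi * t\<^sup>2))"
      by (simp add: gauss_deriv_def abs_mult)
    also have "\<dots> \<le> (1 + \<bar>t\<bar>) ^ n * (C * (1 + \<bar>t\<bar>) ^ k) * exp (- (pi * t\<^sup>2))"
      by (intro mult_right_mono mult_left_mono C) auto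
    also have "\<dots> = C * ((1 + \<bar>t\<bar>) ^ (n + k) * exp (- (pi * t\<^sup>2)))"
      by (simp add: power_add)
    also have "\<dots> \<le> C * (exp \<bar>t\<bar> ^ (n + k) * exp (- (pi * t\<^sup>2)))"
      by (intro mult_left_mono mult_right_mono power_mono exp_ge_add_one_self C0) auto
    also have "\<dots> = C * exp (?N * \<bar>t\<bar> - pi * t\<^sup>2)"
      by (simp only: exp_diff exp_minus exp_of_nat_mult[symmetric]) (simp add: field_simps)
    also have "\<dots> \<le> C * exp (?N\<^sup>2)"
    proof -
      have "?N * \<bar>t\<bar> - pi * t\<^sup>2 \<le> ?N * \<bar>t\<bar> - t\<^sup>2"
        using pi_gt3 mult_right_mono[of 1 pi "t\<^sup>2"] by simp
      also have "\<dots> \<le> ?N\<^sup>2"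
        using zero_le_power2[of "?N - \<bar>t\<bar>"] zero_le_power2[of ?N] zero_le_power2[of "\<bar>t\<bar>"]
        unfolding power2_diff power2_abs by linarith
      finally show ?thesis using C0 by (intro mult_left_mono) auto
    qed
    finally show ?thesis .
  qed
  then show ?thesis by blast
qed

lemma schwartz_gaussian: "schwartz (\<lambda>\<xi>. complex_of_real (gaussian 1 (\<xi> - y)))"
  unfolding schwartz_def
proof (intro exI[of _ "\<lambda>i j \<xi>. complex_of_real (gauss_deriv i (fst \<xi> - fst y) * gauss_deriv j (snd \<xi> - snd y))"] conjI allI)
  show "(\<lambda>\<xi>. complex_of_real (gauss_deriv 0 (fst \<xi> - fst y) * gauss_deriv 0 (snd \<xi> - snd y)))
      = (\<lambda>\<xi>. complex_of_real (gaussian 1 (\<xi> - y)))"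
    by (simp add: gauss_deriv_def gaussian_eq[of 1])
next
  fix i j and x :: plane
  have "((\<lambda>\<xi>. gauss_deriv i (fst \<xi> - fst y)) has_derivative (\<lambda>h. fst h * gauss_deriv (Suc i) (fst x - fst y)))
      (at x)"
    "((\<lambda>\<xi>. gauss_deriv j (snd \<xi> - snd y)) has_derivative (\<lambda>h. snd h * gauss_deriv (Suc j) (snd x - snd y)))
        (at x)"
    by (rule DERIV_compose_FDERIV[OF DERIV_gauss_deriv], auto intro!: derivative_eq_intros)+
  then have "((\<lambda>\<xi>. complex_of_real (gauss_deriv i (fst \<xi> - fst y) * gauss_deriv j (snd \<xi> - snd y)))
      has_derivative
      (\<lambda>h. complex_of_real (gauss_deriv i (fst x - fst y) * (snd h * gauss_deriv (Suc j) (snd x - snd y))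
        + fst h * gauss_deriv (Suc i) (fst x - fst y) * gauss_deriv j (snd x - snd y)))) (at x)"
    by (intro has_derivative_of_real has_derivative_mult)
  then show "((\<lambda>\<xi>. complex_of_real (gauss_deriv i (fst \<xi> - fst y) * gauss_deriv j (snd \<xi> - snd y)))
      has_derivative
      (\<lambda>h. fst h *\<^sub>R complex_of_real (gauss_deriv (Suc i) (fst x - fst y) * gauss_deriv j (snd x - snd y))
        + snd h *\<^sub>R complex_of_real (gauss_deriv i (fst x - fst y) * gauss_deriv (Suc j) (snd x - snd y))))
            (at x)"
    by (rule has_derivative_eq_rhs) (auto simp: scaleR_conv_of_real mult_ac)
next
  fix i j n
  obtain A where A: "(1 + \<bar>t\<bar>) ^ n * \<bar>gauss_deriv i t\<bar> \<le> A" for t using gauss_deriv_bound by blast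
  obtain B where B: "(1 + \<bar>t\<bar>) ^ n * \<bar>gauss_deriv j t\<bar> \<le> B" for t using gauss_deriv_bound by blast
  have A0: "0 \<le> A" using A[of 0] by auto
  have "norm (norm x ^ n *\<^sub>R complex_of_real (gauss_deriv i (fst x - fst y) * gauss_deriv j (snd x - snd y)))
      \<le> (1 + norm y) ^ n * (A * B)" for x :: plane
  proof -
    let ?s = "\<bar>fst x - fst y\<bar>" and ?t = "\<bar>snd x - snd y\<bar>"
    have "norm x \<le> norm (x - y) + norm y" using norm_triangle_sub[of x y] by simp
    also have "norm (x - y) \<le> ?s + ?t"
      using norm_Pair_le[of "fst x - fst y" "snd x - snd y"] by (simp add: minus_prod_def)
    also have "?s + ?t + norm y \<le> (1 + norm y) * ((1 + ?s) * (1 + ?t))"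
      by (simp add: algebra_simps)
    finally have "norm x ^ n \<le> ((1 + norm y) * ((1 + ?s) * (1 + ?t))) ^ n"
      by (intro power_mono) auto
    also have "\<dots> = (1 + norm y) ^ n * ((1 + ?s) ^ n * (1 + ?t) ^ n)" by (simp add: power_mult_distrib)
    finally have "norm (norm x ^ n *\<^sub>R complex_of_real
        (gauss_deriv i (fst x - fst y) * gauss_deriv j (snd x - snd y)))
      \<le> (1 + norm y) ^ n * ((1 + ?s) ^ n * (1 + ?t) ^ n)
          * (\<bar>gauss_deriv i (fst x - fst y)\<bar> * \<bar>gauss_deriv j (snd x - snd y)\<bar>)"
      by (simp add: norm_mult abs_mult mult_right_mono)
    also have "\<dots> = (1 + norm y) ^ n * (((1 + ?s) ^ n * \<bar>gauss_deriv i (fst x - fst y)\<bar>)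
        * ((1 + ?t) ^ n * \<bar>gauss_deriv j (snd x - snd y)\<bar>))"
      by (simp only: mult_ac)
    also have "\<dots> \<le> (1 + norm y) ^ n * (A * B)"
      by (intro mult_left_mono mult_mono A B A0) auto
    finally show ?thesis .
  qed
  then show "bounded (range (\<lambda>x. norm x ^ n *\<^sub>R complex_of_real
      (gauss_deriv i (fst x - fst y) * gauss_deriv j (snd x - snd y))))"
    by (intro boundedI[where B="(1 + norm y) ^ n * (A * B)"]) auto
qed

lemma one_plus_norm_power_gaussian_bound: "\<exists>C. \<forall>x. (1 + norm x) ^ n * gaussian 1 x \<le> C"
proof -
  obtain A where A: "(1 + \<bar>t\<bar>) ^ n * \<bar>gauss_deriv 0 t\<bar> \<le> A" for t using gauss_deriv_bound by blast
  have A0: "0 \<le> A" using A[of 0] by auto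
  have "(1 + norm x) ^ n * gaussian 1 x \<le> A * A" for x :: plane
  proof -
    let ?s = "\<bar>fst x\<bar>" and ?t = "\<bar>snd x\<bar>"
    have "1 + norm x \<le> (1 + ?s) * (1 + ?t)"
    proof -
      have "norm x \<le> ?s + ?t" using norm_Pair_le[of "fst x" "snd x"] by simp
      moreover have "0 \<le> ?s * ?t" by simp
      moreover have "(1 + ?s) * (1 + ?t) = 1 + ?s + ?t + ?s * ?t" by (simp add: algebra_simps)
      ultimately show ?thesis by linarith
    qed
    then have "(1 + norm x) ^ n \<le> (1 + ?s) ^ n * (1 + ?t) ^ n"
      by (subst power_mult_distrib[symmetric]) (intro power_mono, auto)
    then have "(1 + norm x) ^ n * gaussian 1 x \<le> ((1 + ?s) ^ n * (1 + ?t) ^ n) * gaussian 1 x"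
      by (intro mult_right_mono) auto
    also have "\<dots> = ((1 + ?s) ^ n * \<bar>gauss_deriv 0 (fst x)\<bar>) * ((1 + ?t) ^ n * \<bar>gauss_deriv 0 (snd x)\<bar>)"
    proof -
      have "gaussian 1 x = \<bar>gauss_deriv 0 (fst x)\<bar> * \<bar>gauss_deriv 0 (snd x)\<bar>"
        using gaussian_eq[of 1 x] by (simp add: gauss_deriv_def flip: of_real_mult)
      then show ?thesis by (simp only: mult_ac)
    qed
    also have "\<dots> \<le> A * A" by (intro mult_mono A A0) auto
    finally show ?thesis .
  qed
  then show ?thesis by blast
qed

text \<open>The Fourier transform of a translated Gaussian is a Gaussian times a character. Hence testing
with all translates says that \<open>f - inv_fourier F\<close> times a fixed Gaussian has Fourier transform 0. The
Gaussian absorbs the polynomial growth of \<open>f\<close>, so that uniqueness for integrable functions applies.\<close>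

lemma has_fourier_transform_imp_inv_fourier:
  assumes fF: "has_fourier_transform f F" and F: "integrable lborel F"
  shows "AE x in lborel. f x = inv_fourier F x"
proof -
  obtain n where [measurable]: "f \<in> borel_measurable borel"
    and n: "integrable lborel (\<lambda>x. f x /\<^sub>R (1 + norm x) ^ n)"
    and test: "\<And>\<phi>. schwartz \<phi> \<Longrightarrow> (LINT x|lborel. f x * fourier \<phi> x) = (LINT \<xi>|lborel. F \<xi> * \<phi> \<xi>)"
    using fF by (auto simp: has_fourier_transform_def temperate_fun_def)
  have [measurable]: "inv_fourier F \<in> borel_measurable borel" by (rule inv_fourier_measurable[OF F])
  obtain C where C: "(1 + norm x) ^ n * gaussian 1 x \<le> C" for x
    using one_plus_norm_power_gaussian_bound by blast
  have fint: "integrable lborel (\<lambda>x. f x * complex_of_real (gaussian 1 x))"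
  proof (rule Bochner_Integration.integrable_bound)
    show "integrable lborel (\<lambda>x. C *\<^sub>R (f x /\<^sub>R (1 + norm x) ^ n))"
      using n by (intro integrable_scaleR_right impI)
    show "AE x in lborel. norm (f x * complex_of_real (gaussian 1 x))
        \<le> norm (C *\<^sub>R (f x /\<^sub>R (1 + norm x) ^ n))"
    proof (intro always_eventually allI)
      fix x :: plane
      have pos: "(1 + norm x) ^ n > 0" by (intro zero_less_power) (simp add: add_pos_nonneg)
      have "gaussian 1 x \<le> \<bar>C\<bar> / (1 + norm x) ^ n"
        using C[of x] pos by (simp add: field_simps)
      then have "norm (f x) * gaussian 1 x \<le> norm (f x) * (\<bar>C\<bar> / (1 + norm x) ^ n)"
        by (intro mult_left_mono) auto
      then show "norm (f x * complex_of_real (gaussian 1 x)) \<le> norm (C *\<^sub>R (f x /\<^sub>R (1 + norm x) ^ n))"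
        using pos by (simp add: norm_mult field_simps)
    qed
  qed measurable
  have gint: "integrable lborel (\<lambda>x. inv_fourier F x * complex_of_real (gaussian 1 x))"
    by (rule integrable_gaussian_mult) (use norm_inv_fourier_le[OF F] in auto)
  have ph: "fourier (\<lambda>\<xi>. complex_of_real (gaussian 1 (\<xi> - y))) x = complex_of_real (gaussian 1 x)
      * cis (- 2 * pi * (x \<bullet> y))" for x y
  proof -
    have "fourier (\<lambda>\<xi>. complex_of_real (gaussian 1 (\<xi> - y))) x
        = (LINT \<xi>|lborel. complex_of_real (gaussian 1 ((y + 1 *\<^sub>R \<xi>) - y))
            * cis (- 2 * pi * ((y + 1 *\<^sub>R \<xi>) \<bullet> x)))"
      unfolding fourier_def
      by (subst integral_plane_affine[of _ 1 y]) auto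
    also have "\<dots> = (LINT \<xi>|lborel. cis (- 2 * pi * (x \<bullet> y))
        * (complex_of_real (gaussian 1 \<xi>) * cis (2 * pi * (\<xi> \<bullet> (- x)))))"
      by (intro Bochner_Integration.integral_cong)
          (auto simp: cis_mult inner_add_left inner_commute algebra_simps)
    also have "\<dots> = complex_of_real (gaussian 1 x) * cis (- 2 * pi * (x \<bullet> y))"
      unfolding Bochner_Integration.integral_mult_right_zero using gaussian_fourier[of 1 "- x"] by simp
    finally show ?thesis .
  qed
  define u where "u x = f x * complex_of_real (gaussian 1 x) - inv_fourier F x
      * complex_of_real (gaussian 1 x)" for x
  have u: "integrable lborel u" unfolding u_def[abs_def] using fint gint by simp
  have "AE x in lborel. u x = 0"
  proof (rule fourier_zero_imp_AE_zero[OF u])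
    fix y
    have "fourier u y = (LINT x|lborel. f x * complex_of_real (gaussian 1 x) * cis (- 2 * pi * (x \<bullet> y)))
        - (LINT x|lborel. inv_fourier F x * complex_of_real (gaussian 1 x) * cis (- 2 * pi * (x \<bullet> y)))"
      unfolding fourier_def u_def left_diff_distrib
      by (intro Bochner_Integration.integral_diff integrable_mult_cis fint gint) measurable
    also have "(LINT x|lborel. f x * complex_of_real (gaussian 1 x) * cis (- 2 * pi * (x \<bullet> y)))
        = (LINT \<xi>|lborel. F \<xi> * complex_of_real (gaussian 1 (\<xi> - y)))"
      using test[OF schwartz_gaussian[of y]] unfolding ph by (simp only: mult.assoc)
    also have "(LINT x|lborel. inv_fourier F x * complex_of_real (gaussian 1 x) * cis (- 2 * pi * (x \<bullet> y)))
        = (LINT \<xi>|lborel. F \<xi> * complex_of_real (gaussian 1 (\<xi> - y)))"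
      using inv_fourier_gaussian[OF F, of 1 y] by (simp add: mult.assoc)
    finally show "fourier u y = 0" by simp
  qed
  then show ?thesis
    by eventually_elim (use gaussian_pos(1) in \<open>simp add: u_def left_diff_distrib[symmetric]
        order_less_imp_not_eq2\<close>)
qed

section \<open>Vanishing oscillatory integrals\<close>

text \<open>A superposition of characters whose frequencies are given by a map \<open>\<phi>\<close>. This class is closed
under conjugation and, by passing to the product space and adding frequencies, under products; so
products of inverse Fourier transforms can be handled without computing convolutions of their
transforms.\<close>

definition osc :: "('a::euclidean_space \<Rightarrow> complex) \<Rightarrow> ('a \<Rightarrow> plane) \<Rightarrow> plane \<Rightarrow> complex" where
  "osc c \<phi> x = (LINT \<omega>|lborel. c \<omega> * cis (2 * pi * (x \<bullet> \<phi> \<omega>)))"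

lemma inv_fourier_eq_osc: "inv_fourier F = osc F (\<lambda>\<xi>. \<xi>)"
  by (simp add: inv_fourier_def osc_def fun_eq_iff)

lemma osc_mult:
  assumes c: "integrable lborel c" "\<phi> \<in> borel_measurable borel"
    and d: "integrable lborel d" "\<psi> \<in> borel_measurable borel"
  shows "osc c \<phi> x * osc d \<psi> x
    = osc (\<lambda>\<omega>. c (fst \<omega>) * d (snd \<omega>)) (\<lambda>\<omega>. \<phi> (fst \<omega>) + \<psi> (snd \<omega>)) x"
proof -
  note [measurable] = c(2) d(2)
  have "osc c \<phi> x * osc d \<psi> x = (LINT \<omega>|lborel. (c (fst \<omega>) * cis (2 * pi * (x \<bullet> \<phi> (fst \<omega>))))
      * (d (snd \<omega>) * cis (2 * pi * (x \<bullet> \<psi> (snd \<omega>)))))"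
    unfolding osc_def
    by (rule integral_product_lborel[symmetric]; rule integrable_mult_cis) (use c d in measurable)
  also have "\<dots> = osc (\<lambda>\<omega>. c (fst \<omega>) * d (snd \<omega>)) (\<lambda>\<omega>. \<phi> (fst \<omega>) + \<psi> (snd \<omega>)) x"
    unfolding osc_def
  proof (intro Bochner_Integration.integral_cong refl)
    fix \<omega>
    have "cis (2 * pi * (x \<bullet> (\<phi> (fst \<omega>) + \<psi> (snd \<omega>)))) = cis (2 * pi * (x \<bullet> \<phi> (fst \<omega>)))
        * cis (2 * pi * (x \<bullet> \<psi> (snd \<omega>)))"
      unfolding cis_mult by (simp add: inner_add_right algebra_simps)
    then show "c (fst \<omega>) * cis (2 * pi * (x \<bullet> \<phi> (fst \<omega>))) * (d (snd \<omega>) * cis (2 * pi * (x \<bullet> \<psi> (snd \<omega>))))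
        = c (fst \<omega>) * d (snd \<omega>) * cis (2 * pi * (x \<bullet> (\<phi> (fst \<omega>) + \<psi> (snd \<omega>))))"
      by (simp only: mult_ac)
  qed
  finally show ?thesis .
qed

lemma osc_cnj: "cnj (osc c \<phi> x) = osc (\<lambda>\<omega>. cnj (c \<omega>)) (\<lambda>\<omega>. - \<phi> \<omega>) x"
  unfolding osc_def by (simp add: cis_cnj flip: Bochner_Integration.integral_cnj)

text \<open>The integral is the value at the frequency 0 of a Fourier transform that lives on frequencies
of size at least \<open>r\<close>. Since \<open>osc c \<phi>\<close> is only assumed integrable, this is read off from the Gaussian
regularizations, which are of size \<open>O(e)\<close>.\<close>

lemma osc_integral_zero:
  assumes c: "integrable lborel c" and [measurable]: "\<phi> \<in> borel_measurable borel"
    and r: "r > 0" and sep: "\<And>\<omega>. c \<omega> \<noteq> 0 \<Longrightarrow> r \<le> norm (\<phi> \<omega>)"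
    and int: "integrable lborel (osc c \<phi>)"
  shows "(LINT x|lborel. osc c \<phi> x) = 0"
proof -
  define e where "e n = 1 / real (Suc n)" for n
  have e: "e n > 0" "e \<longlonglongrightarrow> 0" for n
    unfolding e_def[abs_def] using LIMSEQ_inverse_real_of_nat by (auto simp: inverse_eq_divide)
  let ?I = "\<lambda>n. LINT x|lborel. osc c \<phi> x * complex_of_real (gaussian (e n) x)"
  let ?N = "LINT \<omega>|lborel. norm (c \<omega>)"
  have I: "?I n = (LINT \<omega>|lborel. c \<omega> * complex_of_real (gaussian (1 / e n) (\<phi> \<omega>) / e n))" for n
  proof -
    have "?I n = (LINT x|lborel. complex_of_real (gaussian (e n) x)
        * (LINT \<omega>|lborel. c \<omega> * cis (2 * pi * (x \<bullet> \<phi> \<omega>))))"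
      by (simp add: osc_def mult.commute)
    also have "\<dots> = (LINT \<omega>|lborel. c \<omega> * (LINT x|lborel. complex_of_real (gaussian (e n) x)
        * cis (2 * pi * (x \<bullet> \<phi> \<omega>))))"
      by (rule integral_swap_bounded_kernel[where C=1])
        (use c integrable_gaussian_cis[OF e(1), of n 0 0] in auto)
    finally show ?thesis unfolding gaussian_fourier[OF e(1)] .
  qed
  have bd: "norm (?I n) \<le> e n * (2 / (pi * r\<^sup>2)\<^sup>2 * ?N)" for n
  proof -
    let ?b = "2 * e n / (pi * r\<^sup>2)\<^sup>2"
    have b: "norm (c \<omega> * complex_of_real (gaussian (1 / e n) (\<phi> \<omega>) / e n)) \<le> ?b * norm (c \<omega>)" for \<omega>
    proof (cases "c \<omega> = 0")
      case False
      define y where "y = pi * r\<^sup>2 / e n"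
      have y: "y > 0" using r e(1)[of n] by (simp add: y_def)
      have "r\<^sup>2 \<le> \<phi> \<omega> \<bullet> \<phi> \<omega>"
        using power_mono[OF sep[OF False], of 2] r by (simp add: power2_norm_eq_inner)
      then have "gaussian (1 / e n) (\<phi> \<omega>) \<le> exp (- y)"
        using e(1)[of n] by (simp add: gaussian_def y_def divide_right_mono mult_left_mono)
      \<comment> \<open>One power of \<open>y\<close> cancels the factor \<open>1 / e n\<close>, the other one gives decay in \<open>e n\<close>.\<close>
      also have "exp (- y) \<le> 2 / y\<^sup>2"
      proof -
        have "1 + y + y\<^sup>2 / 2 \<le> exp y" using exp_lower_Taylor_quadratic[of y] y by simp
        then have "y\<^sup>2 / 2 \<le> exp y" using y by linarith
        then show ?thesis using y by (simp add: exp_minus field_simps)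
      qed
      finally have "gaussian (1 / e n) (\<phi> \<omega>) / e n \<le> 2 / y\<^sup>2 / e n"
        using e(1)[of n] by (intro divide_right_mono) auto
      also have "\<dots> = ?b"
        using e(1)[of n] r by (simp add: y_def power2_eq_square field_simps)
      finally have "norm (c \<omega>) * (gaussian (1 / e n) (\<phi> \<omega>) / e n) \<le> norm (c \<omega>) * ?b"
        by (intro mult_left_mono) auto
      then show ?thesis using e(1)[of n] by (simp add: norm_mult norm_divide mult_ac)
    qed simp
    have "norm (?I n) \<le> (LINT \<omega>|lborel. norm (c \<omega> * complex_of_real (gaussian (1 / e n) (\<phi> \<omega>) / e n)))"
      unfolding I by (rule integral_norm_bound)
    also have "\<dots> \<le> (LINT \<omega>|lborel. ?b * norm (c \<omega>))"
    proof (rule integral_mono')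
      show "integrable lborel (\<lambda>\<omega>. ?b * norm (c \<omega>))"
        by (intro integrable_mult_right integrable_norm c)
    qed (use b e(1)[of n] in \<open>auto intro!: divide_nonneg_nonneg\<close>)
    also have "\<dots> = e n * (2 / (pi * r\<^sup>2)\<^sup>2 * ?N)" by simp
    finally show ?thesis .
  qed
  have "?I \<longlonglongrightarrow> 0"
  proof (rule Lim_null_comparison)
    show "\<forall>\<^sub>F n in sequentially. norm (?I n) \<le> e n * (2 / (pi * r\<^sup>2)\<^sup>2 * ?N)"
      using bd by (intro always_eventually allI)
    show "(\<lambda>n. e n * (2 / (pi * r\<^sup>2)\<^sup>2 * ?N)) \<longlonglongrightarrow> 0"
      by (rule tendsto_mult_left_zero[OF e(2)])
  qed
  moreover have "?I \<longlonglongrightarrow> (LINT x|lborel. osc c \<phi> x)"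
    by (rule integral_gaussian_regularisation[OF int e])
  ultimately show ?thesis by (rule LIMSEQ_unique[rotated])
qed

lemma integral_inv_fourier_pair_zero:
  assumes F: "integrable lborel F" and G: "integrable lborel G"
    and r: "r > 0" and sep: "\<And>\<xi> \<eta>. F \<xi> \<noteq> 0 \<Longrightarrow> G \<eta> \<noteq> 0 \<Longrightarrow> r \<le> norm (\<xi> - \<eta>)"
    and int: "integrable lborel (\<lambda>x. inv_fourier F x * cnj (inv_fourier G x))"
  shows "(LINT x|lborel. inv_fourier F x * cnj (inv_fourier G x)) = 0"
proof -
  let ?c = "\<lambda>\<omega>. F (fst \<omega>) * cnj (G (snd \<omega>))" and ?\<phi> = "\<lambda>\<omega>::plane \<times> plane. fst \<omega> + - snd \<omega>"
  have eq: "(\<lambda>x. inv_fourier F x * cnj (inv_fourier G x)) = osc ?c ?\<phi>"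
    unfolding inv_fourier_eq_osc osc_cnj using F G by (intro ext osc_mult) auto
  show ?thesis
    unfolding eq
  proof (rule osc_integral_zero[OF _ _ r])
    show "integrable lborel ?c" by (rule integrable_product_lborel) (use F G in auto)
    show "integrable lborel (osc ?c ?\<phi>)" using int unfolding eq .
  qed (use sep in auto)
qed

text \<open>Two sums of Fourier supports that keep a positive distance from each other give orthogonal
products.\<close>

lemma integral_inv_fourier_quadruple_zero:
  assumes F: "integrable lborel F1" "integrable lborel F2" "integrable lborel F3" "integrable lborel F4"
    and r: "r > 0"
    and sep: "\<And>\<xi>1 \<xi>2 \<xi>3 \<xi>4. F1 \<xi>1 \<noteq> 0 \<Longrightarrow> F2 \<xi>2 \<noteq> 0 \<Longrightarrow> F3 \<xi>3 \<noteq> 0 \<Longrightarrow> F4 \<xi>4 \<noteq> 0 \<Longrightarrow> r \<le> norm (\<xi>1 + \<xi>2 - \<xi>3 - \<xi>4)"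
    and int: "integrable lborel (\<lambda>x. inv_fourier F1 x * inv_fourier F2 x
        * (cnj (inv_fourier F3 x) * cnj (inv_fourier F4 x)))"
  shows "(LINT x|lborel. inv_fourier F1 x * inv_fourier F2 x
      * (cnj (inv_fourier F3 x) * cnj (inv_fourier F4 x))) = 0"
proof -
  let ?c1 = "\<lambda>\<omega>. F1 (fst \<omega>) * F2 (snd \<omega>)" and ?\<phi>1 = "\<lambda>\<omega>::plane \<times> plane. fst \<omega> + snd \<omega>"
  let ?c2 = "\<lambda>\<omega>. cnj (F3 (fst \<omega>)) * cnj (F4 (snd \<omega>))" and ?\<phi>2 = "\<lambda>\<omega>::plane \<times> plane. - fst \<omega> + - snd \<omega>"
  let ?c = "\<lambda>\<omega>. ?c1 (fst \<omega>) * ?c2 (snd \<omega>)" and ?\<phi> = "\<lambda>\<omega>. ?\<phi>1 (fst \<omega>) + ?\<phi>2 (snd \<omega>)"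
  have c1: "integrable lborel ?c1" and c2: "integrable lborel ?c2"
    by (rule integrable_product_lborel; use F in auto)+
  have "osc F1 (\<lambda>\<xi>. \<xi>) x * osc F2 (\<lambda>\<xi>. \<xi>) x = osc ?c1 ?\<phi>1 x" for x
    by (rule osc_mult) (use F in auto)
  moreover have "osc (\<lambda>\<xi>. cnj (F3 \<xi>)) (\<lambda>\<xi>. - \<xi>) x * osc (\<lambda>\<xi>. cnj (F4 \<xi>)) (\<lambda>\<xi>. - \<xi>) x = osc ?c2 ?\<phi>2 x" for x
    by (rule osc_mult) (use F in auto)
  moreover have "osc ?c1 ?\<phi>1 x * osc ?c2 ?\<phi>2 x = osc ?c ?\<phi> x" for x
    by (rule osc_mult) (use c1 c2 in auto)
  ultimately have eq: "(\<lambda>x. inv_fourier F1 x * inv_fourier F2 x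
      * (cnj (inv_fourier F3 x) * cnj (inv_fourier F4 x))) = osc ?c ?\<phi>"
    unfolding inv_fourier_eq_osc osc_cnj by (intro ext) (simp only:)
  show ?thesis
    unfolding eq
  proof (rule osc_integral_zero[OF _ _ r])
    show "integrable lborel ?c" by (rule integrable_product_lborel[OF c1 c2])
    show "integrable lborel (osc ?c ?\<phi>)" using int unfolding eq .
    show "r \<le> norm (?\<phi> \<omega>)" if "?c \<omega> \<noteq> 0" for \<omega>
      using sep[of "fst (fst \<omega>)" "snd (fst \<omega>)" "fst (snd \<omega>)" "snd (snd \<omega>)"] that by (simp add: algebra_simps)
  qed measurable
qed

section \<open>Convolution operators on test functions\<close>

definition convol :: "(plane \<Rightarrow> complex) \<Rightarrow> (plane \<Rightarrow> complex) \<Rightarrow> plane \<Rightarrow> complex" where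
  "convol K g x = (LINT y|lborel. K (x - y) * g y)"

text \<open>A class of functions that lies in every \<open>L\<^sup>q\<close> and is preserved by cutting off large or small
values, as interpolation requires.\<close>

definition test_function :: "(plane \<Rightarrow> complex) \<Rightarrow> bool" where
  "test_function g \<longleftrightarrow> g \<in> borel_measurable borel \<and> (\<exists>M. \<forall>x. norm (g x) \<le> M) \<and> (\<exists>R. \<forall>x. norm x > R \<longrightarrow> g x = 0)"

lemma integrable_bounded_support:
  fixes g :: "'a::euclidean_space \<Rightarrow> 'b::{banach, second_countable_topology}"
  assumes [measurable]: "g \<in> borel_measurable borel" and M: "\<And>x. norm (g x) \<le> M"
    and R: "\<And>x. norm x > R \<Longrightarrow> g x = 0"
  shows "integrable lborel g"
proof (rule Bochner_Integration.integrable_bound)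
  show "integrable lborel (\<lambda>x::'a. M * indicator (cball 0 R) x :: real)"
    using emeasure_bounded_finite[OF bounded_cball[of "0::'a" R]]
    by (intro integrable_mult_right) (simp add: integrable_indicator_iff)
  show "AE x in lborel. norm (g x) \<le> norm (M * indicator (cball 0 R) x :: real)"
  proof (intro always_eventually allI)
    fix x :: 'a
    show "norm (g x) \<le> norm (M * indicator (cball 0 R) x :: real)"
      using M[of x] R[of x] norm_ge_zero[of "g x"] by (cases "norm x \<le> R") (auto simp: indicator_def)
  qed
qed measurable

lemma test_function_integrable: "test_function g \<Longrightarrow> integrable lborel g"
  unfolding test_function_def using integrable_bounded_support by blast

lemma test_function_measurable [measurable_dest]: "test_function g \<Longrightarrow> g \<in> borel_measurable borel"
  unfolding test_function_def by blast

lemma nn_integral_plane_reflect: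
  fixes f :: "plane \<Rightarrow> ennreal"
  assumes [measurable]: "f \<in> borel_measurable borel"
  shows "(\<integral>\<^sup>+ y. f (x - y) \<partial>lborel) = (\<integral>\<^sup>+ y. f y \<partial>lborel)"
proof -
  have "(\<integral>\<^sup>+ y. f y \<partial>lborel)
      = (\<integral>\<^sup>+ y. f y \<partial>density (distr lborel borel (\<lambda>y. x + (-1) *\<^sub>R y)) (\<lambda>_. ennreal (\<bar>-1\<bar>^DIM(plane))))"
    using lborel_affine[of "-1" x] by simp
  also have "\<dots> = (\<integral>\<^sup>+ y. f (x - y) \<partial>lborel)"
    by (subst nn_integral_density) (simp_all add: nn_integral_distr)
  finally show ?thesis ..
qed

lemma nn_integral_plane_translate:
  fixes f :: "plane \<Rightarrow> ennreal"
  assumes [measurable]: "f \<in> borel_measurable borel"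
  shows "(\<integral>\<^sup>+ x. f (x - y) \<partial>lborel) = (\<integral>\<^sup>+ x. f x \<partial>lborel)"
proof -
  have "(\<integral>\<^sup>+ x. f x \<partial>lborel)
      = (\<integral>\<^sup>+ x. f x \<partial>density (distr lborel borel (\<lambda>x. - y + 1 *\<^sub>R x)) (\<lambda>_. ennreal (\<bar>1\<bar>^DIM(plane))))"
    using lborel_affine[of "1" "- y"] by simp
  also have "\<dots> = (\<integral>\<^sup>+ x. f (x - y) \<partial>lborel)"
    by (subst nn_integral_density) (simp_all add: nn_integral_distr)
  finally show ?thesis ..
qed

lemma integrable_plane_reflect:
  fixes K :: "plane \<Rightarrow> complex"
  assumes "integrable lborel K" shows "integrable lborel (\<lambda>y. K (x - y))"
  using integrable_plane_affine[OF assms, of "-1" x] by simp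

lemma integral_plane_reflect:
  fixes f :: "plane \<Rightarrow> 'b::{banach, second_countable_topology}"
  assumes [measurable]: "f \<in> borel_measurable borel"
  shows "(LINT y|lborel. f (x - y)) = (LINT y|lborel. f y)"
  using integral_plane_affine[OF assms, of "-1" x] by simp

lemma convol_integrable:
  fixes K g :: "plane \<Rightarrow> complex"
  assumes K: "integrable lborel K" and [measurable]: "g \<in> borel_measurable borel" and s: "\<And>y. norm (g y) \<le> s"
  shows "integrable lborel (\<lambda>y. K (x - y) * g y)"
proof (rule Bochner_Integration.integrable_bound)
  show "integrable lborel (\<lambda>y. complex_of_real \<bar>s\<bar> * K (x - y))"
    using integrable_plane_reflect[OF K] by simp
  have [measurable]: "K \<in> borel_measurable borel" using K by auto
  show "(\<lambda>y. K (x - y) * g y) \<in> borel_measurable lborel" by measurable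
  show "AE y in lborel. norm (K (x - y) * g y) \<le> norm (complex_of_real \<bar>s\<bar> * K (x - y))"
  proof (intro always_eventually allI)
    fix y
    have "norm (K (x - y)) * norm (g y) \<le> norm (K (x - y)) * \<bar>s\<bar>"
      using s[of y] by (intro mult_left_mono) auto
    then show "norm (K (x - y) * g y) \<le> norm (complex_of_real \<bar>s\<bar> * K (x - y))"
      by (simp add: norm_mult mult.commute)
  qed
qed

lemma convol_measurable [measurable]:
  assumes K: "integrable lborel K" and [measurable]: "g \<in> borel_measurable borel"
  shows "convol K g \<in> borel_measurable borel"
proof -
  have [measurable]: "K \<in> borel_measurable borel" using K by auto
  show ?thesis unfolding convol_def[abs_def] by measurable
qed

lemma norm_convol_le:
  assumes K: "integrable lborel K" and g: "g \<in> borel_measurable borel" and s: "\<And>y. norm (g y) \<le> s"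
  shows "norm (convol K g x) \<le> (LINT y|lborel. norm (K y)) * s"
proof -
  have [measurable]: "K \<in> borel_measurable borel" using K by auto
  have "norm (convol K g x) \<le> (LINT y|lborel. norm (K (x - y) * g y))"
    unfolding convol_def by (rule integral_norm_bound)
  also have "\<dots> \<le> (LINT y|lborel. norm (K (x - y)) * s)"
    using integrable_norm[OF convol_integrable[OF K g s, of x]]
        integrable_norm[OF integrable_plane_reflect[OF K, of x]]
    by (intro integral_mono integrable_mult_left) (auto simp: norm_mult intro!: mult_left_mono s)
  also have "\<dots> = (LINT y|lborel. norm (K y)) * s"
    using integral_plane_reflect[of "\<lambda>y. norm (K y)" x] by simp
  finally show ?thesis .
qed

lemma convol_add:
  assumes K: "integrable lborel K" and g: "test_function g" and h: "test_function h"
  shows "convol K (\<lambda>y. g y + h y) x = convol K g x + convol K h x"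
proof -
  obtain s t where st: "\<And>y. norm (g y) \<le> s" "\<And>y. norm (h y) \<le> t"
    using g h unfolding test_function_def by blast
  have "integrable lborel (\<lambda>y. K (x - y) * g y)" "integrable lborel (\<lambda>y. K (x - y) * h y)"
    using convol_integrable[OF K _ st(1)] convol_integrable[OF K _ st(2)] g h
        by (auto simp: test_function_def)
  then show ?thesis by (simp add: convol_def ring_distribs)
qed

lemma weighted_square_nn_integral_le:
  fixes k G :: "plane \<Rightarrow> real"
  assumes [measurable]: "k \<in> borel_measurable borel" "G \<in> borel_measurable borel"
    and k: "\<And>y. 0 \<le> k y" and G: "\<And>y. 0 \<le> G y"
  shows "(\<integral>\<^sup>+ y. ennreal (k y * G y) \<partial>lborel)\<^sup>2
    \<le> (\<integral>\<^sup>+ y. ennreal (k y) \<partial>lborel) * (\<integral>\<^sup>+ y. ennreal (k y * (G y)\<^sup>2) \<partial>lborel)"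
proof -
  have "(\<integral>\<^sup>+ y. ennreal (sqrt (k y)) * ennreal (sqrt (k y) * G y) \<partial>lborel)\<^sup>2
      \<le> (\<integral>\<^sup>+ y. (ennreal (sqrt (k y)))\<^sup>2 \<partial>lborel) * (\<integral>\<^sup>+ y. (ennreal (sqrt (k y) * G y))\<^sup>2 \<partial>lborel)"
    by (rule Cauchy_Schwarz_nn_integral) measurable
  moreover have "ennreal (sqrt (k y)) * ennreal (sqrt (k y) * G y) = ennreal (k y * G y)" for y
    using k[of y] G[of y] by (simp flip: ennreal_mult mult.assoc)
  moreover have "(ennreal (sqrt (k y)))\<^sup>2 = ennreal (k y)" for y
    using k[of y] by (simp add: ennreal_power)
  moreover have "(ennreal (sqrt (k y) * G y))\<^sup>2 = ennreal (k y * (G y)\<^sup>2)" for y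
    using k[of y] G[of y] by (simp add: ennreal_power power_mult_distrib)
  ultimately show ?thesis by simp
qed

lemma nn_integral_convol_tonelli:
  fixes k G :: "plane \<Rightarrow> real"
  assumes [measurable]: "k \<in> borel_measurable borel" "G \<in> borel_measurable borel"
    and k: "\<And>y. 0 \<le> k y" and G: "\<And>y. 0 \<le> G y"
  shows "(\<integral>\<^sup>+ x. (\<integral>\<^sup>+ y. ennreal (k (x - y) * G y) \<partial>lborel) \<partial>lborel)
    = (\<integral>\<^sup>+ y. ennreal (k y) \<partial>lborel) * (\<integral>\<^sup>+ y. ennreal (G y) \<partial>lborel)"
proof -
  have "(\<integral>\<^sup>+ x. (\<integral>\<^sup>+ y. ennreal (k (x - y) * G y) \<partial>lborel) \<partial>lborel)
      = (\<integral>\<^sup>+ y. (\<integral>\<^sup>+ x. ennreal (k (x - y) * G y) \<partial>lborel) \<partial>lborel)"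
    by (rule lborel_pair.Fubini'[symmetric]) measurable
  also have "\<dots> = (\<integral>\<^sup>+ y. (\<integral>\<^sup>+ x. ennreal (k (x - y)) \<partial>lborel) * ennreal (G y) \<partial>lborel)"
    using k G by (simp add: ennreal_mult nn_integral_multc)
  also have "\<dots> = (\<integral>\<^sup>+ y. ennreal (k y) \<partial>lborel) * (\<integral>\<^sup>+ y. ennreal (G y) \<partial>lborel)"
    by (simp add: nn_integral_plane_translate[of "\<lambda>x. ennreal (k x)"] nn_integral_cmult)
  finally show ?thesis .
qed

lemma norm_convol_nn_integral:
  assumes K: "integrable lborel K" and g: "test_function g"
  shows "ennreal (norm (convol K g x)) \<le> (\<integral>\<^sup>+ y. ennreal (norm (K (x - y)) * norm (g y)) \<partial>lborel)"
proof -
  obtain s where s: "\<And>y. norm (g y) \<le> s"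
    using g unfolding test_function_def by blast
  have "integrable lborel (\<lambda>y. K (x - y) * g y)"
    using convol_integrable[OF K _ s] g by (auto simp: test_function_def)
  from integral_norm_bound_ennreal[OF this] show ?thesis
    by (simp add: convol_def norm_mult)
qed

text \<open>Cauchy-Schwarz for the measure with density \<open>norm (K (x - y))\<close> in \<open>y\<close>.\<close>

lemma young_square_pointwise:
  fixes K :: "plane \<Rightarrow> complex" and G :: "plane \<Rightarrow> real"
  assumes K: "integrable lborel K" and [measurable]: "G \<in> borel_measurable borel" and G: "\<And>y. 0 \<le> G y"
  shows "(\<integral>\<^sup>+ y. ennreal (norm (K (x - y)) * G y) \<partial>lborel)\<^sup>2
    \<le> ennreal (LINT y|lborel. norm (K y)) * (\<integral>\<^sup>+ y. ennreal (norm (K (x - y)) * (G y)\<^sup>2) \<partial>lborel)"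
proof -
  have [measurable]: "K \<in> borel_measurable borel" using K by auto
  have "(\<integral>\<^sup>+ y. ennreal (norm (K (x - y))) \<partial>lborel) = ennreal (LINT y|lborel. norm (K y))"
    using nn_integral_plane_reflect[of "\<lambda>y. ennreal (norm (K y))" x]
        nn_integral_eq_integral[OF integrable_norm[OF K]]
    by simp
  then show ?thesis
    using weighted_square_nn_integral_le[of "\<lambda>y. norm (K (x - y))" G] G by simp
qed

text \<open>The fourth power is the square of a square: apply the pointwise inequality twice.\<close>

lemma young_1_2_4:
  assumes K: "integrable lborel K" and g: "test_function g"
  defines "\<kappa> \<equiv> LINT y|lborel. norm (K y)"
  shows "(\<integral>\<^sup>+ x. ennreal (norm (convol K g x)) \<partial>lborel) \<le> ennreal \<kappa> * (\<integral>\<^sup>+ x. ennreal (norm (g x)) \<partial>lborel)"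
    and "(\<integral>\<^sup>+ x. ennreal (norm (convol K g x) ^ 2) \<partial>lborel) \<le> ennreal (\<kappa> ^ 2)
        * (\<integral>\<^sup>+ x. ennreal (norm (g x) ^ 2) \<partial>lborel)"
    and "(\<integral>\<^sup>+ x. ennreal (norm (convol K g x) ^ 4) \<partial>lborel) \<le> ennreal (\<kappa> ^ 4)
        * (\<integral>\<^sup>+ x. ennreal (norm (g x) ^ 4) \<partial>lborel)"
proof -
  have [measurable]: "K \<in> borel_measurable borel" using K by auto
  note [measurable] = test_function_measurable[OF g]
  have \<kappa>: "0 \<le> \<kappa>" "(\<integral>\<^sup>+ y. ennreal (norm (K y)) \<partial>lborel) = ennreal \<kappa>"
    using nn_integral_eq_integral[OF integrable_norm[OF K]] by (auto simp: \<kappa>_def)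
  let ?N = "\<lambda>m x. \<integral>\<^sup>+ y. ennreal (norm (K (x - y)) * norm (g y) ^ m) \<partial>lborel"
  have tot: "(\<integral>\<^sup>+ x. ?N m x \<partial>lborel) = ennreal \<kappa> * (\<integral>\<^sup>+ x. ennreal (norm (g x) ^ m) \<partial>lborel)" for m
    using nn_integral_convol_tonelli[of "\<lambda>y. norm (K y)" "\<lambda>y. norm (g y) ^ m"] by (simp add: \<kappa>)
  have p1: "ennreal (norm (convol K g x)) \<le> ?N 1 x" for x
    using norm_convol_nn_integral[OF K g] by simp
  have p2: "(?N 1 x)\<^sup>2 \<le> ennreal \<kappa> * ?N 2 x" for x
    using young_square_pointwise[OF K, where G="\<lambda>y. norm (g y)" and x=x] by (simp add: \<kappa>_def)
  have p4: "(?N 2 x)\<^sup>2 \<le> ennreal \<kappa> * ?N 4 x" for x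
    using young_square_pointwise[OF K, where G="\<lambda>y. norm (g y) ^ 2" and x=x]
        by (simp add: \<kappa>_def flip: power_mult)
  have q2: "ennreal (norm (convol K g x) ^ 2) \<le> ennreal \<kappa> * ?N 2 x" for x
    using order_trans[OF power_mono[OF p1, where n=2] p2] by (simp add: ennreal_power)
  have q4: "ennreal (norm (convol K g x) ^ 4) \<le> ennreal \<kappa> ^ 3 * ?N 4 x" for x
  proof -
    have "ennreal (norm (convol K g x) ^ 4) = (ennreal (norm (convol K g x) ^ 2))\<^sup>2"
      by (simp add: ennreal_power flip: power_mult)
    also have "\<dots> \<le> (ennreal \<kappa> * ?N 2 x)\<^sup>2" by (intro power_mono q2) auto
    also have "\<dots> \<le> (ennreal \<kappa>)\<^sup>2 * (ennreal \<kappa> * ?N 4 x)"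
      unfolding power_mult_distrib by (intro mult_left_mono p4) auto
    finally show ?thesis by (simp add: power3_eq_cube power2_eq_square mult.assoc)
  qed
  show "(\<integral>\<^sup>+ x. ennreal (norm (convol K g x)) \<partial>lborel) \<le> ennreal \<kappa> * (\<integral>\<^sup>+ x. ennreal (norm (g x)) \<partial>lborel)"
  proof -
    have "(\<integral>\<^sup>+ x. ennreal (norm (convol K g x)) \<partial>lborel) \<le> (\<integral>\<^sup>+ x. ?N 1 x \<partial>lborel)"
      by (intro nn_integral_mono p1)
    then show ?thesis unfolding tot by simp
  qed
  have "(\<integral>\<^sup>+ x. ennreal (norm (convol K g x) ^ 2) \<partial>lborel) \<le> (\<integral>\<^sup>+ x. ennreal \<kappa> * ?N 2 x \<partial>lborel)"
    by (intro nn_integral_mono q2)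
  also have "\<dots> = ennreal \<kappa> * (\<integral>\<^sup>+ x. ?N 2 x \<partial>lborel)" by (rule nn_integral_cmult) measurable
  also have "\<dots> = ennreal (\<kappa> ^ 2) * (\<integral>\<^sup>+ x. ennreal (norm (g x) ^ 2) \<partial>lborel)"
    unfolding tot using \<kappa>(1) by (simp add: power2_eq_square ennreal_mult mult.assoc)
  finally show "(\<integral>\<^sup>+ x. ennreal (norm (convol K g x) ^ 2) \<partial>lborel) \<le> ennreal (\<kappa> ^ 2)
      * (\<integral>\<^sup>+ x. ennreal (norm (g x) ^ 2) \<partial>lborel)" .
  have "(\<integral>\<^sup>+ x. ennreal (norm (convol K g x) ^ 4) \<partial>lborel) \<le> (\<integral>\<^sup>+ x. ennreal \<kappa> ^ 3 * ?N 4 x \<partial>lborel)"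
    by (intro nn_integral_mono q4)
  also have "\<dots> = ennreal \<kappa> ^ 3 * (\<integral>\<^sup>+ x. ?N 4 x \<partial>lborel)" by (rule nn_integral_cmult) measurable
  also have "\<dots> = ennreal (\<kappa> ^ 4) * (\<integral>\<^sup>+ x. ennreal (norm (g x) ^ 4) \<partial>lborel)"
  proof -
    have "ennreal (\<kappa> ^ 4) = ennreal \<kappa> ^ 3 * ennreal \<kappa>"
      using \<kappa>(1) by (simp add: eval_nat_numeral mult_ac flip: ennreal_mult ennreal_power)
    then show ?thesis unfolding tot by (simp only: mult.assoc)
  qed
  finally show "(\<integral>\<^sup>+ x. ennreal (norm (convol K g x) ^ 4) \<partial>lborel) \<le> ennreal (\<kappa> ^ 4)
      * (\<integral>\<^sup>+ x. ennreal (norm (g x) ^ 4) \<partial>lborel)" .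
qed

lemma convol_L1:
  assumes K: "integrable lborel K" and g: "test_function g"
  shows "integrable lborel (convol K g)"
proof (rule integrableI_bounded)
  note [measurable] = test_function_measurable[OF g]
  show "convol K g \<in> borel_measurable lborel" using convol_measurable[OF K] by simp
  have "(\<integral>\<^sup>+ x. ennreal (norm (g x)) \<partial>lborel) < \<infinity>"
    using test_function_integrable[OF g] by (simp add: integrable_iff_bounded)
  then show "(\<integral>\<^sup>+ x. ennreal (norm (convol K g x)) \<partial>lborel) < \<infinity>"
    using young_1_2_4(1)[OF K g] by (auto intro: order_le_less_trans simp: ennreal_mult_less_top)
qed

text \<open>This puts the Fourier transform of a convolution into the support of \<open>T\<close>.\<close>

lemma convol_eq_inv_fourier:
  assumes T: "integrable lborel T" and g: "integrable lborel g" 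
  shows "convol (inv_fourier T) g = inv_fourier (\<lambda>\<xi>. T \<xi> * fourier g \<xi>)"
proof
  fix x
  have "convol (inv_fourier T) g x = (LINT y|lborel. g y
      * (LINT \<xi>|lborel. T \<xi> * cis (2 * pi * ((x - y) \<bullet> \<xi>))))"
    by (simp add: convol_def inv_fourier_def mult.commute)
  also have "\<dots> = (LINT \<xi>|lborel. T \<xi> * (LINT y|lborel. g y * cis (2 * pi * ((x - y) \<bullet> \<xi>))))"
    by (rule integral_swap_bounded_kernel[where C=1]) (use T g in auto)
  also have "\<dots> = (LINT \<xi>|lborel. T \<xi> * fourier g \<xi> * cis (2 * pi * (x \<bullet> \<xi>)))"
  proof (intro Bochner_Integration.integral_cong refl)
    fix \<xi>
    have "g y * cis (2 * pi * ((x - y) \<bullet> \<xi>)) = g y * cis (- 2 * pi * (y \<bullet> \<xi>)) * cis (2 * pi * (x \<bullet> \<xi>))" for y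
    proof -
      have "cis (2 * pi * ((x - y) \<bullet> \<xi>)) = cis (- 2 * pi * (y \<bullet> \<xi>)) * cis (2 * pi * (x \<bullet> \<xi>))"
        unfolding cis_mult by (simp add: inner_diff_left algebra_simps)
      then show ?thesis by (simp only: mult.assoc)
    qed
    then have "(LINT y|lborel. g y * cis (2 * pi * ((x - y) \<bullet> \<xi>))) = fourier g \<xi> * cis (2 * pi * (x \<bullet> \<xi>))"
      by (simp only: fourier_def Bochner_Integration.integral_mult_left_zero)
    then show "T \<xi> * (LINT y|lborel. g y * cis (2 * pi * ((x - y) \<bullet> \<xi>))) = T \<xi> * fourier g \<xi>
        * cis (2 * pi * (x \<bullet> \<xi>))"
      by (simp only: mult.assoc)
  qed
  finally show "convol (inv_fourier T) g x = inv_fourier (\<lambda>\<xi>. T \<xi> * fourier g \<xi>) x"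
    by (simp add: inv_fourier_def)
qed

lemma integrable_mult_fourier:
  assumes T: "integrable lborel T" and g: "integrable lborel g" 
  shows "integrable lborel (\<lambda>\<xi>. T \<xi> * fourier g \<xi>)"
proof (rule Bochner_Integration.integrable_bound)
  have [measurable]: "T \<in> borel_measurable borel" "g \<in> borel_measurable borel" using T g by auto
  let ?M = "LINT y|lborel. norm (g y)"
  show "integrable lborel (\<lambda>\<xi>. complex_of_real ?M * T \<xi>)" using T by simp
  have M: "norm (fourier g \<xi>) \<le> ?M" for \<xi>
    unfolding fourier_def by (rule order_trans[OF integral_norm_bound]) (simp add: norm_mult)
  show "AE \<xi> in lborel. norm (T \<xi> * fourier g \<xi>) \<le> norm (complex_of_real ?M * T \<xi>)"
    by (intro always_eventually allI) (simp add: norm_mult mult.commute mult_mono order_trans[OF M])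
  show "(\<lambda>\<xi>. T \<xi> * fourier g \<xi>) \<in> borel_measurable lborel"
    unfolding fourier_def by measurable
qed

lemma convol_reproduces_inv_fourier:
  assumes K: "integrable lborel K" and F: "integrable lborel F"
    and one: "\<And>\<xi>. F \<xi> \<noteq> 0 \<Longrightarrow> fourier K \<xi> = 1"
  shows "convol K (inv_fourier F) = inv_fourier F"
proof
  fix x
  have [measurable]: "K \<in> borel_measurable borel" using K by auto
  have "convol K (inv_fourier F) x = (LINT \<xi>|lborel. F \<xi>
      * (LINT y|lborel. K (x - y) * cis (2 * pi * (y \<bullet> \<xi>))))"
    unfolding convol_def inv_fourier_def
    by (rule integral_swap_bounded_kernel[where C=1]) (use F integrable_plane_reflect[OF K] in auto)
  also have "\<dots> = (LINT \<xi>|lborel. F \<xi> * cis (2 * pi * (x \<bullet> \<xi>)))"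
  proof (intro Bochner_Integration.integral_cong refl)
    fix \<xi>
    have "(LINT y|lborel. K (x - y) * cis (2 * pi * (y \<bullet> \<xi>)))
        = (LINT y|lborel. (\<lambda>z. K z * cis (2 * pi * ((x - z) \<bullet> \<xi>))) (x - y))"
      by simp
    also have "\<dots> = (LINT z|lborel. K z * cis (2 * pi * ((x - z) \<bullet> \<xi>)))"
      by (rule integral_plane_reflect) measurable
    also have "\<dots> = (LINT z|lborel. K z * cis (- 2 * pi * (z \<bullet> \<xi>)) * cis (2 * pi * (x \<bullet> \<xi>)))"
    proof (intro Bochner_Integration.integral_cong refl)
      fix z
      have "cis (2 * pi * ((x - z) \<bullet> \<xi>)) = cis (- 2 * pi * (z \<bullet> \<xi>)) * cis (2 * pi * (x \<bullet> \<xi>))"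
        unfolding cis_mult by (simp add: inner_diff_left algebra_simps)
      then show "K z * cis (2 * pi * ((x - z) \<bullet> \<xi>)) = K z * cis (- 2 * pi * (z \<bullet> \<xi>)) * cis (2 * pi * (x \<bullet> \<xi>))"
        by (simp only: mult.assoc)
    qed
    also have "\<dots> = fourier K \<xi> * cis (2 * pi * (x \<bullet> \<xi>))"
      by (simp only: fourier_def Bochner_Integration.integral_mult_left_zero)
    finally show "F \<xi> * (LINT y|lborel. K (x - y) * cis (2 * pi * (y \<bullet> \<xi>))) = F \<xi> * cis (2 * pi * (x \<bullet> \<xi>))"
      using one[of \<xi>] by (cases "F \<xi> = 0") auto
  qed
  finally show "convol K (inv_fourier F) x = inv_fourier F x" by (simp add: inv_fourier_def)
qed

section \<open>Frequency cut-offs with integrable kernels\<close>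

definition profile_hat :: "(real \<Rightarrow> real) \<Rightarrow> real \<Rightarrow> complex" where
  "profile_hat q t = (LINT u|lborel. complex_of_real (q u) * cis (2 * pi * (u * t)))"

text \<open>A cut-off in frequency adapted to the rectangle with center \<open>c\<close> and half sides \<open>a\<close> and \<open>b\<close>.\<close>

definition profile_box :: "(real \<Rightarrow> real) \<Rightarrow> plane \<Rightarrow> real \<Rightarrow> real \<Rightarrow> plane \<Rightarrow> complex" where
  "profile_box q c a b \<xi> = complex_of_real (q ((fst \<xi> - fst c) / a))
      * complex_of_real (q ((snd \<xi> - snd c) / b))"

lemma integrable_profile_affine:
  assumes q: "integrable lborel (q :: real \<Rightarrow> real)" and a: "a > 0"
  shows "integrable lborel (\<lambda>u. q ((u - c) / a))"
  using lborel_integrable_real_affine[OF q, of "1 / a" "- c / a"] a by (simp add: diff_divide_distrib)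

lemma integrable_profile_cis:
  assumes q: "integrable lborel (q :: real \<Rightarrow> real)"
  shows "integrable lborel (\<lambda>u. complex_of_real (q u) * cis (2 * pi * (u * t)))"
  by (rule integrable_mult_cis) (use q in auto)

lemma integral_profile_affine:
  assumes q: "integrable lborel (q :: real \<Rightarrow> real)" and a: "a > 0"
  shows "(LINT u|lborel. complex_of_real (q ((u - c) / a)) * cis (2 * pi * (u * t)))
    = complex_of_real a * cis (2 * pi * (c * t)) * profile_hat q (a * t)"
proof -
  have "(LINT u|lborel. complex_of_real (q ((u - c) / a)) * cis (2 * pi * (u * t)))
      = \<bar>a\<bar> *\<^sub>R (LINT u|lborel. complex_of_real (q ((c + a * u - c) / a)) * cis (2 * pi * ((c + a * u) * t)))"
    by (rule lborel_integral_real_affine) (use a in simp)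
  also have "\<dots> = complex_of_real a * (LINT u|lborel. cis (2 * pi * (c * t))
      * (complex_of_real (q u) * cis (2 * pi * (u * (a * t)))))"
  proof -
    have "complex_of_real (q ((c + a * u - c) / a)) * cis (2 * pi * ((c + a * u) * t))
        = cis (2 * pi * (c * t)) * (complex_of_real (q u) * cis (2 * pi * (u * (a * t))))" for u
    proof -
      have "cis (2 * pi * ((c + a * u) * t)) = cis (2 * pi * (c * t)) * cis (2 * pi * (u * (a * t)))"
        unfolding cis_mult by (simp add: algebra_simps)
      moreover have "(c + a * u - c) / a = u" using a by simp
      ultimately show ?thesis by (simp only: mult_ac)
    qed
    then show ?thesis using a by (simp only: scaleR_conv_of_real abs_of_pos)
  qed
  finally show ?thesis
    unfolding profile_hat_def Bochner_Integration.integral_mult_right_zero by (simp only: mult.assoc)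
qed

lemma integrable_profile_box:
  assumes q: "integrable lborel q" and ab: "a > 0" "b > 0"
  shows "integrable lborel (profile_box q c a b)"
  unfolding profile_box_def[abs_def]
  by (rule integrable_product_lborel[of "\<lambda>u. complex_of_real (q ((u - fst c) / a))" "\<lambda>u. complex_of_real
      (q ((u - snd c) / b))"])
    (use integrable_profile_affine[OF q] ab in auto)

lemma inv_fourier_profile_box:
  assumes q: "integrable lborel q" and ab: "a > 0" "b > 0"
  shows "inv_fourier (profile_box q c a b) x
    = complex_of_real (a * b) * cis (2 * pi * (x \<bullet> c))
        * (profile_hat q (a * fst x) * profile_hat q (b * snd x))"
proof -
  let ?f = "\<lambda>u. complex_of_real (q ((u - fst c) / a)) * cis (2 * pi * (u * fst x))"
  let ?g = "\<lambda>u. complex_of_real (q ((u - snd c) / b)) * cis (2 * pi * (u * snd x))"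
  have f: "integrable lborel ?f" and g: "integrable lborel ?g"
    by (rule integrable_mult_cis; use integrable_profile_affine[OF q] ab in auto)+
  have "inv_fourier (profile_box q c a b) x = (LINT \<xi>|lborel. ?f (fst \<xi>) * ?g (snd \<xi>))"
    unfolding inv_fourier_def
  proof (intro Bochner_Integration.integral_cong refl)
    fix \<xi> :: plane
    have "cis (2 * pi * (x \<bullet> \<xi>)) = cis (2 * pi * (fst \<xi> * fst x)) * cis (2 * pi * (snd \<xi> * snd x))"
      unfolding cis_mult by (simp add: inner_prod_def algebra_simps)
    then show "profile_box q c a b \<xi> * cis (2 * pi * (x \<bullet> \<xi>)) = ?f (fst \<xi>) * ?g (snd \<xi>)"
      by (simp only: profile_box_def mult_ac)
  qed
  also have "\<dots> = (LINT u|lborel. ?f u) * (LINT u|lborel. ?g u)"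
    by (rule integral_product_lborel[OF f g])
  also have "\<dots> = (complex_of_real a * cis (2 * pi * (fst c * fst x)) * profile_hat q (a * fst x))
      * (complex_of_real b * cis (2 * pi * (snd c * snd x)) * profile_hat q (b * snd x))"
    by (simp only: integral_profile_affine[OF q ab(1)] integral_profile_affine[OF q ab(2)])
  also have "\<dots> = complex_of_real (a * b) * cis (2 * pi * (x \<bullet> c))
      * (profile_hat q (a * fst x) * profile_hat q (b * snd x))"
  proof -
    have "cis (2 * pi * (x \<bullet> c)) = cis (2 * pi * (fst c * fst x)) * cis (2 * pi * (snd c * snd x))"
      unfolding cis_mult by (simp add: inner_prod_def algebra_simps)
    then show ?thesis by (simp only: of_real_mult mult_ac)
  qed
  finally show ?thesis .
qed

text \<open>Scaling invariance: the \<open>L\<^sup>1\<close> norm of the kernel depends neither on the position nor on the sides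
of the rectangle.\<close>

lemma inv_fourier_profile_box_integrable:
  assumes q: "integrable lborel q" and h: "integrable lborel (profile_hat q)" and ab: "a > 0" "b > 0"
  shows "integrable lborel (inv_fourier (profile_box q c a b))"
    and "(LINT x|lborel. norm (inv_fourier (profile_box q c a b) x))
        = (LINT t|lborel. norm (profile_hat q t))\<^sup>2"
proof -
  have f: "integrable lborel (\<lambda>t. profile_hat q (a * t))" if "a > 0" for a
    using lborel_integrable_real_affine[OF h, of a 0] that by simp
  let ?P = "\<lambda>x. profile_hat q (a * fst x) * profile_hat q (b * snd x)"
  let ?c = "\<lambda>x. complex_of_real (a * b) * cis (2 * pi * (x \<bullet> c))"
  have P: "integrable lborel ?P"
    by (rule integrable_product_lborel[OF f f]) (use ab in auto)
  have eq: "inv_fourier (profile_box q c a b) = (\<lambda>x. complex_of_real (a * b)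
      * (?P x * cis (2 * pi * (x \<bullet> c))))"
    using inv_fourier_profile_box[OF q ab, of c] by (intro ext) (simp only: mult_ac)
  show "integrable lborel (inv_fourier (profile_box q c a b))"
    unfolding eq by (intro integrable_mult_right impI integrable_mult_cis P) measurable
  have nf: "(LINT t|lborel. norm (profile_hat q (a * t))) = (LINT t|lborel. norm (profile_hat q t)) / a"
      if "a > 0" for a
    using lborel_integral_real_affine[of a "\<lambda>t. norm (profile_hat q t)" 0] that by (simp add: field_simps)
  have "(LINT x|lborel. norm (inv_fourier (profile_box q c a b) x))
      = (LINT x|lborel. a * b * (norm (profile_hat q (a * fst x)) * norm (profile_hat q (b * snd x))))"
    using ab by (intro Bochner_Integration.integral_cong)
        (auto simp: inv_fourier_profile_box[OF q ab] norm_mult)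
  also have "\<dots> = a * b * (LINT x|lborel. norm (profile_hat q (a * fst x)) * norm (profile_hat q (b * snd x)))"
    by simp
  also have "(LINT x|lborel. norm (profile_hat q (a * fst x)) * norm (profile_hat q (b * snd x)))
      = (LINT t|lborel. norm (profile_hat q (a * t))) * (LINT t|lborel. norm (profile_hat q (b * t)))"
  proof -
    have "(LINT x|lborel. complex_of_real (norm (profile_hat q (a * fst x)))
        * complex_of_real (norm (profile_hat q (b * snd x))))
        = (LINT t|lborel. complex_of_real (norm (profile_hat q (a * t))))
            * (LINT t|lborel. complex_of_real (norm (profile_hat q (b * t))))"
      by (rule integral_product_lborel; intro integrable_of_real integrable_norm f ab)
    then show ?thesis unfolding of_real_mult[symmetric] integral_complex_of_real
        by (simp only: of_real_eq_iff)
  qed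
  also have "a * b * \<dots> = (LINT t|lborel. norm (profile_hat q t))\<^sup>2"
    using nf[OF ab(1)] nf[OF ab(2)] ab by (simp add: power2_eq_square)
  finally show "(LINT x|lborel. norm (inv_fourier (profile_box q c a b) x))
      = (LINT t|lborel. norm (profile_hat q t))\<^sup>2" .
qed

definition tent :: "real \<Rightarrow> real" where "tent u = max 0 (1 - \<bar>u\<bar>)"

text \<open>The profile of the de la Vallee Poussin kernel. It is 1 on \<open>[-1, 1]\<close> and 0 outside \<open>[-2, 2]\<close>, and
as a combination of tents it has an integrable Fourier transform, unlike an indicator function.\<close>

definition trapezoid :: "real \<Rightarrow> real" where "trapezoid u = 2 * tent (u / 2) - tent u"

lemma continuous_tent: "continuous_on UNIV tent"
  unfolding tent_def[abs_def] by (intro continuous_intros)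

lemma tent_measurable [measurable]: "tent \<in> borel_measurable borel"
  using continuous_tent by (rule borel_measurable_continuous_onI)

lemma tent_bounds: "0 \<le> tent u" "tent u \<le> 1" "\<bar>u\<bar> \<ge> 1 \<Longrightarrow> tent u = 0"
  by (auto simp: tent_def)

lemma integrable_tent: "integrable lborel tent"
  by (rule integrable_bounded_support[of _ 1 1]) (use tent_bounds in auto)

text \<open>The Fejer kernel, whose quadratic decay makes it integrable. On each half of the tent the
integrand has an elementary primitive.\<close>

lemma tent_hat: 
  assumes t: "t \<noteq> 0"
  shows "profile_hat tent t = complex_of_real ((1 - cos (2 * pi * t)) / (2 * pi\<^sup>2 * t\<^sup>2))"
proof -
  define w where "w = 2 * pi * t"
  have w: "w \<noteq> 0" using t by (simp add: w_def)
  let ?f = "\<lambda>u. complex_of_real (tent u) * cis (2 * pi * (u * t))"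
  define k1 where "k1 = 1 / (\<i> * complex_of_real w)"
  define k2 where "k2 = 1 / (complex_of_real w)\<^sup>2"
  have k: "\<i> * complex_of_real w * k1 = 1" "k1 + \<i> * complex_of_real w * k2 = 0"
    using w by (auto simp: k1_def k2_def power2_eq_square divide_simps)
  let ?A = "\<lambda>u. complex_of_real (1 + 1 * u) * cis (w * u) * k1 + cis (w * u) * k2"
  let ?B = "\<lambda>u. complex_of_real (1 + (-1) * u) * cis (w * u) * k1 + cis (w * u) * (- k2)"
  have dcis: "((\<lambda>u. cis (w * u)) has_vector_derivative (\<i> * w * cis (w * u))) (at u within S)" for u S
  proof -
    have "((\<lambda>u. cis (w * u)) has_derivative (\<lambda>h. (w * h) *\<^sub>R (\<i> * cis (w * u)))) (at u within S)"
      by (auto intro!: derivative_eq_intros)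
    then show ?thesis
      unfolding has_vector_derivative_def by (rule has_derivative_eq_rhs)
          (auto simp: scaleR_conv_of_real fun_eq_iff)
  qed
  have prim: "((\<lambda>u. complex_of_real (1 + \<sigma> * u) * cis (w * u) * k1 + cis (w * u) * l) has_vector_derivative
      complex_of_real (1 + \<sigma> * u) * cis (w * u)) (at u within S)"
    if l: "complex_of_real \<sigma> * k1 + \<i> * complex_of_real w * l = 0" for \<sigma> l u S
  proof -
    have "((\<lambda>u. complex_of_real (1 + \<sigma> * u)) has_vector_derivative complex_of_real \<sigma>) (at u within S)"
      by (rule has_vector_derivative_of_real) (auto intro!: derivative_eq_intros)
    then have "((\<lambda>u. complex_of_real (1 + \<sigma> * u) * cis (w * u) * k1 + cis (w * u) * l) has_vector_derivative
        (complex_of_real (1 + \<sigma> * u) * (\<i> * w * cis (w * u)) + complex_of_real \<sigma> * cis (w * u)) * k1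
          + (\<i> * w * cis (w * u)) * l) (at u within S)"
      by (intro has_vector_derivative_add has_vector_derivative_mult_left has_vector_derivative_mult dcis)
    moreover have "(complex_of_real (1 + \<sigma> * u) * (\<i> * w * cis (w * u)) + complex_of_real \<sigma> * cis (w * u))
        * k1
          + (\<i> * w * cis (w * u)) * l
        = complex_of_real (1 + \<sigma> * u) * cis (w * u) * (\<i> * w * k1) + cis (w * u)
            * (complex_of_real \<sigma> * k1 + \<i> * w * l)"
      by (simp only: ring_distribs mult_ac add_ac)
    ultimately show ?thesis unfolding k(1) l by simp
  qed
  have A: "((\<lambda>u. complex_of_real (1 + 1 * u) * cis (w * u)) has_integral (?A 0 - ?A (-1))) {-1..0}"
    by (rule fundamental_theorem_of_calculus, simp, rule prim) (simp only: k(2) of_real_1 mult_1)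
  have B: "((\<lambda>u. complex_of_real (1 + (-1) * u) * cis (w * u)) has_integral (?B 1 - ?B 0)) {0..1}"
  proof (rule fundamental_theorem_of_calculus, simp, rule prim)
    have "complex_of_real (- 1) * k1 + \<i> * complex_of_real w * - k2 = - (k1 + \<i> * complex_of_real w * k2)"
      by simp
    then show "complex_of_real (- 1) * k1 + \<i> * complex_of_real w * - k2 = 0"
      by (simp only: k(2) minus_zero)
  qed
  have "(?f has_integral (?A 0 - ?A (-1))) {-1..0}"
    by (rule has_integral_eq[OF _ A]) (simp add: tent_def w_def mult_ac)
  moreover have "(?f has_integral (?B 1 - ?B 0)) {0..1}"
    by (rule has_integral_eq[OF _ B]) (simp add: tent_def w_def mult_ac)
  ultimately have "(?f has_integral (?A 0 - ?A (-1) + (?B 1 - ?B 0))) {-1..1}"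
    by (rule has_integral_combine[rotated 2]) auto
  then have "(?f has_integral (?A 0 - ?A (-1) + (?B 1 - ?B 0))) UNIV"
    by (rule has_integral_on_superset) (auto simp: tent_def)
  moreover have "(?f has_integral profile_hat tent t) UNIV"
    unfolding profile_hat_def by (rule has_integral_integral_lborel[OF
        integrable_profile_cis[OF integrable_tent]])
  ultimately have "profile_hat tent t = ?A 0 - ?A (-1) + (?B 1 - ?B 0)" by (rule has_integral_unique[rotated])
  also have "\<dots> = (2 - (cis w + cis (- w))) / (complex_of_real w)\<^sup>2"
  proof -
    have "?A 0 - ?A (-1) + (?B 1 - ?B 0) = (2 - (cis w + cis (- w))) * k2"
      by simp (simp only: ring_distribs mult_1 mult_minus_left, simp)
    then show ?thesis by (simp only: k2_def times_divide_eq_right mult_1_right)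
  qed
  also have "cis w + cis (- w) = complex_of_real (2 * cos w)"
    by (simp add: complex_eq_iff)
  also have "(2 - complex_of_real (2 * cos w)) / (complex_of_real w)\<^sup>2
      = complex_of_real ((2 - 2 * cos w) / w\<^sup>2)"
    by simp
  also have "(2 - 2 * cos w) / w\<^sup>2 = (1 - cos (2 * pi * t)) / (2 * pi\<^sup>2 * t\<^sup>2)"
  proof -
    have "w\<^sup>2 = 2 * (2 * pi\<^sup>2 * t\<^sup>2)" by (simp add: w_def power_mult_distrib)
    moreover have "2 - 2 * cos w = 2 * (1 - cos (2 * pi * t))" by (simp add: w_def)
    ultimately show ?thesis by (simp only: mult_divide_mult_cancel_left_if) simp
  qed
  finally show ?thesis .
qed

lemma profile_hat_measurable [measurable]:
  assumes "integrable lborel q" shows "profile_hat q \<in> borel_measurable borel"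
proof -
  have [measurable]: "q \<in> borel_measurable borel" using assms by auto
  show ?thesis unfolding profile_hat_def[abs_def] by measurable
qed

lemma integrable_inverse_quadratic: "integrable lborel (\<lambda>t::real. 1 / (1 + t\<^sup>2))"
  using integrable_inverse_1_plus_square by (simp add: set_integrable_def inverse_eq_divide)

lemma integral_tent: "(LINT u|lborel. tent u) = 1"
proof -
  have A: "((\<lambda>u. 1 + u) has_integral ((\<lambda>u. u + u\<^sup>2 / 2) 0 - (\<lambda>u. u + u\<^sup>2 / 2) (-1))) {-1..0::real}"
    by (rule fundamental_theorem_of_calculus)
      (auto intro!: derivative_eq_intros simp flip: has_real_derivative_iff_has_vector_derivative)
  have B: "((\<lambda>u. 1 - u) has_integral ((\<lambda>u. u - u\<^sup>2 / 2) 1 - (\<lambda>u. u - u\<^sup>2 / 2) 0)) {0..1::real}"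
    by (rule fundamental_theorem_of_calculus)
      (auto intro!: derivative_eq_intros simp flip: has_real_derivative_iff_has_vector_derivative)
  have "(tent has_integral (1/2)) {-1..0}"
    by (rule has_integral_eq[OF _ A[simplified]]) (auto simp: tent_def)
  moreover have "(tent has_integral (1/2)) {0..1}"
    by (rule has_integral_eq[OF _ B[simplified]]) (auto simp: tent_def)
  ultimately have "(tent has_integral (1/2 + 1/2)) {-1..1}"
    by (rule has_integral_combine[rotated 2]) auto
  then have "(tent has_integral (1/2 + 1/2)) UNIV"
    by (rule has_integral_on_superset) (auto simp: tent_def)
  then have "(tent has_integral 1) UNIV" by simp
  with has_integral_integral_lborel[OF integrable_tent] show ?thesis by (rule has_integral_unique)
qed

lemma tent_hat_0: "profile_hat tent 0 = 1"
  using integral_tent by (simp add: profile_hat_def)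

lemma tent_hat_bounds:
  shows "norm (profile_hat tent t) \<le> 1" and "norm (profile_hat tent t) \<le> 2 / (1 + t\<^sup>2)"
proof -
  have "norm (profile_hat tent t) \<le> (LINT u|lborel. tent u)"
    unfolding profile_hat_def by (rule order_trans[OF integral_norm_bound]) (simp add: norm_mult tent_bounds)
  then show 1: "norm (profile_hat tent t) \<le> 1" by (simp add: integral_tent)
  show "norm (profile_hat tent t) \<le> 2 / (1 + t\<^sup>2)"
  proof (cases "\<bar>t\<bar> \<le> 1")
    case True
    then have "t\<^sup>2 \<le> 1" by (simp add: abs_square_le_1)
    moreover have "0 < 1 + t\<^sup>2" by (simp add: add_pos_nonneg)
    ultimately have "1 \<le> 2 / (1 + t\<^sup>2)" by (subst pos_le_divide_eq) auto
    then show ?thesis using 1 by linarith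
  next
    case False
    then have t: "t \<noteq> 0" "1 \<le> t\<^sup>2" using abs_square_le_1[of t] by (auto simp: linorder_not_le)
    have "norm (profile_hat tent t) = \<bar>1 - cos (2 * pi * t)\<bar> / (2 * pi\<^sup>2 * t\<^sup>2)"
      unfolding tent_hat[OF t(1)] norm_of_real by simp
    also have "\<dots> \<le> 2 / (2 * pi\<^sup>2 * t\<^sup>2)"
      using cos_ge_minus_one[of "2 * pi * t"] cos_le_one[of "2 * pi * t"] by (intro divide_right_mono) auto
    also have "\<dots> \<le> 2 / (1 + t\<^sup>2)"
    proof (rule frac_le)
      have "1 \<le> pi\<^sup>2" using pi_gt3 by (simp add: one_le_power)
      then have "1 * t\<^sup>2 \<le> pi\<^sup>2 * t\<^sup>2" by (rule mult_right_mono) simp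
      then show "1 + t\<^sup>2 \<le> 2 * pi\<^sup>2 * t\<^sup>2" using t(2) by linarith
      show "0 < 1 + t\<^sup>2" by (simp add: add_pos_nonneg)
    qed simp_all
    finally show ?thesis .
  qed
qed

lemma integrable_tent_hat: "integrable lborel (profile_hat tent)"
proof (rule Bochner_Integration.integrable_bound)
  show "integrable lborel (\<lambda>t::real. 2 * (1 / (1 + t\<^sup>2)))"
    using integrable_inverse_quadratic by (rule integrable_mult_right)
  show "AE t in lborel. norm (profile_hat tent t) \<le> norm (2 * (1 / (1 + t\<^sup>2)))"
    using tent_hat_bounds(2) by (intro always_eventually allI) (simp add: add_pos_nonneg)
qed (use integrable_tent in measurable)

text \<open>The value is the square of \<open>sin (\<pi> t) / (\<pi> t)\<close>, and \<open>sin s \<ge> s / 2\<close> for \<open>s \<le> 1\<close>.\<close>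

lemma tent_hat_near_0:
  assumes "\<bar>t\<bar> \<le> 1 / 4" shows "1 / 4 \<le> Re (profile_hat tent t)" "Im (profile_hat tent t) = 0"
proof -
  show "Im (profile_hat tent t) = 0"
    by (cases "t = 0") (simp_all add: tent_hat_0 tent_hat)
  show "1 / 4 \<le> Re (profile_hat tent t)"
  proof (cases "t = 0")
    case False
    have half: "1 - cos (2 * pi * t) = 2 * (sin (pi * t))\<^sup>2"
      using cos_double_sin[of "pi * t"] by (simp add: mult.assoc)
    define s where "s = \<bar>pi * t\<bar>"
    have s: "0 < s" "s \<le> 1"
      using False assms pi_less_4 mult_mono[of pi 4 "\<bar>t\<bar>" "1/4"] by (auto simp: s_def abs_mult)
    have "sin 0 - 0 / 2 \<le> sin s - s / 2"
    proof (rule DERIV_nonneg_imp_nondecreasing[where f="\<lambda>s. sin s - s / 2" and a=0 and b=s])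
      fix v assume v: "0 \<le> v" "v \<le> s"
      have "cos (pi / 3) \<le> cos v"
        using v s pi_gt3 by (intro cos_monotone_0_pi_le) auto
      then show "\<exists>y. ((\<lambda>s. sin s - s / 2) has_real_derivative y) (at v) \<and> 0 \<le> y"
        by (intro exI[of _ "cos v - 1 / 2"]) (auto intro!: derivative_eq_intros simp: cos_60)
    qed (use s in simp)
    then have "s / 2 \<le> sin s" by simp
    then have "(s / 2)\<^sup>2 \<le> (sin s)\<^sup>2" using s by (intro power_mono) auto
    also have "(sin s)\<^sup>2 = (sin (pi * t))\<^sup>2" by (simp add: s_def abs_if)
    finally have "1 / 4 \<le> (sin (pi * t))\<^sup>2 / (pi * t)\<^sup>2"
      using False by (simp add: s_def power_divide field_simps)
    then show ?thesis
      unfolding tent_hat[OF False] half by (simp add: power_mult_distrib)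
  qed (simp add: tent_hat_0)
qed

lemma integrable_trapezoid: "integrable lborel trapezoid"
  unfolding trapezoid_def[abs_def]
  using integrable_profile_affine[OF integrable_tent, of 2 0] integrable_tent by simp

lemma trapezoid_hat: "profile_hat trapezoid t = 4 * profile_hat tent (2 * t) - profile_hat tent t"
proof -
  have i: "integrable lborel (\<lambda>u. complex_of_real (tent (u / 2)) * cis (2 * pi * (u * t)))"
    by (rule integrable_mult_cis) (use integrable_profile_affine[OF integrable_tent, of 2 0] in auto)
  have "profile_hat trapezoid t = (LINT u|lborel. 2
      * (complex_of_real (tent (u / 2)) * cis (2 * pi * (u * t)))
      - complex_of_real (tent u) * cis (2 * pi * (u * t)))"
    unfolding profile_hat_def trapezoid_def by (simp add: algebra_simps)
  also have "\<dots> = 2 * (LINT u|lborel. complex_of_real (tent ((u - 0) / 2)) * cis (2 * pi * (u * t))) -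
      profile_hat tent t"
    unfolding profile_hat_def using i integrable_profile_cis[OF integrable_tent, of t] by simp
  also have "\<dots> = 4 * profile_hat tent (2 * t) - profile_hat tent t"
    unfolding integral_profile_affine[OF integrable_tent zero_less_numeral] by simp
  finally show ?thesis .
qed

lemma integrable_trapezoid_hat: "integrable lborel (profile_hat trapezoid)"
  unfolding trapezoid_hat[abs_def]
  using lborel_integrable_real_affine[OF integrable_tent_hat, of 2 0] integrable_tent_hat by simp

lemma trapezoid_values:
  shows "\<bar>u\<bar> \<le> 1 \<Longrightarrow> trapezoid u = 1" "trapezoid u \<noteq> 0 \<Longrightarrow> \<bar>u\<bar> < 2" "\<bar>trapezoid u\<bar> \<le> 3"
  by (auto simp: trapezoid_def tent_def max_def abs_if split: if_splits)

lemma continuous_trapezoid: "continuous_on UNIV trapezoid"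
  unfolding trapezoid_def[abs_def] tent_def by (intro continuous_intros) auto

lemma fourier_inv_fourier_profile_box:
  assumes q: "integrable lborel q" and h: "integrable lborel (profile_hat q)" and cont: "continuous_on UNIV q"
    and M: "\<And>u. \<bar>q u\<bar> \<le> M" and ab: "a > 0" "b > 0"
  shows "fourier (inv_fourier (profile_box q c a b)) \<xi> = profile_box q c a b \<xi>"
proof (rule fourier_inv_fourier)
  show "integrable lborel (profile_box q c a b)" by (rule integrable_profile_box[OF q ab])
  show "integrable lborel (inv_fourier (profile_box q c a b))"
      by (rule inv_fourier_profile_box_integrable[OF q h ab])
  show "continuous_on UNIV (profile_box q c a b)"
    unfolding profile_box_def[abs_def] using ab
    by (intro continuous_intros continuous_on_compose2[OF cont]) auto
  show "norm (profile_box q c a b x) \<le> M * M" for x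
    using M order_trans[OF abs_ge_zero M] unfolding profile_box_def norm_mult norm_of_real
        by (intro mult_mono) auto
qed

text \<open>The common \<open>L\<^sup>1\<close> norm of all cap kernels.\<close>

definition young_const :: real where
  "young_const = (LINT t|lborel. norm (profile_hat trapezoid t))\<^sup>2"

section \<open>Interpolation by the real method\<close>

definition multi_convol :: "('i \<Rightarrow> plane \<Rightarrow> complex) \<Rightarrow> 'i set \<Rightarrow> ('i \<Rightarrow> plane \<Rightarrow> complex) \<Rightarrow> plane \<Rightarrow> complex" where
  "multi_convol K I g x = (\<Sum>k\<in>I. convol (K k) (g k) x)"

text \<open>Powers of norms add up over a family and avoid roots.\<close>

abbreviation Lp_power :: "real \<Rightarrow> (plane \<Rightarrow> complex) \<Rightarrow> ennreal" where
  "Lp_power q f \<equiv> \<integral>\<^sup>+ x. ennreal (norm (f x) powr q) \<partial>lborel"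

text \<open>Strong type \<open>(q, q)\<close> of the operator \<open>multi_convol K I\<close>, with the norms raised to the power \<open>q\<close>;
families are measured in \<open>\<ell>\<^sup>q(L\<^sup>q)\<close>.\<close>

definition strong_bound :: "('i \<Rightarrow> plane \<Rightarrow> complex) \<Rightarrow> 'i set \<Rightarrow> real \<Rightarrow> real \<Rightarrow> bool" where
  "strong_bound K I q B \<longleftrightarrow> (\<forall>g. (\<forall>k\<in>I. test_function (g k)) \<longrightarrow>
     Lp_power q (multi_convol K I g)
       \<le> ennreal B * (\<Sum>k\<in>I. Lp_power q (g k)))"

text \<open>With the relations \<open>\<alpha> * l < s\<close> and \<open>s \<le> \<alpha> * l\<close> for \<open>P l s\<close> these are the high and the low part of \<open>h\<close>
at level \<open>l\<close>.\<close>

definition select_values :: "(real \<Rightarrow> real \<Rightarrow> bool) \<Rightarrow> real \<Rightarrow> (plane \<Rightarrow> complex) \<Rightarrow> plane \<Rightarrow> complex" where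
  "select_values P l h y = (if P l (norm (h y)) then h y else 0)"

lemma test_function_select_values:
  assumes h: "test_function h" and P: "Measurable.pred borel (\<lambda>z. P (fst z) (snd z))"
  shows "test_function (select_values P l h)"
proof -
  obtain M R where M: "\<And>x. norm (h x) \<le> M" and R: "\<And>x. norm x > R \<Longrightarrow> h x = 0"
    using h unfolding test_function_def by blast
  have [measurable]: "h \<in> borel_measurable borel" using h by (rule test_function_measurable)
  have "(\<lambda>y. (l, norm (h y))) \<in> borel \<rightarrow>\<^sub>M (borel :: (real \<times> real) measure)"
    by (intro borel_measurable_Pair) measurable
  from measurable_compose[OF this P] have [measurable]: "Measurable.pred borel (\<lambda>y. P l (norm (h y)))" by simp
  have "select_values P l h \<in> borel_measurable borel"
    unfolding select_values_def[abs_def] by measurable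
  moreover have "0 \<le> M" using M[of undefined] norm_ge_zero order_trans by blast
  ultimately show ?thesis
    unfolding test_function_def
    by (intro conjI exI[of _ M] exI[of _ R] allI impI) (simp_all add: select_values_def M R)
qed

lemma multi_convol_add:
  assumes K: "\<And>k. k \<in> I \<Longrightarrow> integrable lborel (K k)"
    and g: "\<And>k. k \<in> I \<Longrightarrow> test_function (g k)" and h: "\<And>k. k \<in> I \<Longrightarrow> test_function (h k)"
  shows "multi_convol K I (\<lambda>k y. g k y + h k y) x = multi_convol K I g x + multi_convol K I h x"
  unfolding multi_convol_def sum.distrib[symmetric]
  by (intro sum.cong refl convol_add K g h)

lemma multi_convol_select_measurable:
  assumes K: "\<And>k. k \<in> I \<Longrightarrow> integrable lborel (K k)"
    and g: "\<And>k. k \<in> I \<Longrightarrow> test_function (g k)" and P: "Measurable.pred borel (\<lambda>z. P (fst z) (snd z))"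
  shows "(\<lambda>z. multi_convol K I (\<lambda>k. select_values P (snd z) (g k)) (fst z))
      \<in> borel_measurable (lborel \<Otimes>\<^sub>M lborel)"
  unfolding multi_convol_def
proof (rule borel_measurable_sum)
  fix k assume k: "k \<in> I"
  have [measurable]: "K k \<in> borel_measurable borel" using K[OF k] by auto
  have [measurable]: "g k \<in> borel_measurable borel" using g[OF k] by (rule test_function_measurable)
  have "(\<lambda>w. (snd (fst w), norm (g k (snd w)))) \<in> (lborel \<Otimes>\<^sub>M lborel) \<Otimes>\<^sub>M lborel \<rightarrow>\<^sub>M
      (borel :: (real \<times> real) measure)"
    by (intro borel_measurable_Pair) measurable
  from measurable_compose[OF this P]
  have [measurable]: "Measurable.pred ((lborel \<Otimes>\<^sub>M lborel) \<Otimes>\<^sub>M lborel)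
      (\<lambda>w. P (snd (fst w)) (norm (g k (snd w))))" by simp
  show "(\<lambda>z. convol (K k) (select_values P (snd z) (g k)) (fst z)) \<in> borel_measurable (lborel \<Otimes>\<^sub>M lborel)"
    unfolding convol_def select_values_def
    by (rule sigma_finite_measure.borel_measurable_lebesgue_integral[OF sigma_finite_lborel])
      (simp add: case_prod_unfold)
qed

text \<open>One half of the interpolation argument. Apply the bound for the exponent \<open>q\<close> to the part of \<open>g\<close>
selected at each level \<open>l\<close>, and exchange the integrations over \<open>l\<close> and over the plane; what remains at a
point where \<open>g k\<close> has size \<open>s\<close> is the integral over \<open>l\<close> in the assumption \<open>layer\<close>.\<close>

lemma layer_bound:
  assumes fin: "finite I" and K: "\<And>k. k \<in> I \<Longrightarrow> integrable lborel (K k)"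
    and g: "\<And>k. k \<in> I \<Longrightarrow> test_function (g k)" and P: "Measurable.pred borel (\<lambda>z. P (fst z) (snd z))"
    and B: "strong_bound K I q B" "0 \<le> B" and c: "0 \<le> c"
    and layer: "\<And>s. 0 \<le> s \<Longrightarrow> (\<integral>\<^sup>+ l. ennreal (l powr (p - 1 - q) * s powr q)
        * indicator {l. 0 < l \<and> P l s} l \<partial>lborel) \<le> ennreal (c * s powr p)"
  shows "(\<integral>\<^sup>+ x. (\<integral>\<^sup>+ l. ennreal (l powr (p - 1) *
      (2 * norm (multi_convol K I (\<lambda>k. select_values P l (g k)) x) / l) powr q)
        * indicator {0<..} l \<partial>lborel) \<partial>lborel)
    \<le> ennreal (2 powr q * B * c) * (\<Sum>k\<in>I. Lp_power p (g k))"
proof -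
  let ?T = "\<lambda>l x. multi_convol K I (\<lambda>k. select_values P l (g k)) x"
  note T[measurable] = multi_convol_select_measurable[OF K g P, of I, simplified]
  have T': "(\<lambda>z. ?T (snd z) (fst z)) \<in> borel_measurable (lborel \<Otimes>\<^sub>M lborel)"
    using multi_convol_select_measurable[OF K g P, of I] by simp
  have Tl: "(\<lambda>x. ?T l x) \<in> borel_measurable lborel" for l
    using measurable_compose[OF measurable_Pair1'[of l] ] measurable_compose[OF _ T', of "\<lambda>x. (x, l)" lborel]
    by simp
  have meas_g [measurable]: "k \<in> I \<Longrightarrow> g k \<in> borel_measurable borel" for k
    using g by (blast dest: test_function_measurable)
  have "(\<integral>\<^sup>+ x. (\<integral>\<^sup>+ l. ennreal (l powr (p - 1) * (2 * norm (?T l x) / l) powr q)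
      * indicator {0<..} l \<partial>lborel) \<partial>lborel)
      = (\<integral>\<^sup>+ l. (\<integral>\<^sup>+ x. ennreal (l powr (p - 1) * (2 * norm (?T l x) / l) powr q)
          * indicator {0<..} l \<partial>lborel) \<partial>lborel)"
    by (rule lborel_pair.Fubini'[symmetric]) (use T' in \<open>simp add: case_prod_unfold\<close>)
  also have "\<dots> \<le> (\<integral>\<^sup>+ l. ennreal (2 powr q * B) * (\<Sum>k\<in>I. \<integral>\<^sup>+ y. ennreal
      (l powr (p - 1 - q) * norm (g k y) powr q)
        * indicator {l. 0 < l \<and> P l (norm (g k y))} l \<partial>lborel) \<partial>lborel)"
  proof (rule nn_integral_mono)
    fix l :: real
    show "(\<integral>\<^sup>+ x. ennreal (l powr (p - 1) * (2 * norm (?T l x) / l) powr q) * indicator {0<..} l \<partial>lborel)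
      \<le> ennreal (2 powr q * B) * (\<Sum>k\<in>I. \<integral>\<^sup>+ y. ennreal (l powr (p - 1 - q) * norm (g k y) powr q)
        * indicator {l. 0 < l \<and> P l (norm (g k y))} l \<partial>lborel)"
    proof (cases "l > 0")
      case True
      let ?w = "l powr (p - 1 - q)"
      have "l powr (p - 1) * (2 * norm z / l) powr q = 2 powr q * ?w * norm z powr q" for z :: complex
        using True by (simp add: powr_mult powr_divide powr_diff)
      then have "(\<integral>\<^sup>+ x. ennreal (l powr (p - 1) * (2 * norm (?T l x) / l) powr q)
          * indicator {0<..} l \<partial>lborel)
          = (\<integral>\<^sup>+ x. ennreal (2 powr q * ?w) * ennreal (norm (?T l x) powr q) \<partial>lborel)"
        using True by (simp add: ennreal_mult)
      also have "\<dots> = ennreal (2 powr q * ?w) * Lp_power q (?T l)"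
        by (rule nn_integral_cmult) (use Tl in measurable)
      also have "Lp_power q (?T l)
          \<le> ennreal B * (\<Sum>k\<in>I. Lp_power q (select_values P l (g k)))"
        using B(1)[unfolded strong_bound_def, rule_format, of "\<lambda>k. select_values P l (g k)"]
          test_function_select_values[OF g P] by blast
      also have "ennreal (2 powr q * ?w) * (ennreal B * (\<Sum>k\<in>I. Lp_power q (select_values P l (g k))))
          = ennreal (2 powr q * B) * (\<Sum>k\<in>I. ennreal ?w * Lp_power q (select_values P l (g k)))"
        using B(2) by (simp add: ennreal_mult sum_distrib_left mult_ac)
      also have "(\<Sum>k\<in>I. ennreal ?w * Lp_power q (select_values P l (g k)))
          = (\<Sum>k\<in>I. \<integral>\<^sup>+ y. ennreal (?w * norm (g k y) powr q)
              * indicator {l. 0 < l \<and> P l (norm (g k y))} l \<partial>lborel)"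
      proof (rule sum.cong[OF refl])
        fix k assume k: "k \<in> I"
        note [measurable] = test_function_measurable[OF test_function_select_values[OF g[OF k] P]]
        have "ennreal ?w * Lp_power q (select_values P l (g k))
            = (\<integral>\<^sup>+ y. ennreal ?w * ennreal (norm (select_values P l (g k) y) powr q) \<partial>lborel)"
          by (rule nn_integral_cmult[symmetric]) measurable
        also have "\<dots> = (\<integral>\<^sup>+ y. ennreal (?w * norm (g k y) powr q)
            * indicator {l. 0 < l \<and> P l (norm (g k y))} l \<partial>lborel)"
          using True by (intro nn_integral_cong) (auto simp: select_values_def ennreal_mult)
        finally show "ennreal ?w * Lp_power q (select_values P l (g k))
            = (\<integral>\<^sup>+ y. ennreal (?w * norm (g k y) powr q)
                * indicator {l. 0 < l \<and> P l (norm (g k y))} l \<partial>lborel)" .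
      qed
      finally show ?thesis by (simp add: mult_left_mono)
    qed simp
  qed
  also have "\<dots> = ennreal (2 powr q * B) * (\<Sum>k\<in>I. \<integral>\<^sup>+ y.
      (\<integral>\<^sup>+ l. ennreal (l powr (p - 1 - q) * norm (g k y) powr q)
        * indicator {l. 0 < l \<and> P l (norm (g k y))} l \<partial>lborel) \<partial>lborel)"
  proof -
    have meas: "(\<lambda>(y, l). ennreal (l powr (p - 1 - q) * norm (g k y) powr q)
        * indicator {l. 0 < l \<and> P l (norm (g k y))} l) \<in> borel_measurable (lborel \<Otimes>\<^sub>M lborel)" if k: "k \<in> I"
            for k
    proof -
      note [measurable] = meas_g[OF k]
      have "(\<lambda>w. (snd w, norm (g k (fst w)))) \<in> lborel \<Otimes>\<^sub>M lborel \<rightarrow>\<^sub>M (borel :: (real \<times> real) measure)"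
        by (intro borel_measurable_Pair) measurable
      from measurable_compose[OF this P]
      have [measurable]: "Measurable.pred (lborel \<Otimes>\<^sub>M lborel) (\<lambda>w. P (snd w) (norm (g k (fst w))))" by simp
      have "(\<lambda>(y, l). ennreal (l powr (p - 1 - q) * norm (g k y) powr q)
          * indicator {l. 0 < l \<and> P l (norm (g k y))} l)
        = (\<lambda>w. ennreal (snd w powr (p - 1 - q) * norm (g k (fst w)) powr q)
          * (if 0 < snd w \<and> P (snd w) (norm (g k (fst w))) then 1 else 0))"
        by (auto simp: fun_eq_iff indicator_def)
      then show ?thesis by simp
    qed
    have mk: "(\<lambda>l. \<integral>\<^sup>+ y. ennreal (l powr (p - 1 - q) * norm (g k y) powr q)
        * indicator {l. 0 < l \<and> P l (norm (g k y))} l \<partial>lborel) \<in> borel_measurable lborel" if k: "k \<in> I" for k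
    proof (rule sigma_finite_measure.borel_measurable_nn_integral[OF sigma_finite_lborel])
      show "(\<lambda>(l, y). ennreal (l powr (p - 1 - q) * norm (g k y) powr q)
          * indicator {l. 0 < l \<and> P l (norm (g k y))} l) \<in> borel_measurable (lborel \<Otimes>\<^sub>M lborel)"
        using measurable_compose[OF measurable_pair_swap' meas[OF k]] by (simp add: case_prod_unfold)
    qed
    have "(\<integral>\<^sup>+ l. (\<Sum>k\<in>I. \<integral>\<^sup>+ y. ennreal (l powr (p - 1 - q) * norm (g k y) powr q)
        * indicator {l. 0 < l \<and> P l (norm (g k y))} l \<partial>lborel) \<partial>lborel)
      = (\<Sum>k\<in>I. \<integral>\<^sup>+ l. \<integral>\<^sup>+ y. ennreal (l powr (p - 1 - q) * norm (g k y) powr q)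
        * indicator {l. 0 < l \<and> P l (norm (g k y))} l \<partial>lborel \<partial>lborel)"
      by (rule nn_integral_sum) (rule mk)
    also have "\<dots> = (\<Sum>k\<in>I. \<integral>\<^sup>+ y. (\<integral>\<^sup>+ l. ennreal (l powr (p - 1 - q) * norm (g k y) powr q)
        * indicator {l. 0 < l \<and> P l (norm (g k y))} l \<partial>lborel) \<partial>lborel)"
      by (intro sum.cong refl lborel_pair.Fubini' meas)
    finally show ?thesis
      by (subst nn_integral_cmult) (rule borel_measurable_sum, erule mk, simp only:)
  qed
  also have "\<dots> \<le> ennreal (2 powr q * B) * (\<Sum>k\<in>I. \<integral>\<^sup>+ y. ennreal c * ennreal (norm (g k y) powr p) \<partial>lborel)"
    using layer[OF norm_ge_zero] c by (intro mult_left_mono sum_mono nn_integral_mono)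
        (auto simp: ennreal_mult)
  also have "\<dots> = ennreal (2 powr q * B) * (\<Sum>k\<in>I. ennreal c * Lp_power p (g k))"
    by (intro arg_cong2[where f="(*)"] sum.cong refl nn_integral_cmult) measurable
  also have "\<dots> = ennreal (2 powr q * B * c) * (\<Sum>k\<in>I. Lp_power p (g k))"
    using B(2) c by (simp add: ennreal_mult sum_distrib_left mult.assoc)
  finally show ?thesis .
qed

lemma nn_integral_powr_Ioo:
  assumes a: "a > (-1::real)" and c: "0 \<le> c"
  shows "(\<integral>\<^sup>+ l. ennreal (l powr a) * indicator {l. 0 < l \<and> l < c} l \<partial>lborel)
      = ennreal (c powr (a + 1) / (a + 1))"
proof -
  have "((\<lambda>l. l powr a) has_integral (c powr (a + 1) / (a + 1))) {0<..<c}"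
    using has_integral_powr_from_0[OF a c] by (simp only: has_integral_Icc_iff_Ioo)
  from nn_integral_has_integral_lebesgue[OF _ this]
  have "(\<integral>\<^sup>+ l. ennreal (indicator {0<..<c} l * l powr a) \<partial>lborel) = ennreal (c powr (a + 1) / (a + 1))"
    by simp
  moreover have "ennreal (l powr a) * indicator {l. 0 < l \<and> l < c} l
      = ennreal (indicator {0<..<c} l * l powr a)" for l
    by (simp split: split_indicator)
  ultimately show ?thesis by simp
qed

lemma nn_integral_powr_Ici:
  assumes a: "a < (-1::real)" and c: "0 < c"
  shows "(\<integral>\<^sup>+ l. ennreal (l powr a) * indicator {l. c \<le> l} l \<partial>lborel)
      = ennreal (c powr (a + 1) / (- (a + 1)))"
proof -
  have "((\<lambda>l. l powr a) has_integral (- (c powr (a + 1)) / (a + 1))) {c..}"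
    by (rule has_integral_powr_to_inf[OF a c])
  then have "((\<lambda>l. l powr a) has_integral (c powr (a + 1) / (- (a + 1)))) {c..}"
    by (simp only: divide_minus_left divide_minus_right)
  from nn_integral_has_integral_lebesgue[OF _ this]
  have "(\<integral>\<^sup>+ l. ennreal (indicator {c..} l * l powr a) \<partial>lborel) = ennreal (c powr (a + 1) / (- (a + 1)))"
    using powr_ge_zero by blast
  moreover have "ennreal (l powr a) * indicator {l. c \<le> l} l = ennreal (indicator {c..} l * l powr a)" for l
    by (simp split: split_indicator)
  ultimately show ?thesis by (simp only:)
qed

lemma high_layer:
  assumes q: "q < p" and \<alpha>: "\<alpha> > 0" and s: "0 \<le> s"
  shows "(\<integral>\<^sup>+ l. ennreal (l powr (p - 1 - q) * s powr q) * indicator {l. 0 < l \<and> \<alpha> * l < s} l \<partial>lborel)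
    \<le> ennreal (\<alpha> powr (q - p) / (p - q) * s powr p)"
proof -
  have set: "{l. 0 < l \<and> \<alpha> * l < s} = {l. 0 < l \<and> l < s / \<alpha>}"
    using \<alpha> by (auto simp: field_simps)
  have "(\<integral>\<^sup>+ l. ennreal (l powr (p - 1 - q) * s powr q) * indicator {l. 0 < l \<and> \<alpha> * l < s} l \<partial>lborel)
      = (\<integral>\<^sup>+ l. ennreal (s powr q) * (ennreal (l powr (p - 1 - q)) * indicator {l. 0 < l \<and> l < s / \<alpha>} l)
          \<partial>lborel)"
    unfolding set by (simp add: ennreal_mult mult_ac)
  also have "\<dots> = ennreal (s powr q) * (\<integral>\<^sup>+ l. ennreal (l powr (p - 1 - q))
      * indicator {l. 0 < l \<and> l < s / \<alpha>} l \<partial>lborel)"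
    by (rule nn_integral_cmult) measurable
  also have "\<dots> = ennreal (s powr q * ((s / \<alpha>) powr (p - q) / (p - q)))"
    using nn_integral_powr_Ioo[of "p - 1 - q" "s / \<alpha>"] q \<alpha> s by (simp flip: ennreal_mult)
  also have "s powr q * ((s / \<alpha>) powr (p - q) / (p - q)) = \<alpha> powr (q - p) / (p - q) * s powr p"
  proof (cases "s = 0")
    case False
    then have s: "s > 0" using s by simp
    have "s powr q * s powr (p - q) = s powr p" using s by (simp flip: powr_add)
    moreover have "1 / \<alpha> powr (p - q) = \<alpha> powr (q - p)"
      using \<alpha> powr_minus_divide[of \<alpha> "p - q"] by simp
    moreover have "s powr q * ((s / \<alpha>) powr (p - q) / (p - q)) = (s powr q * s powr (p - q))
        * (1 / \<alpha> powr (p - q)) / (p - q)"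
      using s \<alpha> by (simp add: powr_divide)
    ultimately show ?thesis by (simp only: mult_ac times_divide_eq_left times_divide_eq_right)
  qed simp
  finally show ?thesis by simp
qed

lemma low_layer:
  assumes q: "p < q" and \<alpha>: "\<alpha> > 0" and s: "0 \<le> s"
  shows "(\<integral>\<^sup>+ l. ennreal (l powr (p - 1 - q) * s powr q) * indicator {l. 0 < l \<and> s \<le> \<alpha> * l} l \<partial>lborel)
    \<le> ennreal (\<alpha> powr (q - p) / (q - p) * s powr p)"
proof (cases "s = 0")
  case False
  then have s: "s > 0" using s by simp
  have set: "{l. 0 < l \<and> s \<le> \<alpha> * l} = {l. s / \<alpha> \<le> l}"
  proof (intro Collect_cong iffI conjI)
    fix l assume "s / \<alpha> \<le> l"
    then show "0 < l" using s \<alpha> by (meson divide_pos_pos less_le_trans)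
    show "s \<le> \<alpha> * l" using \<open>s / \<alpha> \<le> l\<close> \<alpha> by (simp add: field_simps)
  qed (use \<alpha> in \<open>auto simp: field_simps\<close>)
  have "(\<integral>\<^sup>+ l. ennreal (l powr (p - 1 - q) * s powr q) * indicator {l. 0 < l \<and> s \<le> \<alpha> * l} l \<partial>lborel)
      = (\<integral>\<^sup>+ l. ennreal (s powr q) * (ennreal (l powr (p - 1 - q)) * indicator {l. s / \<alpha> \<le> l} l) \<partial>lborel)"
    unfolding set by (simp add: ennreal_mult mult_ac)
  also have "\<dots> = ennreal (s powr q) * (\<integral>\<^sup>+ l. ennreal (l powr (p - 1 - q))
      * indicator {l. s / \<alpha> \<le> l} l \<partial>lborel)"
    by (rule nn_integral_cmult) measurable
  also have "\<dots> = ennreal (s powr q * ((s / \<alpha>) powr (p - q) / (q - p)))"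
    using nn_integral_powr_Ici[of "p - 1 - q" "s / \<alpha>"] q \<alpha> s by (simp flip: ennreal_mult)
  also have "s powr q * ((s / \<alpha>) powr (p - q) / (q - p)) = \<alpha> powr (q - p) / (q - p) * s powr p"
  proof -
    have "s powr q * s powr (p - q) = s powr p" using s by (simp flip: powr_add)
    moreover have "1 / \<alpha> powr (p - q) = \<alpha> powr (q - p)"
      using \<alpha> powr_minus_divide[of \<alpha> "p - q"] by simp
    moreover have "s powr q * ((s / \<alpha>) powr (p - q) / (q - p)) = (s powr q * s powr (p - q))
        * (1 / \<alpha> powr (p - q)) / (q - p)"
      using s \<alpha> by (simp add: powr_divide)
    ultimately show ?thesis by (simp only: mult_ac times_divide_eq_left times_divide_eq_right)
  qed
  finally show ?thesis by simp
qed simp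

lemma powr_as_layers:
  assumes p: "p > 0" and y: "0 \<le> y"
  shows "ennreal (y powr p) = ennreal p * (\<integral>\<^sup>+ l. ennreal (l powr (p - 1))
      * indicator {l. 0 < l \<and> l < y} l \<partial>lborel)"
  using nn_integral_powr_Ioo[of "p - 1" y] p y by (simp flip: ennreal_mult)

lemma high_pred: "Measurable.pred borel (\<lambda>z. \<alpha> * fst z < (snd z :: real))"
  and low_pred: "Measurable.pred borel (\<lambda>z. snd z \<le> \<alpha> * (fst z :: real))"
  by measurable

text \<open>Chebyshev's inequality before integration: where the part \<open>u\<close> exceeds \<open>l / 2\<close>, its normalized power
is at least 1.\<close>

lemma one_le_powr_ratio:
  assumes "0 < l" "l / 2 \<le> u" "0 \<le> (q::real)"
  shows "l powr a \<le> l powr a * (2 * u / l) powr q"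
proof -
  have "1 \<le> 2 * u / l" using assms by (simp add: field_simps)
  then have "1 \<le> (2 * u / l) powr q" using assms by (intro ge_one_powr_ge_zero) auto
  then show ?thesis by (simp add: mult_le_cancel_left1)
qed

lemma multi_convol_split:
  assumes K: "\<And>k. k \<in> I \<Longrightarrow> integrable lborel (K k)" and g: "\<And>k. k \<in> I \<Longrightarrow> test_function (g k)"
  shows "multi_convol K I g x = multi_convol K I (\<lambda>k. select_values (\<lambda>l s. \<alpha> * l < s) l (g k)) x
    + multi_convol K I (\<lambda>k. select_values (\<lambda>l s. s \<le> \<alpha> * l) l (g k)) x"
proof -
  have "g k y = select_values (\<lambda>l s. \<alpha> * l < s) l (g k) y + select_values (\<lambda>l s. s \<le> \<alpha> * l) l (g k) y" for k y
    by (simp add: select_values_def)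
  then have "g = (\<lambda>k y. select_values (\<lambda>l s. \<alpha> * l < s) l (g k) y
      + select_values (\<lambda>l s. s \<le> \<alpha> * l) l (g k) y)"
    by (intro ext)
  then have "multi_convol K I g x = multi_convol K I (\<lambda>k y. select_values (\<lambda>l s. \<alpha> * l < s) l (g k) y
      + select_values (\<lambda>l s. s \<le> \<alpha> * l) l (g k) y) x"
    by (rule arg_cong)
  also have "\<dots> = multi_convol K I (\<lambda>k. select_values (\<lambda>l s. \<alpha> * l < s) l (g k)) x
    + multi_convol K I (\<lambda>k. select_values (\<lambda>l s. s \<le> \<alpha> * l) l (g k)) x"
    by (rule multi_convol_add[OF K]) (auto intro!: test_function_select_values g high_pred low_pred)
  finally show ?thesis .
qed

text \<open>At each level \<open>l\<close> split every \<open>g k\<close> at the height \<open>\<alpha> * l\<close>. Where the image of \<open>g\<close> exceeds \<open>l\<close>, the image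
of one of the two parts exceeds \<open>l / 2\<close>, and the parts are controlled by the exponents \<open>q0\<close> and \<open>q1\<close>. The
parameter \<open>\<alpha>\<close> is left free so that it can balance the two endpoint constants.\<close>

theorem marcinkiewicz:
  assumes fin: "finite I" and K: "\<And>k. k \<in> I \<Longrightarrow> integrable lborel (K k)"
    and B0: "strong_bound K I q0 B0" "0 \<le> B0" and B1: "strong_bound K I q1 B1" "0 \<le> B1"
    and q: "0 \<le> q0" "q0 < p" "p < q1" and \<alpha>: "\<alpha> > 0"
  shows "strong_bound K I p (p * (2 powr q0 * B0 * (\<alpha> powr (q0 - p) / (p - q0)) + 2 powr q1 * B1
      * (\<alpha> powr (q1 - p) / (q1 - p))))"
  unfolding strong_bound_def
proof (intro allI impI)
  fix g assume "\<forall>k\<in>I. test_function (g k)"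
  then have g: "\<And>k. k \<in> I \<Longrightarrow> test_function (g k)" by blast
  let ?u = "\<lambda>l x. norm (multi_convol K I (\<lambda>k. select_values (\<lambda>l s. \<alpha> * l < s) l (g k)) x)"
  let ?v = "\<lambda>l x. norm (multi_convol K I (\<lambda>k. select_values (\<lambda>l s. s \<le> \<alpha> * l) l (g k)) x)"
  let ?U = "\<lambda>x l. ennreal (l powr (p - 1) * (2 * ?u l x / l) powr q0) * indicator {0<..} l"
  let ?V = "\<lambda>x l. ennreal (l powr (p - 1) * (2 * ?v l x / l) powr q1) * indicator {0<..} l"
  let ?S = "\<Sum>k\<in>I. Lp_power p (g k)"
  let ?c0 = "2 powr q0 * B0 * (\<alpha> powr (q0 - p) / (p - q0))"
  let ?c1 = "2 powr q1 * B1 * (\<alpha> powr (q1 - p) / (q1 - p))"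
  have p: "p > 0" using q by linarith
  have m0: "(\<lambda>z. multi_convol K I (\<lambda>k. select_values (\<lambda>l s. \<alpha> * l < s) (snd z) (g k)) (fst z))
      \<in> borel_measurable (lborel \<Otimes>\<^sub>M lborel)"
    by (rule multi_convol_select_measurable[OF K g high_pred])
  have m1: "(\<lambda>z. multi_convol K I (\<lambda>k. select_values (\<lambda>l s. s \<le> \<alpha> * l) (snd z) (g k)) (fst z))
      \<in> borel_measurable (lborel \<Otimes>\<^sub>M lborel)"
    by (rule multi_convol_select_measurable[OF K g low_pred])
  have U2: "case_prod ?U \<in> borel_measurable (lborel \<Otimes>\<^sub>M lborel)"
    using m0 by (simp add: case_prod_unfold)
  have V2: "case_prod ?V \<in> borel_measurable (lborel \<Otimes>\<^sub>M lborel)"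
    using m1 by (simp add: case_prod_unfold)
  have U1: "?U x \<in> borel_measurable lborel" for x
    using measurable_compose[OF measurable_Pair1' U2, of x] by simp
  have V1: "?V x \<in> borel_measurable lborel" for x
    using measurable_compose[OF measurable_Pair1' V2, of x] by simp
  have U0: "(\<lambda>x. \<integral>\<^sup>+ l. ?U x l \<partial>lborel) \<in> borel_measurable lborel"
    by (rule sigma_finite_measure.borel_measurable_nn_integral[OF sigma_finite_lborel U2])
  have V0: "(\<lambda>x. \<integral>\<^sup>+ l. ?V x l \<partial>lborel) \<in> borel_measurable lborel"
    by (rule sigma_finite_measure.borel_measurable_nn_integral[OF sigma_finite_lborel V2])
  have point: "ennreal (norm (multi_convol K I g x) powr p) \<le> ennreal p
      * ((\<integral>\<^sup>+ l. ?U x l \<partial>lborel) + (\<integral>\<^sup>+ l. ?V x l \<partial>lborel))" for x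
  proof -
    let ?y = "norm (multi_convol K I g x)"
    have "ennreal (l powr (p - 1)) * indicator {l. 0 < l \<and> l < ?y} l \<le> ?U x l + ?V x l" for l
    proof (cases "0 < l \<and> l < ?y")
      case True
      have "?y \<le> ?u l x + ?v l x"
        by (subst multi_convol_split[OF K g, where \<alpha>=\<alpha> and l=l]) (auto intro: norm_triangle_ineq)
      then have "l / 2 \<le> ?u l x \<or> l / 2 \<le> ?v l x" using True by linarith
      then have "l powr (p - 1) \<le> l powr (p - 1) * (2 * ?u l x / l) powr q0 + l powr (p - 1)
          * (2 * ?v l x / l) powr q1"
        using one_le_powr_ratio[of l "?u l x" q0 "p - 1"] one_le_powr_ratio[of l "?v l x" q1 "p - 1"] True q
        by (auto intro: add_increasing add_increasing2)
      then have "ennreal (l powr (p - 1)) \<le> ennreal (l powr (p - 1) * (2 * ?u l x / l) powr q0)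
          + ennreal (l powr (p - 1) * (2 * ?v l x / l) powr q1)"
        by (simp flip: ennreal_plus)
      then show ?thesis using True by simp
    qed simp
    then have "(\<integral>\<^sup>+ l. ennreal (l powr (p - 1)) * indicator {l. 0 < l \<and> l < ?y} l \<partial>lborel)
        \<le> (\<integral>\<^sup>+ l. ?U x l + ?V x l \<partial>lborel)"
      by (intro nn_integral_mono)
    also have "\<dots> = (\<integral>\<^sup>+ l. ?U x l \<partial>lborel) + (\<integral>\<^sup>+ l. ?V x l \<partial>lborel)"
      by (rule nn_integral_add[OF U1 V1])
    finally show ?thesis
      unfolding powr_as_layers[OF p norm_ge_zero] by (rule mult_left_mono) simp
  qed
  have "Lp_power p (multi_convol K I g)
      \<le> (\<integral>\<^sup>+ x. ennreal p * ((\<integral>\<^sup>+ l. ?U x l \<partial>lborel) + (\<integral>\<^sup>+ l. ?V x l \<partial>lborel)) \<partial>lborel)"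
    by (intro nn_integral_mono point)
  also have "\<dots> = ennreal p * ((\<integral>\<^sup>+ x. \<integral>\<^sup>+ l. ?U x l \<partial>lborel \<partial>lborel)
      + (\<integral>\<^sup>+ x. \<integral>\<^sup>+ l. ?V x l \<partial>lborel \<partial>lborel))"
    by (subst nn_integral_cmult[OF borel_measurable_add[OF U0 V0]], subst nn_integral_add[OF U0 V0])
        (rule refl)
  also have "\<dots> \<le> ennreal p * (ennreal ?c0 * ?S + ennreal ?c1 * ?S)"
  proof (intro mult_left_mono add_mono)
    show "(\<integral>\<^sup>+ x. \<integral>\<^sup>+ l. ?U x l \<partial>lborel \<partial>lborel) \<le> ennreal ?c0 * ?S"
      using high_layer[OF q(2) \<alpha>] q by (intro layer_bound[OF fin K g high_pred B0]) auto
    show "(\<integral>\<^sup>+ x. \<integral>\<^sup>+ l. ?V x l \<partial>lborel \<partial>lborel) \<le> ennreal ?c1 * ?S"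
      using low_layer[OF q(3) \<alpha>] q by (intro layer_bound[OF fin K g low_pred B1]) auto
  qed simp
  also have "\<dots> = ennreal (p * (?c0 + ?c1)) * ?S"
  proof -
    have "0 \<le> ?c0" "0 \<le> ?c1" using B0(2) B1(2) q by auto
    then have "ennreal (p * (?c0 + ?c1)) = ennreal p * (ennreal ?c0 + ennreal ?c1)"
      using p by (simp only: ennreal_mult ennreal_plus add_nonneg_nonneg order_less_imp_le)
    then show ?thesis by (simp only: ring_distribs mult.assoc)
  qed
  finally show "Lp_power p (multi_convol K I g) \<le> ennreal (p * (?c0 + ?c1)) * ?S" .
qed

text \<open>Splitting at the height \<open>l / (2 N)\<close> leaves a low part whose image never exceeds \<open>l / 2\<close>, so that
only the high part counts.\<close>

theorem marcinkiewicz_infinity: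
  assumes fin: "finite I" and K: "\<And>k. k \<in> I \<Longrightarrow> integrable lborel (K k)"
    and B0: "strong_bound K I q0 B0" "0 \<le> B0"
    and sup: "\<And>g s x. (\<And>k. k \<in> I \<Longrightarrow> test_function (g k)) \<Longrightarrow> (\<And>k y. k \<in> I \<Longrightarrow> norm (g k y) \<le> s)
        \<Longrightarrow> norm (multi_convol K I g x) \<le> N * s"
    and N: "N > 0" and q: "0 \<le> q0" "q0 < p"
  shows "strong_bound K I p (p * (2 powr q0 * B0 * ((2 * N) powr (p - q0) / (p - q0))))"
  unfolding strong_bound_def
proof (intro allI impI)
  fix g assume "\<forall>k\<in>I. test_function (g k)"
  then have g: "\<And>k. k \<in> I \<Longrightarrow> test_function (g k)" by blast
  define \<alpha> where "\<alpha> = 1 / (2 * N)"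
  have \<alpha>: "\<alpha> > 0" using N by (simp add: \<alpha>_def)
  let ?u = "\<lambda>l x. norm (multi_convol K I (\<lambda>k. select_values (\<lambda>l s. \<alpha> * l < s) l (g k)) x)"
  let ?v = "\<lambda>l x. norm (multi_convol K I (\<lambda>k. select_values (\<lambda>l s. s \<le> \<alpha> * l) l (g k)) x)"
  let ?U = "\<lambda>x l. ennreal (l powr (p - 1) * (2 * ?u l x / l) powr q0) * indicator {0<..} l"
  let ?S = "\<Sum>k\<in>I. Lp_power p (g k)"
  let ?c0 = "2 powr q0 * B0 * (\<alpha> powr (q0 - p) / (p - q0))"
  have p: "p > 0" using q by linarith
  have m0: "(\<lambda>z. multi_convol K I (\<lambda>k. select_values (\<lambda>l s. \<alpha> * l < s) (snd z) (g k)) (fst z))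
      \<in> borel_measurable (lborel \<Otimes>\<^sub>M lborel)"
    by (rule multi_convol_select_measurable[OF K g high_pred])
  have U2: "case_prod ?U \<in> borel_measurable (lborel \<Otimes>\<^sub>M lborel)"
    using m0 by (simp add: case_prod_unfold)
  have U0: "(\<lambda>x. \<integral>\<^sup>+ l. ?U x l \<partial>lborel) \<in> borel_measurable lborel"
    by (rule sigma_finite_measure.borel_measurable_nn_integral[OF sigma_finite_lborel U2])
  have point: "ennreal (norm (multi_convol K I g x) powr p) \<le> ennreal p * (\<integral>\<^sup>+ l. ?U x l \<partial>lborel)" for x
  proof -
    let ?y = "norm (multi_convol K I g x)"
    have "ennreal (l powr (p - 1)) * indicator {l. 0 < l \<and> l < ?y} l \<le> ?U x l" for l
    proof (cases "0 < l \<and> l < ?y")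
      case True
      have "?y \<le> ?u l x + ?v l x"
        by (subst multi_convol_split[OF K g, where \<alpha>=\<alpha> and l=l]) (auto intro: norm_triangle_ineq)
      moreover have "?v l x \<le> N * (\<alpha> * l)"
        using True \<alpha> by (intro sup test_function_select_values g low_pred) (auto simp: select_values_def)
      moreover have "N * (\<alpha> * l) = l / 2" using N by (simp add: \<alpha>_def)
      ultimately have "l / 2 \<le> ?u l x" using True by linarith
      then have "l powr (p - 1) \<le> l powr (p - 1) * (2 * ?u l x / l) powr q0"
        using one_le_powr_ratio[of l "?u l x" q0 "p - 1"] True q by auto
      then show ?thesis using True by (simp add: ennreal_leI)
    qed simp
    then have "(\<integral>\<^sup>+ l. ennreal (l powr (p - 1)) * indicator {l. 0 < l \<and> l < ?y} l \<partial>lborel)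
        \<le> (\<integral>\<^sup>+ l. ?U x l \<partial>lborel)"
      by (intro nn_integral_mono)
    then show ?thesis
      unfolding powr_as_layers[OF p norm_ge_zero] by (rule mult_left_mono) simp
  qed
  have "Lp_power p (multi_convol K I g)
      \<le> (\<integral>\<^sup>+ x. ennreal p * (\<integral>\<^sup>+ l. ?U x l \<partial>lborel) \<partial>lborel)"
    by (intro nn_integral_mono point)
  also have "\<dots> = ennreal p * (\<integral>\<^sup>+ x. \<integral>\<^sup>+ l. ?U x l \<partial>lborel \<partial>lborel)"
    by (rule nn_integral_cmult[OF U0])
  also have "\<dots> \<le> ennreal p * (ennreal ?c0 * ?S)"
  proof (intro mult_left_mono)
    show "(\<integral>\<^sup>+ x. \<integral>\<^sup>+ l. ?U x l \<partial>lborel \<partial>lborel) \<le> ennreal ?c0 * ?S"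
      using high_layer[OF q(2) \<alpha>] q by (intro layer_bound[OF fin K g high_pred B0]) auto
  qed simp
  also have "\<dots> = ennreal (p * ?c0) * ?S"
  proof -
    have "0 \<le> ?c0" using B0(2) q by auto
    then have "ennreal (p * ?c0) = ennreal p * ennreal ?c0"
      using p by (simp only: ennreal_mult order_less_imp_le)
    then show ?thesis by (simp only: mult.assoc)
  qed
  also have "\<alpha> powr (q0 - p) = (2 * N) powr (p - q0)"
    using N powr_minus[of "2 * N" "p - q0"] by (simp add: \<alpha>_def powr_divide field_simps powr_minus)
  finally show "Lp_power p (multi_convol K I g)
      \<le> ennreal (p * (2 powr q0 * B0 * ((2 * N) powr (p - q0) / (p - q0)))) * ?S" .
qed

section \<open>Almost orthogonality for squares and fourth powers\<close>

lemma cnj_measurable [measurable]: "cnj \<in> borel_measurable borel"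
  by (intro borel_measurable_continuous_onI continuous_intros)

lemma integrable_bounded_mult:
  fixes f g :: "plane \<Rightarrow> complex"
  assumes f: "integrable lborel f" and [measurable]: "g \<in> borel_measurable borel" and M: "\<And>x. norm (g x) \<le> M"
  shows "integrable lborel (\<lambda>x. f x * g x)"
proof (rule Bochner_Integration.integrable_bound)
  have [measurable]: "f \<in> borel_measurable borel" using f by auto
  show "(\<lambda>x. f x * g x) \<in> borel_measurable lborel" by measurable
  show "integrable lborel (\<lambda>x. complex_of_real \<bar>M\<bar> * f x)" using f by simp
  show "AE x in lborel. norm (f x * g x) \<le> norm (complex_of_real \<bar>M\<bar> * f x)"
  proof (intro always_eventually allI)
    fix x
    have "norm (f x) * norm (g x) \<le> norm (f x) * \<bar>M\<bar>"
      using M[of x] by (intro mult_left_mono) auto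
    then show "norm (f x * g x) \<le> norm (complex_of_real \<bar>M\<bar> * f x)"
      by (simp add: norm_mult mult.commute)
  qed
qed

lemma integrable_norm_power:
  fixes h :: "plane \<Rightarrow> complex"
  assumes h: "integrable lborel h" and M: "\<And>x. norm (h x) \<le> M"
  shows "integrable lborel (\<lambda>x. norm (h x) ^ Suc n)"
proof -
  have [measurable]: "h \<in> borel_measurable borel" using h by auto
  have "integrable lborel (\<lambda>x. h x * complex_of_real (norm (h x) ^ n))"
    by (rule integrable_bounded_mult[OF h, where M="M ^ n"]) (auto simp: norm_power intro!: power_mono M)
  then have "integrable lborel (\<lambda>x. norm (h x * complex_of_real (norm (h x) ^ n)))" by (rule integrable_norm)
  then show ?thesis by (simp add: norm_mult norm_power)
qed

lemma four_product_le:
  fixes a b c d :: real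
  shows "0 \<le> a \<Longrightarrow> 0 \<le> b \<Longrightarrow> 0 \<le> c \<Longrightarrow> 0 \<le> d \<Longrightarrow> a * b * (c * d) \<le> (a ^ 4 + b ^ 4 + c ^ 4 + d ^ 4) / 4"
proof -
  have two: "x * y \<le> (x\<^sup>2 + y\<^sup>2) / 2" for x y :: real
    using zero_le_power2[of "x - y"] by (simp add: power2_diff)
  have sq: "(x\<^sup>2)\<^sup>2 = x ^ 4" for x :: real by (simp flip: power_mult)
  assume "0 \<le> a" "0 \<le> b" "0 \<le> c" "0 \<le> d"
  have "a * b * (c * d) \<le> ((a * b)\<^sup>2 + (c * d)\<^sup>2) / 2" by (rule two)
  moreover have "(a * b)\<^sup>2 \<le> (a ^ 4 + b ^ 4) / 2" using two[of "a\<^sup>2" "b\<^sup>2"]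
      by (simp add: sq power_mult_distrib)
  moreover have "(c * d)\<^sup>2 \<le> (c ^ 4 + d ^ 4) / 2" using two[of "c\<^sup>2" "d\<^sup>2"]
      by (simp add: sq power_mult_distrib)
  ultimately show ?thesis by simp
qed

text \<open>Expand the square, drop the pairs with integral 0 and use the inequality \<open>2 a b \<le> a\<^sup>2 + b\<^sup>2\<close>. The
relation \<open>Q\<close> marks the pairs that may interact.\<close>

lemma almost_orthogonal_L2:
  fixes h :: "'i \<Rightarrow> plane \<Rightarrow> complex"
  assumes fin: "finite I" and h: "\<And>k. k \<in> I \<Longrightarrow> integrable lborel (h k)"
    and M: "\<And>k x. k \<in> I \<Longrightarrow> norm (h k x) \<le> M"
    and zero: "\<And>k l. k \<in> I \<Longrightarrow> l \<in> I \<Longrightarrow> \<not> Q k l \<Longrightarrow> (LINT x|lborel. h k x * cnj (h l x)) = 0"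
    and sym: "\<And>k l. Q k l \<longleftrightarrow> Q l k"
    and card: "\<And>k. k \<in> I \<Longrightarrow> real (card {l \<in> I. Q k l}) \<le> m"
  shows "(LINT x|lborel. norm (\<Sum>k\<in>I. h k x) ^ 2) \<le> m * (\<Sum>k\<in>I. LINT x|lborel. norm (h k x) ^ 2)"
proof -
  let ?a = "\<lambda>k. LINT x|lborel. norm (h k x) ^ 2"
  let ?P = "\<lambda>(k, l) x. h k x * cnj (h l x)"
  let ?q = "\<lambda>(k, l). if Q k l then 1 else 0 :: real"
  have meas: "k \<in> I \<Longrightarrow> h k \<in> borel_measurable borel" for k using h by auto
  have int: "integrable lborel (?P t)" if tI: "t \<in> I \<times> I" for t
  proof -
    obtain k l where t: "t = (k, l)" "k \<in> I" "l \<in> I" using tI by auto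
    note [measurable] = meas[OF t(3)]
    have "integrable lborel (\<lambda>x. h k x * cnj (h l x))"
      by (rule integrable_bounded_mult[OF h[OF t(2)], where M=M]) (use M t in auto)
    then show ?thesis by (simp add: t)
  qed
  have sq: "integrable lborel (\<lambda>x. norm (h k x) ^ 2)" if "k \<in> I" for k
    using integrable_norm_power[OF h M, OF that that, where n=1] by (simp add: numeral_2_eq_2)
  have bd: "norm (LINT x|lborel. ?P t x) \<le> ?q t * ((?a (fst t) + ?a (snd t)) / 2)" if t: "t \<in> I \<times> I" for t
  proof (cases "?q t = 0")
    case True
    then show ?thesis using zero t by (auto split: if_splits)
  next
    case False
    obtain k l where t': "t = (k, l)" "k \<in> I" "l \<in> I" using t by auto
    have "norm (LINT x|lborel. ?P t x) \<le> (LINT x|lborel. norm (?P t x))" by (rule integral_norm_bound)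
    also have "\<dots> \<le> (LINT x|lborel. (norm (h k x) ^ 2 + norm (h l x) ^ 2) / 2)"
    proof (rule integral_mono)
      show "integrable lborel (\<lambda>x. norm (?P t x))" using int[OF t] by (rule integrable_norm)
      show "norm (?P t x) \<le> (norm (h k x) ^ 2 + norm (h l x) ^ 2) / 2" for x
        using zero_le_power2[of "norm (h k x) - norm (h l x)"] by (simp add: t' norm_mult power2_diff)
    qed (use sq t' in auto)
    also have "\<dots> = (?a k + ?a l) / 2" using sq t' by simp
    finally show ?thesis using False t' by (auto split: if_splits)
  qed
  have "complex_of_real (norm (\<Sum>k\<in>I. h k x) ^ 2) = (\<Sum>t\<in>I \<times> I. ?P t x)" for x
  proof -
    have "complex_of_real (norm (\<Sum>k\<in>I. h k x) ^ 2) = (\<Sum>k\<in>I. h k x) * (\<Sum>l\<in>I. cnj (h l x))"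
      by (simp only: complex_norm_square cnj_sum)
    then show ?thesis by (simp only: sum_product sum.cartesian_product case_prod_unfold)
  qed
  then have "complex_of_real (LINT x|lborel. norm (\<Sum>k\<in>I. h k x) ^ 2) = (LINT x|lborel. (\<Sum>t\<in>I \<times> I. ?P t x))"
    by (simp only: integral_complex_of_real[symmetric])
  also have "\<dots> = (\<Sum>t\<in>I \<times> I. LINT x|lborel. ?P t x)"
    by (rule Bochner_Integration.integral_sum) (rule int)
  finally have "norm (complex_of_real (LINT x|lborel. norm (\<Sum>k\<in>I. h k x) ^ 2))
      = norm (\<Sum>t\<in>I \<times> I. LINT x|lborel. ?P t x)"
    by (rule arg_cong)
  then have "(LINT x|lborel. norm (\<Sum>k\<in>I. h k x) ^ 2) \<le> norm (\<Sum>t\<in>I \<times> I. LINT x|lborel. ?P t x)"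
    unfolding norm_of_real by (rule order_trans[OF abs_ge_self order_eq_refl])
  also have "\<dots> \<le> (\<Sum>t\<in>I \<times> I. ?q t * ((?a (fst t) + ?a (snd t)) / 2))"
    by (rule order_trans[OF norm_sum sum_mono]) (rule bd)
  also have "\<dots> = ((\<Sum>t\<in>I \<times> I. ?q t * ?a (fst t)) + (\<Sum>t\<in>I \<times> I. ?q t * ?a (snd t))) / 2"
    by (simp add: sum.distrib[symmetric] ring_distribs sum_divide_distrib add_divide_distrib)
  also have "(\<Sum>t\<in>I \<times> I. ?q t * ?a (snd t)) = (\<Sum>t\<in>I \<times> I. ?q t * ?a (fst t))"
    by (rule sum.reindex_bij_witness[where i="\<lambda>(k, l). (l, k)" and j="\<lambda>(k, l). (l, k)"]) (auto simp: sym)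
  also have "((\<Sum>t\<in>I \<times> I. ?q t * ?a (fst t)) + (\<Sum>t\<in>I \<times> I. ?q t * ?a (fst t))) / 2
      = (\<Sum>k\<in>I. real (card {l \<in> I. Q k l}) * ?a k)"
  proof -
    have "(\<Sum>t\<in>I \<times> I. ?q t * ?a (fst t)) = (\<Sum>k\<in>I. \<Sum>l\<in>I. (if Q k l then 1 else 0) * ?a k)"
      by (simp add: sum.cartesian_product case_prod_unfold)
    also have "\<dots> = (\<Sum>k\<in>I. real (card {l \<in> I. Q k l}) * ?a k)"
      using fin by (intro sum.cong refl) (simp add: sum_distrib_right[symmetric] sum.If_cases Int_def)
    finally show ?thesis by simp
  qed
  also have "\<dots> \<le> (\<Sum>k\<in>I. m * ?a k)"
    by (intro sum_mono mult_right_mono card) auto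
  finally show ?thesis by (simp add: sum_distrib_left)
qed

text \<open>Expand the fourth power over quadruples, drop those with integral 0 and apply the inequality
between arithmetic and geometric means to the others. By the symmetries of \<open>Q\<close> the four resulting sums
are equal, and in the first of them each index \<open>k1\<close> is counted once for each quadruple that it starts.\<close>

lemma almost_orthogonal_L4:
  fixes h :: "'i \<Rightarrow> plane \<Rightarrow> complex"
  assumes fin: "finite I" and h: "\<And>k. k \<in> I \<Longrightarrow> integrable lborel (h k)"
    and M: "\<And>k x. k \<in> I \<Longrightarrow> norm (h k x) \<le> M"
    and zero: "\<And>k1 k2 k3 k4. k1 \<in> I \<Longrightarrow> k2 \<in> I \<Longrightarrow> k3 \<in> I \<Longrightarrow> k4 \<in> I \<Longrightarrow> \<not> Q k1 k2 k3 k4 \<Longrightarrow>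
      (LINT x|lborel. h k1 x * h k2 x * (cnj (h k3 x) * cnj (h k4 x))) = 0"
    and sym: "\<And>k1 k2 k3 k4. Q k1 k2 k3 k4 \<longleftrightarrow> Q k2 k1 k3 k4" "\<And>k1 k2 k3 k4. Q k1 k2 k3 k4 \<longleftrightarrow> Q k3 k4 k1 k2"
    and card: "\<And>k1. k1 \<in> I \<Longrightarrow> real (card {(k2, k3, k4) \<in> I \<times> I \<times> I. Q k1 k2 k3 k4}) \<le> m"
  shows "(LINT x|lborel. norm (\<Sum>k\<in>I. h k x) ^ 4) \<le> m * (\<Sum>k\<in>I. LINT x|lborel. norm (h k x) ^ 4)"
proof -
  let ?a = "\<lambda>k. LINT x|lborel. norm (h k x) ^ 4"
  let ?P = "\<lambda>((k1, k2), (k3, k4)) x. h k1 x * h k2 x * (cnj (h k3 x) * cnj (h k4 x))"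
  let ?q = "\<lambda>((k1, k2), (k3, k4)). if Q k1 k2 k3 k4 then 1 else 0 :: real"
  let ?J = "(I \<times> I) \<times> (I \<times> I)"
  let ?s1 = "\<lambda>t. ?q t * ?a (fst (fst t))" and ?s2 = "\<lambda>t. ?q t * ?a (snd (fst t))"
  let ?s3 = "\<lambda>t. ?q t * ?a (fst (snd t))" and ?s4 = "\<lambda>t. ?q t * ?a (snd (snd t))"
  have meas: "k \<in> I \<Longrightarrow> h k \<in> borel_measurable borel" for k using h by auto
  have int: "integrable lborel (?P t)" if tJ: "t \<in> ?J" for t
  proof -
    obtain k1 k2 k3 k4 where t: "t = ((k1, k2), (k3, k4))" "k1 \<in> I" "k2 \<in> I" "k3 \<in> I" "k4 \<in> I"
      using tJ by (cases t, cases "fst t", cases "snd t") auto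
    note [measurable] = meas[OF t(2)] meas[OF t(3)] meas[OF t(4)] meas[OF t(5)]
    have "integrable lborel (\<lambda>x. h k1 x * (h k2 x * (cnj (h k3 x) * cnj (h k4 x))))"
    proof (rule integrable_bounded_mult[OF h[OF t(2)], where M="M * (M * M)"])
      show "norm (h k2 x * (cnj (h k3 x) * cnj (h k4 x))) \<le> M * (M * M)" for x
        unfolding norm_mult complex_mod_cnj using M t order_trans[OF norm_ge_zero M[OF t(2)]]
        by (intro mult_mono) auto
    qed measurable
    then show ?thesis by (simp add: t mult.assoc)
  qed
  have sym3: "Q a b c d \<longleftrightarrow> Q a b d c" for a b c d
    using sym(2)[of a b c d] sym(1)[of c d a b] sym(2)[of d c a b] by simp
  have pw: "integrable lborel (\<lambda>x. norm (h k x) ^ 4)" if "k \<in> I" for k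
    using integrable_norm_power[OF h M, OF that that, where n=3] by (simp add: eval_nat_numeral)
  have bd: "norm (LINT x|lborel. ?P t x) \<le> (?s1 t + ?s2 t + ?s3 t + ?s4 t) / 4" if tJ: "t \<in> ?J" for t
  proof -
    obtain k1 k2 k3 k4 where t: "t = ((k1, k2), (k3, k4))" "k1 \<in> I" "k2 \<in> I" "k3 \<in> I" "k4 \<in> I"
      using tJ by (cases t, cases "fst t", cases "snd t") auto
    show ?thesis
    proof (cases "Q k1 k2 k3 k4")
      case False
      then show ?thesis using zero t by simp
    next
      case True
      have "norm (LINT x|lborel. ?P t x) \<le> (LINT x|lborel. norm (?P t x))" by (rule integral_norm_bound)
      also have "\<dots> \<le> (LINT x|lborel. (norm (h k1 x) ^ 4 + norm (h k2 x) ^ 4 + norm (h k3 x) ^ 4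
          + norm (h k4 x) ^ 4) / 4)"
      proof (rule integral_mono)
        show "integrable lborel (\<lambda>x. norm (?P t x))" using int[OF tJ] by (rule integrable_norm)
        show "norm (?P t x) \<le> (norm (h k1 x) ^ 4 + norm (h k2 x) ^ 4 + norm (h k3 x) ^ 4 + norm (h k4 x) ^ 4)
            / 4" for x
          using four_product_le[of "norm (h k1 x)" "norm (h k2 x)" "norm (h k3 x)" "norm (h k4 x)"]
          by (simp add: t norm_mult)
      qed (use pw t in auto)
      also have "\<dots> = (?a k1 + ?a k2 + ?a k3 + ?a k4) / 4" using pw t by simp
      finally show ?thesis using True t by simp
    qed
  qed
  have "complex_of_real (norm (\<Sum>k\<in>I. h k x) ^ 4) = (\<Sum>t\<in>?J. ?P t x)" for x
  proof -
    let ?S = "\<Sum>k\<in>I. h k x" and ?C = "\<Sum>k\<in>I. cnj (h k x)"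
    have "complex_of_real (norm ?S ^ 4) = (complex_of_real (norm ?S ^ 2))\<^sup>2"
      by (simp flip: of_real_power power_mult)
    also have "\<dots> = (?S * ?C)\<^sup>2"
      by (simp only: complex_norm_square cnj_sum)
    also have "\<dots> = (?S * ?S) * (?C * ?C)" by (simp add: power2_eq_square mult_ac)
    finally show ?thesis
      by (simp only: sum_product sum.cartesian_product case_prod_unfold)
  qed
  then have "complex_of_real (LINT x|lborel. norm (\<Sum>k\<in>I. h k x) ^ 4) = (LINT x|lborel. (\<Sum>t\<in>?J. ?P t x))"
    by (simp only: integral_complex_of_real[symmetric])
  also have "\<dots> = (\<Sum>t\<in>?J. LINT x|lborel. ?P t x)"
    by (rule Bochner_Integration.integral_sum) (rule int)
  finally have "norm (complex_of_real (LINT x|lborel. norm (\<Sum>k\<in>I. h k x) ^ 4))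
      = norm (\<Sum>t\<in>?J. LINT x|lborel. ?P t x)"
    by (rule arg_cong)
  then have "(LINT x|lborel. norm (\<Sum>k\<in>I. h k x) ^ 4) \<le> norm (\<Sum>t\<in>?J. LINT x|lborel. ?P t x)"
    unfolding norm_of_real by (rule order_trans[OF abs_ge_self order_eq_refl])
  also have "\<dots> \<le> (\<Sum>t\<in>?J. (?s1 t + ?s2 t + ?s3 t + ?s4 t) / 4)"
    by (rule order_trans[OF norm_sum sum_mono]) (rule bd)
  also have "\<dots> = (sum ?s1 ?J + sum ?s2 ?J + sum ?s3 ?J + sum ?s4 ?J) / 4"
    by (simp only: sum.distrib[symmetric] sum_divide_distrib[symmetric])
  also have "sum ?s2 ?J = sum ?s1 ?J"
    by (rule sum.reindex_bij_witness[where i="\<lambda>((k1, k2), (k3, k4)). ((k2, k1), (k3, k4))"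
        and j="\<lambda>((k1, k2), (k3, k4)). ((k2, k1), (k3, k4))"])
      (use sym in auto)
  also have "sum ?s4 ?J = sum ?s3 ?J"
    by (rule sum.reindex_bij_witness[where i="\<lambda>((k1, k2), (k3, k4)). ((k1, k2), (k4, k3))"
        and j="\<lambda>((k1, k2), (k3, k4)). ((k1, k2), (k4, k3))"])
      (use sym3 in auto)
  also have "sum ?s3 ?J = sum ?s1 ?J"
    by (rule sum.reindex_bij_witness[where i="\<lambda>((k1, k2), (k3, k4)). ((k3, k4), (k1, k2))"
        and j="\<lambda>((k1, k2), (k3, k4)). ((k3, k4), (k1, k2))"])
      (use sym in auto)
  also have "(sum ?s1 ?J + sum ?s1 ?J + sum ?s1 ?J + sum ?s1 ?J) / 4 = sum ?s1 ?J" by simp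
  also have "sum ?s1 ?J = (\<Sum>k1\<in>I. real (card {(k2, k3, k4) \<in> I \<times> I \<times> I. Q k1 k2 k3 k4}) * ?a k1)"
  proof -
    have "sum ?s1 ?J = (\<Sum>k1\<in>I. \<Sum>t\<in>I \<times> I \<times> I. (if Q k1 (fst t) (fst (snd t)) (snd (snd t)) then 1 else 0)
        * ?a k1)"
      unfolding sum.cartesian_product
      by (rule sum.reindex_bij_witness[where i="\<lambda>(k1, k2, k3, k4). ((k1, k2), (k3, k4))"
          and j="\<lambda>((k1, k2), (k3, k4)). (k1, k2, k3, k4)"])
        auto
    also have "\<dots> = (\<Sum>k1\<in>I. real (card {(k2, k3, k4) \<in> I \<times> I \<times> I. Q k1 k2 k3 k4}) * ?a k1)"
    proof (intro sum.cong refl)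
      fix k1
      have "{(k2, k3, k4) \<in> I \<times> I \<times> I. Q k1 k2 k3 k4}
          = (I \<times> I \<times> I) \<inter> {t. Q k1 (fst t) (fst (snd t)) (snd (snd t))}"
        by auto
      then show "(\<Sum>t\<in>I \<times> I \<times> I. (if Q k1 (fst t) (fst (snd t)) (snd (snd t)) then 1 else 0) * ?a k1)
          = real (card {(k2, k3, k4) \<in> I \<times> I \<times> I. Q k1 k2 k3 k4}) * ?a k1"
        using fin by (simp only: sum_distrib_right[symmetric]) (simp add: sum.If_cases)
    qed
    finally show ?thesis .
  qed
  also have "\<dots> \<le> (\<Sum>k\<in>I. m * ?a k)"
    by (intro sum_mono mult_right_mono card) auto
  finally show ?thesis by (simp add: sum_distrib_left)
qed

section \<open>Counting the interacting quadruples of caps\<close>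

lemma harm_le_1_plus_ln:
  assumes "n \<ge> 1" shows "harm n \<le> 1 + ln (real n)"
proof -
  obtain m where n: "n = Suc m" using assms by (cases n) auto
  have "harm (Suc m) - ln (real (Suc m)) \<le> harm (Suc 0) - ln (real (Suc 0))"
    using decseq_harm_diff_ln by (rule decseqD) simp
  then show ?thesis by (simp add: n harm_expand)
qed

text \<open>Count the lattice points under a hyperbola, column by column.\<close>

lemma card_small_products:
  fixes M :: nat
  assumes X: "0 \<le> X"
  assumes D: "D = {- int M..int M}"
  shows "real (card {(d, d') \<in> D \<times> D. real_of_int \<bar>d * d'\<bar> \<le> X}) \<le> 4 * real M + 1 + 4 * X * harm M"
proof -
  let ?f = "\<lambda>d. real (card {d' \<in> D. real_of_int \<bar>d * d'\<bar> \<le> X})"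
  have fin: "finite D" by (simp add: D)
  have eqD: "D = insert 0 (int ` {1..M} \<union> (\<lambda>j. - int j) ` {1..M})"
  proof (intro equalityI subsetI)
    fix d assume d: "d \<in> D"
    show "d \<in> insert 0 (int ` {1..M} \<union> (\<lambda>j. - int j) ` {1..M})"
    proof (cases d "0 :: int" rule: linorder_cases)
      case less
      then have "d = - int (nat (- d))" "nat (- d) \<in> {1..M}" using d by (auto simp: D)
      then show ?thesis by blast
    next
      case greater
      then have "d = int (nat d)" "nat d \<in> {1..M}" using d by (auto simp: D)
      then show ?thesis by blast
    qed simp
  qed (auto simp: D)
  have "{(d, d') \<in> D \<times> D. real_of_int \<bar>d * d'\<bar> \<le> X} = Sigma D (\<lambda>d. {d' \<in> D. real_of_int \<bar>d * d'\<bar> \<le> X})"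
    by auto
  then have "real (card {(d, d') \<in> D \<times> D. real_of_int \<bar>d * d'\<bar> \<le> X}) = (\<Sum>d\<in>D. ?f d)"
    using fin by (simp add: card_SigmaI)
  also have "(\<Sum>d\<in>D. ?f d) = (\<Sum>d\<in>insert 0 (int ` {1..M} \<union> (\<lambda>j. - int j) ` {1..M}). ?f d)"
    by (rule sum.cong[OF eqD refl])
  also have "\<dots> = ?f 0 + ((\<Sum>j=1..M. ?f (int j)) + (\<Sum>j=1..M. ?f (- int j)))"
  proof -
    have "(\<Sum>d\<in>insert 0 (int ` {1..M} \<union> (\<lambda>j. - int j) ` {1..M}). ?f d)
        = ?f 0 + (\<Sum>d\<in>int ` {1..M} \<union> (\<lambda>j. - int j) ` {1..M}. ?f d)"
      by (rule sum.insert) auto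
    also have "(\<Sum>d\<in>int ` {1..M} \<union> (\<lambda>j. - int j) ` {1..M}. ?f d)
        = (\<Sum>d\<in>int ` {1..M}. ?f d) + (\<Sum>d\<in>(\<lambda>j. - int j) ` {1..M}. ?f d)"
      by (rule sum.union_disjoint) auto
    also have "(\<Sum>d\<in>int ` {1..M}. ?f d) = (\<Sum>j=1..M. ?f (int j))"
      by (rule sum.reindex_cong[where l=int]) (auto simp: inj_on_def)
    also have "(\<Sum>d\<in>(\<lambda>j. - int j) ` {1..M}. ?f d) = (\<Sum>j=1..M. ?f (- int j))"
      by (rule sum.reindex_cong[where l="\<lambda>j. - int j"]) (auto simp: inj_on_def)
    finally show ?thesis .
  qed
  also have "\<dots> \<le> (2 * real M + 1) + ((\<Sum>j=1..M. 2 * X * inverse (real j) + 1)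
      + (\<Sum>j=1..M. 2 * X * inverse (real j) + 1))"
  proof (intro add_mono sum_mono)
    have "D = {d' \<in> D. real_of_int \<bar>0 * d'\<bar> \<le> X}" using X by simp
    moreover have "real (card D) = 2 * real M + 1" by (simp add: D)
    ultimately show "?f 0 \<le> 2 * real M + 1" by simp
    have bd: "?f d \<le> 2 * X * inverse (real j) + 1" if "j \<in> {1..M}" "\<bar>d\<bar> = int j" for d j
    proof -
      have j: "real j > 0" using that by simp
      have "{d' \<in> D. real_of_int \<bar>d * d'\<bar> \<le> X} \<subseteq> {- \<lfloor>X / real j\<rfloor>..\<lfloor>X / real j\<rfloor>}"
      proof
        fix d' assume "d' \<in> {d' \<in> D. real_of_int \<bar>d * d'\<bar> \<le> X}"
        then have "real j * \<bar>real_of_int d'\<bar> \<le> X" using that by (simp add: abs_mult)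
        then have "\<bar>real_of_int d'\<bar> \<le> X / real j" using j by (simp add: field_simps)
        then have "\<bar>d'\<bar> \<le> \<lfloor>X / real j\<rfloor>" by (simp add: le_floor_iff)
        then show "d' \<in> {- \<lfloor>X / real j\<rfloor>..\<lfloor>X / real j\<rfloor>}" by auto
      qed
      then have "card {d' \<in> D. real_of_int \<bar>d * d'\<bar> \<le> X} \<le> card {- \<lfloor>X / real j\<rfloor>..\<lfloor>X / real j\<rfloor>}"
        by (rule card_mono[rotated]) simp
      moreover have "real (card {- \<lfloor>X / real j\<rfloor>..\<lfloor>X / real j\<rfloor>}) \<le> 2 * (X / real j) + 1"
      proof -
        have "0 \<le> \<lfloor>X / real j\<rfloor>" using X j by simp
        then have "real (card {- \<lfloor>X / real j\<rfloor>..\<lfloor>X / real j\<rfloor>}) = 2 * real_of_int \<lfloor>X / real j\<rfloor> + 1" by simp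
        moreover have "real_of_int \<lfloor>X / real j\<rfloor> \<le> X / real j" by (rule of_int_floor_le)
        ultimately show ?thesis by linarith
      qed
      ultimately show ?thesis by (simp add: divide_inverse mult.assoc)
    qed
    show "?f (int j) \<le> 2 * X * inverse (real j) + 1" "?f (- int j) \<le> 2 * X * inverse (real j) + 1" if "j
        \<in> {1..M}" for j
      by (rule bd[OF that]; simp)+
  qed
  also have "\<dots> = 4 * real M + 1 + 4 * X * harm M"
    by (simp add: sum.distrib harm_def sum_distrib_left[symmetric] mult.assoc)
  finally show ?thesis .
qed

text \<open>The midpoint of the \<open>k\<close>-th interval; the last interval may be cut off before it.\<close>

definition cap_center :: "real \<Rightarrow> nat \<Rightarrow> real" where
  "cap_center \<delta> k = -1 + (real k + 1 / 2) * \<delta>"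

definition cap_count :: "real \<Rightarrow> nat" where
  "cap_count \<delta> = nat \<lceil>2 / \<delta>\<rceil>"

lemma cap_count_bounds:
  assumes "0 < \<delta>" "\<delta> \<le> 1" 
  shows "2 / \<delta> \<le> real (cap_count \<delta>)" "real (cap_count \<delta>) \<le> 2 / \<delta> + 1" "real (cap_count \<delta>) \<le> 3 / \<delta>"
proof -
  have "0 < 2 / \<delta>" using assms by simp
  then have *: "real (cap_count \<delta>) = real_of_int \<lceil>2 / \<delta>\<rceil>" unfolding cap_count_def by simp
  show "2 / \<delta> \<le> real (cap_count \<delta>)" "real (cap_count \<delta>) \<le> 2 / \<delta> + 1" unfolding * by linarith+
  then show "real (cap_count \<delta>) \<le> 3 / \<delta>" using assms by (simp add: field_simps)
qed

lemma cap_index_bound: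
  assumes "0 < \<delta>" "k < cap_count \<delta>" shows "real k * \<delta> < 2"
proof -
  have "real k < 2 / \<delta>" using assms(2) unfolding cap_count_def by linarith
  then show ?thesis using assms(1) by (simp add: field_simps)
qed

lemma cap_center_bound:
  assumes \<delta>: "0 < \<delta>" and k: "k < cap_count \<delta>"
  shows "\<bar>cap_center \<delta> k\<bar> \<le> 1 + \<delta> / 2"
proof -
  have "0 \<le> real k * \<delta>" using \<delta> by simp
  moreover have "cap_center \<delta> k = -1 + real k * \<delta> + \<delta> / 2" by (simp add: cap_center_def ring_distribs)
  ultimately show ?thesis using cap_index_bound[OF assms] \<delta> by linarith
qed

text \<open>The condition for interaction, stated in terms of the centers: the first coordinates can
compensate within the widths of the frequency cut-offs, and so can the second ones. The right-hand
sides 4 and 25 leave a gap of size at least \<open>\<delta>\<close> in the remaining cases.\<close>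

definition cap_quadruple :: "real \<Rightarrow> real \<Rightarrow> nat \<Rightarrow> nat \<Rightarrow> nat \<Rightarrow> nat \<Rightarrow> bool" where
  "cap_quadruple \<delta> w k1 k2 k3 k4 \<longleftrightarrow>
     \<bar>int k1 + int k2 - int k3 - int k4\<bar> \<le> 4 \<and>
     \<bar>(cap_center \<delta> k1)\<^sup>2 + (cap_center \<delta> k2)\<^sup>2 - (cap_center \<delta> k3)\<^sup>2 - (cap_center \<delta> k4)\<^sup>2\<bar> \<le> 25 * w"

lemma cap_quadruple_sym:
  "cap_quadruple \<delta> w k1 k2 k3 k4 \<longleftrightarrow> cap_quadruple \<delta> w k2 k1 k3 k4"
  "cap_quadruple \<delta> w k1 k2 k3 k4 \<longleftrightarrow> cap_quadruple \<delta> w k3 k4 k1 k2"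
  by (auto simp: cap_quadruple_def abs_le_iff algebra_simps)

text \<open>If \<open>c\<^sub>1 + c\<^sub>2 = c\<^sub>3 + c\<^sub>4\<close>, then \<open>c\<^sub>1\<^sup>2 + c\<^sub>2\<^sup>2 - c\<^sub>3\<^sup>2 - c\<^sub>4\<^sup>2 = 2 (c\<^sub>1 - c\<^sub>3) (c\<^sub>1 - c\<^sub>4)\<close>; this
is the curvature of the parabola at work. The first equation holds up to a multiple \<open>e * \<delta>\<close> with
\<open>\<bar>e\<bar> \<le> 4\<close>, and the resulting error \<open>O(\<delta>)\<close> is absorbed by \<open>w \<ge> \<delta>\<close>.\<close>

lemma cap_quadruple_product:
  assumes \<delta>: "0 < \<delta>" "\<delta> \<le> 1 / 4" and w: "\<delta> \<le> w" and k2: "k2 < cap_count \<delta>"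
    and Q: "cap_quadruple \<delta> w k1 k2 k3 k4"
  shows "real_of_int \<bar>(int k1 - int k3) * (int k1 - int k4)\<bar> \<le> 21 * w / \<delta>\<^sup>2"
proof -
  let ?c = "cap_center \<delta>"
  define e where "e = real k1 + real k2 - real k3 - real k4"
  have "\<bar>int k1 + int k2 - int k3 - int k4\<bar> \<le> 4" using Q by (simp add: cap_quadruple_def)
  then have e: "\<bar>e\<bar> \<le> 4" unfolding e_def by linarith
  have c2: "?c k2 = ?c k3 + ?c k4 - ?c k1 + e * \<delta>"
    by (simp add: cap_center_def e_def algebra_simps)
  have "(?c k1)\<^sup>2 + (?c k2)\<^sup>2 - (?c k3)\<^sup>2 - (?c k4)\<^sup>2
      = 2 * ((?c k1 - ?c k3) * (?c k1 - ?c k4)) + e * \<delta> * (2 * ?c k2 - e * \<delta>)"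
    unfolding c2 by (simp add: power2_eq_square algebra_simps)
  moreover have "\<bar>e * \<delta> * (2 * ?c k2 - e * \<delta>)\<bar> \<le> (4 * \<delta>) * 4"
  proof -
    have 1: "\<bar>e * \<delta>\<bar> \<le> 4 * \<delta>" using e \<delta> by (simp add: abs_mult)
    have "\<bar>2 * ?c k2 - e * \<delta>\<bar> \<le> 2 * \<bar>?c k2\<bar> + \<bar>e * \<delta>\<bar>" by arith
    also have "\<dots> \<le> 4" using 1 cap_center_bound[OF \<delta>(1) k2] \<delta> by linarith
    finally show ?thesis unfolding abs_mult[of "e * \<delta>"] using 1 \<delta> by (intro mult_mono) auto
  qed
  ultimately have "\<bar>2 * ((?c k1 - ?c k3) * (?c k1 - ?c k4))\<bar> \<le> 25 * w + 16 * \<delta>"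
    using Q unfolding cap_quadruple_def by linarith
  then have b: "\<bar>(?c k1 - ?c k3) * (?c k1 - ?c k4)\<bar> \<le> 21 * w" using w \<delta> by linarith
  have "?c k1 - ?c k3 = (real k1 - real k3) * \<delta>" "?c k1 - ?c k4 = (real k1 - real k4) * \<delta>"
    by (auto simp: cap_center_def algebra_simps)
  then have "\<bar>(?c k1 - ?c k3) * (?c k1 - ?c k4)\<bar> = \<bar>(real k1 - real k3) * (real k1 - real k4)\<bar> * \<delta>\<^sup>2"
    by (simp add: power2_eq_square abs_mult)
  then have "\<bar>(real k1 - real k3) * (real k1 - real k4)\<bar> * \<delta>\<^sup>2 \<le> 21 * w" using b by simp
  then have "\<bar>(real k1 - real k3) * (real k1 - real k4)\<bar> \<le> 21 * w / \<delta>\<^sup>2"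
    using \<delta> by (simp add: pos_le_divide_eq)
  then show ?thesis by simp
qed

text \<open>For fixed \<open>k1\<close>, a quadruple is determined by the defect \<open>k1 + k2 - k3 - k4\<close>, which takes 9 values,
and by the differences \<open>k1 - k3\<close> and \<open>k1 - k4\<close>, which have a small product.\<close>

lemma card_cap_quadruples:
  assumes \<delta>: "0 < \<delta>" "\<delta> \<le> 1 / 4" and w: "\<delta> \<le> w" and k1: "k1 < cap_count \<delta>"
  shows "real (card {(k2, k3, k4) \<in> {..<cap_count \<delta>} \<times> {..<cap_count \<delta>} \<times> {..<cap_count \<delta>}.
      cap_quadruple \<delta> w k1 k2 k3 k4}) \<le> 2500 * (w / \<delta>\<^sup>2 * \<bar>ln \<delta>\<bar>)"
proof -
  let ?N = "cap_count \<delta>"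
  let ?S = "{(k2, k3, k4) \<in> {..<?N} \<times> {..<?N} \<times> {..<?N}. cap_quadruple \<delta> w k1 k2 k3 k4}"
  define M where "M = ?N - 1"
  define X where "X = 21 * w / \<delta>\<^sup>2"
  let ?D = "{- int M..int M}"
  let ?H = "{(d, d') \<in> ?D \<times> ?D. real_of_int \<bar>d * d'\<bar> \<le> X}"
  let ?\<phi> = "\<lambda>(k2, k3, k4). (int k1 + int k2 - int k3 - int k4, (int k1 - int k3, int k1 - int k4))"
  have X: "0 \<le> X" using w \<delta> by (simp add: X_def)
  have finH: "finite ?H" by (rule finite_subset[of _ "?D \<times> ?D"]) auto
  \<comment> \<open>\<open>?\<phi>\<close> records the defect and the two differences.\<close>
  have "inj_on ?\<phi> ?S" by (auto simp: inj_on_def)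
  moreover have "?\<phi> ` ?S \<subseteq> {-4..4} \<times> ?H"
  proof
    fix t assume "t \<in> ?\<phi> ` ?S"
    then obtain k2 k3 k4 where t: "t = ?\<phi> (k2, k3, k4)" and k: "k2 < ?N" "k3 < ?N" "k4 < ?N"
      and Q: "cap_quadruple \<delta> w k1 k2 k3 k4" by auto
    have "real_of_int \<bar>(int k1 - int k3) * (int k1 - int k4)\<bar> \<le> X"
      unfolding X_def by (rule cap_quadruple_product[OF \<delta> w k(1) Q])
    moreover have "int k1 - int k3 \<in> ?D" "int k1 - int k4 \<in> ?D" using k k1 by (auto simp: M_def)
    moreover have "int k1 + int k2 - int k3 - int k4 \<in> {-4..4}" using Q by (auto simp: cap_quadruple_def)
    ultimately show "t \<in> {-4..4} \<times> ?H" by (simp add: t)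
  qed
  ultimately have "card ?S \<le> card ({-4..4::int} \<times> ?H)"
    using finH by (intro card_inj_on_le[of ?\<phi>]) auto
  then have "real (card ?S) \<le> 9 * real (card ?H)" by (simp add: card_cartesian_product)
  also have "\<dots> \<le> 9 * (4 * real M + 1 + 4 * X * harm M)"
    using card_small_products[OF X refl, of M] by (intro mult_left_mono) auto
  also have "\<dots> \<le> 2500 * (w / \<delta>\<^sup>2 * \<bar>ln \<delta>\<bar>)"
  proof -
    have "8 \<le> 2 / \<delta>" using \<delta> by (simp add: field_simps)
    then have N8: "8 \<le> real ?N" using cap_count_bounds(1)[of \<delta>] \<delta> by linarith
    then have M: "M \<ge> 1" "real M \<le> 2 / \<delta>" using cap_count_bounds(2)[of \<delta>] \<delta> by (auto simp: M_def)
    have L1: "1 \<le> ln (1 / \<delta>)"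
    proof -
      have "3 \<le> 1 / \<delta>" using \<delta> by (simp add: field_simps)
      then have "exp 1 \<le> 1 / \<delta>" using exp_le by linarith
      then show ?thesis using \<delta> by (subst ln_ge_iff) auto
    qed
    define Lg where "Lg = ln (1 / \<delta>)"
    have Lg: "\<bar>ln \<delta>\<bar> = Lg" using L1 \<delta> by (simp add: Lg_def ln_div)
    have "harm M \<le> 1 + ln (real M)" by (rule harm_le_1_plus_ln[OF M(1)])
    also have "ln (real M) \<le> ln (2 / \<delta>)" using M \<delta> by (intro ln_mono) auto
    also have "ln (2 / \<delta>) = ln 2 + Lg" using \<delta> by (simp add: Lg_def ln_div)
    also have "ln 2 \<le> (1::real)" using ln_2_less_1 by simp
    finally have h: "harm M \<le> 3 * Lg" using L1 by (simp add: Lg_def)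
    let ?y = "w / \<delta>\<^sup>2"
    have y: "1 / \<delta> \<le> ?y" "1 \<le> 1 / \<delta>" using w \<delta> by (auto simp: field_simps power2_eq_square)
    have "?y * 1 \<le> ?y * Lg" using L1 y unfolding Lg_def by (intro mult_left_mono) linarith+
    moreover have "4 * real M + 1 \<le> 9 * ?y" using M y by simp
    moreover have "4 * X * harm M \<le> 4 * (21 * ?y) * (3 * Lg)"
      unfolding X_def using h y by (intro mult_mono) (auto simp: harm_nonneg)
    moreover have "0 \<le> ?y * Lg" using \<open>?y * 1 \<le> ?y * Lg\<close> y by linarith
    ultimately have "4 * real M + 1 + 4 * X * harm M \<le> 9 * (?y * Lg) + 252 * (?y * Lg)" by linarith
    then have "9 * (4 * real M + 1 + 4 * X * harm M) \<le> 9 * (9 * (?y * Lg) + 252 * (?y * Lg))"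
      by (rule mult_left_mono) simp
    also have "\<dots> \<le> 2500 * (?y * Lg)"
    proof -
      have "9 * (9 * t + 252 * t) \<le> 2500 * t" if "0 \<le> t" for t :: real using that by simp
      then show ?thesis using \<open>0 \<le> ?y * Lg\<close> .
    qed
    finally show ?thesis unfolding Lg .
  qed
  finally show ?thesis .
qed

lemma card_close_indices: "real (card {l \<in> {..<N}. \<bar>int k - int l\<bar> \<le> 2}) \<le> 5"
proof -
  have "int ` {l \<in> {..<N}. \<bar>int k - int l\<bar> \<le> 2} \<subseteq> {int k - 2..int k + 2}" by auto
  then have "card (int ` {l \<in> {..<N}. \<bar>int k - int l\<bar> \<le> 2}) \<le> card {int k - 2..int k + 2}"
    by (rule card_mono[rotated]) simp
  then show ?thesis by (simp add: card_image)
qed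

section \<open>Endpoint bounds for the cap operators\<close>

lemma abs_coordinates_le_norm: "\<bar>fst z\<bar> \<le> norm z" "\<bar>snd z\<bar> \<le> norm (z :: plane)"
  using norm_fst_le[of "fst z" "snd z"] norm_snd_le[of "snd z" "fst z"] by simp_all

text \<open>The half height \<open>3 * w\<close> takes into account that over a cap the parabola deviates from
\<open>(cap_center \<delta> k)\<^sup>2\<close> by at most \<open>2 * \<delta> \<le> 2 * w\<close>; compare \<open>cap_multiplier_on_small_cap\<close>.\<close>

definition cap_multiplier :: "real \<Rightarrow> real \<Rightarrow> nat \<Rightarrow> plane \<Rightarrow> complex" where
  "cap_multiplier \<delta> w k = profile_box trapezoid (cap_center \<delta> k, (cap_center \<delta> k)\<^sup>2) (\<delta> / 2) (3 * w)"

definition cap_kernel :: "real \<Rightarrow> real \<Rightarrow> nat \<Rightarrow> plane \<Rightarrow> complex" where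
  "cap_kernel \<delta> w k = inv_fourier (cap_multiplier \<delta> w k)"

lemma cap_multiplier_support:
  assumes "\<delta> > 0" "w > 0" "cap_multiplier \<delta> w k \<xi> \<noteq> 0"
  shows "\<bar>fst \<xi> - cap_center \<delta> k\<bar> < \<delta>" "\<bar>snd \<xi> - (cap_center \<delta> k)\<^sup>2\<bar> < 6 * w"
proof -
  have "trapezoid ((fst \<xi> - cap_center \<delta> k) / (\<delta> / 2)) \<noteq> 0" "trapezoid
      ((snd \<xi> - (cap_center \<delta> k)\<^sup>2) / (3 * w)) \<noteq> 0"
    using assms(3) by (auto simp: cap_multiplier_def profile_box_def)
  from this[THEN trapezoid_values(2)]
  have "\<bar>fst \<xi> - cap_center \<delta> k\<bar> / (\<delta> / 2) < 2" "\<bar>snd \<xi> - (cap_center \<delta> k)\<^sup>2\<bar> / (3 * w) < 2"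
    using assms(1,2) by (simp_all only: abs_divide abs_mult abs_numeral abs_of_pos)
  then show "\<bar>fst \<xi> - cap_center \<delta> k\<bar> < \<delta>" "\<bar>snd \<xi> - (cap_center \<delta> k)\<^sup>2\<bar> < 6 * w"
    using assms(1,2) by (simp_all add: divide_less_eq)
qed

lemma cap_multiplier_eq_1:
  assumes "\<delta> > 0" "w > 0" "\<bar>fst \<xi> - cap_center \<delta> k\<bar> \<le> \<delta> / 2" "\<bar>snd \<xi> - (cap_center \<delta> k)\<^sup>2\<bar> \<le> 3 * w"
  shows "cap_multiplier \<delta> w k \<xi> = 1"
proof -
  have "\<bar>(fst \<xi> - cap_center \<delta> k) / (\<delta> / 2)\<bar> \<le> 1" "\<bar>(snd \<xi> - (cap_center \<delta> k)\<^sup>2) / (3 * w)\<bar> \<le> 1"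
    unfolding abs_divide using assms by (simp_all add: divide_le_eq)
  then show ?thesis by (simp add: cap_multiplier_def profile_box_def trapezoid_values(1))
qed

lemma cap_multiplier_integrable:
  "\<delta> > 0 \<Longrightarrow> w > 0 \<Longrightarrow> integrable lborel (cap_multiplier \<delta> w k)"
  unfolding cap_multiplier_def by (rule integrable_profile_box[OF integrable_trapezoid]) auto

lemma cap_kernel_integrable:
  assumes "\<delta> > 0" "w > 0"
  shows "integrable lborel (cap_kernel \<delta> w k)" "(LINT x|lborel. norm (cap_kernel \<delta> w k x)) = young_const"
  using inv_fourier_profile_box_integrable[OF integrable_trapezoid integrable_trapezoid_hat, of "\<delta> / 2" "3
      * w"] assms
  by (auto simp: cap_kernel_def cap_multiplier_def young_const_def)

lemma fourier_cap_kernel: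
  assumes "\<delta> > 0" "w > 0"
  shows "fourier (cap_kernel \<delta> w k) \<xi> = cap_multiplier \<delta> w k \<xi>"
  unfolding cap_kernel_def cap_multiplier_def
  by (rule fourier_inv_fourier_profile_box[OF integrable_trapezoid integrable_trapezoid_hat
      continuous_trapezoid trapezoid_values(3)])
    (use assms in auto)

lemma young_const_nonneg: "0 \<le> young_const"
  by (simp add: young_const_def)

lemma cap_convol_eq:
  assumes "\<delta> > 0" "w > 0" and g: "test_function g"
  shows "convol (cap_kernel \<delta> w k) g = inv_fourier (\<lambda>\<xi>. cap_multiplier \<delta> w k \<xi> * fourier g \<xi>)"
    and "integrable lborel (\<lambda>\<xi>. cap_multiplier \<delta> w k \<xi> * fourier g \<xi>)"
  using convol_eq_inv_fourier[OF cap_multiplier_integrable[OF assms(1,2)] test_function_integrable[OF g]]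
    integrable_mult_fourier[OF cap_multiplier_integrable[OF assms(1,2)] test_function_integrable[OF g]]
  by (simp_all add: cap_kernel_def)

lemma convol_uniform_bound:
  assumes fin: "finite I" and K: "\<And>k. k \<in> I \<Longrightarrow> integrable lborel (K k)" and g: "\<And>k. k \<in> I
      \<Longrightarrow> test_function (g k)"
  shows "\<exists>M. \<forall>k\<in>I. \<forall>x. norm (convol (K k) (g k) x) \<le> M"
proof -
  have "\<exists>M. \<forall>x. norm (convol (K k) (g k) x) \<le> M" if k: "k \<in> I" for k
  proof -
    obtain s where "\<And>y. norm (g k y) \<le> s" using g[OF k] unfolding test_function_def by blast
    then show ?thesis using norm_convol_le[OF K[OF k] test_function_measurable[OF g[OF k]]] by blast
  qed
  then obtain M where M: "\<And>k x. k \<in> I \<Longrightarrow> norm (convol (K k) (g k) x) \<le> M k" by metis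
  have "norm (convol (K k) (g k) x) \<le> Max (insert 0 (M ` I))" if "k \<in> I" for k x
    using order_trans[OF M[OF that] Max_ge[of "insert 0 (M ` I)" "M k"]] fin that by simp
  then show ?thesis by blast
qed

text \<open>An orthogonality estimate for the functions \<open>convol (K k) (g k)\<close> becomes a bound in terms of \<open>g\<close> by
Young's inequality.\<close>

lemma strong_bound_of_orthogonality:
  assumes fin: "finite I" and K: "\<And>k. k \<in> I \<Longrightarrow> integrable lborel (K k)" and \<kappa>: "\<And>k. k \<in> I
      \<Longrightarrow> (LINT x|lborel. norm (K k x)) = \<kappa>"
    and n: "n = 2 \<or> n = 4" and m: "0 \<le> m"
    and bound: "\<And>g. (\<And>k. k \<in> I \<Longrightarrow> test_function (g k)) \<Longrightarrow>
      (LINT x|lborel. norm (\<Sum>k\<in>I. convol (K k) (g k) x) ^ n) \<le> m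
          * (\<Sum>k\<in>I. LINT x|lborel. norm (convol (K k) (g k) x) ^ n)"
  shows "strong_bound K I (real n) (m * \<kappa> ^ n)"
  unfolding strong_bound_def
proof (intro allI impI)
  fix g assume "\<forall>k\<in>I. test_function (g k)"
  then have g: "\<And>k. k \<in> I \<Longrightarrow> test_function (g k)" by blast
  obtain M where M: "\<And>k x. k \<in> I \<Longrightarrow> norm (convol (K k) (g k) x) \<le> M"
  proof -
    have "\<exists>M. \<forall>k\<in>I. \<forall>x. norm (convol (K k) (g k) x) \<le> M"
      by (rule convol_uniform_bound[OF fin]) (rule K g, assumption)+
    then show ?thesis using that by blast
  qed
  obtain n' where n': "n = Suc n'" using n by (cases n) auto
  have pw: "norm z powr real n = norm z ^ n" for z :: complex
    using n by auto
  have int: "integrable lborel (\<lambda>x. norm (convol (K k) (g k) x) ^ n)" if "k \<in> I" for k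
    unfolding n' using integrable_norm_power[OF convol_L1[OF K g] M] that by blast
  let ?S = "multi_convol K I g"
  have S: "integrable lborel ?S" unfolding multi_convol_def[abs_def]
    by (intro Bochner_Integration.integrable_sum convol_L1 K g)
  have "norm (?S x) \<le> real (card I) * M" for x
    unfolding multi_convol_def by (rule order_trans[OF norm_sum sum_bounded_above]) (rule M)
  from integrable_norm_power[OF S this] have intS: "integrable lborel (\<lambda>x. norm (?S x) ^ n)" unfolding n' .
  have "Lp_power (real n) ?S = ennreal (LINT x|lborel. norm (?S x) ^ n)"
    unfolding pw by (rule nn_integral_eq_integral[OF intS]) simp
  also have "\<dots> \<le> ennreal (m * (\<Sum>k\<in>I. LINT x|lborel. norm (convol (K k) (g k) x) ^ n))"
    using bound[OF g] by (intro ennreal_leI) (simp add: multi_convol_def)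
  also have "\<dots> = ennreal m * (\<Sum>k\<in>I. \<integral>\<^sup>+ x. ennreal (norm (convol (K k) (g k) x) ^ n) \<partial>lborel)"
  proof -
    have "(\<integral>\<^sup>+ x. ennreal (norm (convol (K k) (g k) x) ^ n) \<partial>lborel)
        = ennreal (LINT x|lborel. norm (convol (K k) (g k) x) ^ n)" if "k \<in> I" for k
      by (rule nn_integral_eq_integral[OF int[OF that]]) simp
    then show ?thesis using m by (simp add: ennreal_mult sum_nonneg)
  qed
  also have "\<dots> \<le> ennreal m * (\<Sum>k\<in>I. ennreal (\<kappa> ^ n) * (\<integral>\<^sup>+ x. ennreal (norm (g k x) ^ n) \<partial>lborel))"
  proof (intro mult_left_mono sum_mono)
    fix k assume k: "k \<in> I"
    show "(\<integral>\<^sup>+ x. ennreal (norm (convol (K k) (g k) x) ^ n) \<partial>lborel) \<le> ennreal (\<kappa> ^ n)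
        * (\<integral>\<^sup>+ x. ennreal (norm (g k x) ^ n) \<partial>lborel)"
      using n young_1_2_4(2,3)[OF K[OF k] g[OF k]] unfolding \<kappa>[OF k] by auto
  qed simp
  also have "\<dots> = ennreal (m * \<kappa> ^ n) * (\<Sum>k\<in>I. Lp_power (real n) (g k))"
  proof -
    have "0 \<le> \<kappa> ^ n" using n by auto
    then have "ennreal (m * \<kappa> ^ n) = ennreal m * ennreal (\<kappa> ^ n)" using m by (intro ennreal_mult)
    then show ?thesis unfolding pw by (simp add: sum_distrib_left mult.assoc)
  qed
  finally show "Lp_power (real n) ?S
    \<le> ennreal (m * \<kappa> ^ n) * (\<Sum>k\<in>I. Lp_power (real n) (g k))" .
qed

text \<open>The cut-offs of caps with indices at distance 3 or more have disjoint supports, already in the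
first coordinate.\<close>

lemma cap_strong_bound_2:
  assumes \<delta>: "0 < \<delta>" and w: "0 < w"
  shows "strong_bound (cap_kernel \<delta> w) {..<N} 2 (5 * young_const ^ 2)"
proof -
  let ?K = "cap_kernel \<delta> w" and ?I = "{..<N}"
  have "strong_bound ?K ?I (real 2) (5 * young_const ^ 2)"
  proof (rule strong_bound_of_orthogonality)
    fix g assume g: "\<And>k. k \<in> ?I \<Longrightarrow> test_function (g k :: plane \<Rightarrow> complex)"
    let ?h = "\<lambda>k. convol (?K k) (g k)"
    obtain M where M: "\<And>k x. k \<in> ?I \<Longrightarrow> norm (?h k x) \<le> M"
    proof -
      have "\<exists>M. \<forall>k\<in>?I. \<forall>x. norm (?h k x) \<le> M"
        by (rule convol_uniform_bound[OF _ cap_kernel_integrable(1)[OF \<delta> w] g]) auto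
      then show ?thesis using that by blast
    qed
    have h: "integrable lborel (?h k)" if "k \<in> ?I" for k
      by (rule convol_L1[OF cap_kernel_integrable(1)[OF \<delta> w] g[OF that]])
    show "(LINT x|lborel. norm (\<Sum>k\<in>?I. ?h k x) ^ 2) \<le> 5 * (\<Sum>k\<in>?I. LINT x|lborel. norm (?h k x) ^ 2)"
    proof (rule almost_orthogonal_L2[where Q="\<lambda>k l. \<bar>int k - int l\<bar> \<le> 2"])
      fix k l assume kl: "k \<in> ?I" "l \<in> ?I" "\<not> \<bar>int k - int l\<bar> \<le> 2"
      note e = cap_convol_eq[OF \<delta> w]
      show "(LINT x|lborel. ?h k x * cnj (?h l x)) = 0"
        unfolding e(1)[OF g[OF kl(1)]] e(1)[OF g[OF kl(2)]]
      proof (rule integral_inv_fourier_pair_zero[OF e(2)[OF g[OF kl(1)]] e(2)[OF g[OF kl(2)]] \<delta>])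
        show "integrable lborel (\<lambda>x. inv_fourier (\<lambda>\<xi>. cap_multiplier \<delta> w k \<xi> * fourier (g k) \<xi>) x *
            cnj (inv_fourier (\<lambda>\<xi>. cap_multiplier \<delta> w l \<xi> * fourier (g l) \<xi>) x))"
          unfolding e(1)[OF g[OF kl(1)], symmetric] e(1)[OF g[OF kl(2)], symmetric]
        proof (rule integrable_bounded_mult[where M=M])
          show "(\<lambda>x. cnj (?h l x)) \<in> borel_measurable borel"
            by (rule measurable_compose[OF _ cnj_measurable]) (use h[OF kl(2)] in auto)
        qed (use h M kl in auto)
        fix \<xi> \<eta> assume "cap_multiplier \<delta> w k \<xi> * fourier (g k) \<xi> \<noteq> 0" "cap_multiplier \<delta> w l \<eta>
            * fourier (g l) \<eta> \<noteq> 0"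
        then have b: "\<bar>fst \<xi> - cap_center \<delta> k\<bar> < \<delta>" "\<bar>fst \<eta> - cap_center \<delta> l\<bar> < \<delta>"
          using cap_multiplier_support(1)[OF \<delta> w] by auto
        have "3 \<le> \<bar>real k - real l\<bar>" using kl(3) by linarith
        then have "3 * \<delta> \<le> \<bar>real k - real l\<bar> * \<delta>" using \<delta> by (intro mult_right_mono) auto
        also have "\<bar>real k - real l\<bar> * \<delta> = \<bar>(real k - real l) * \<delta>\<bar>" using \<delta> by (simp add: abs_mult)
        also have "(real k - real l) * \<delta> = cap_center \<delta> k - cap_center \<delta> l"
            by (simp add: cap_center_def algebra_simps)
        finally have "\<delta> \<le> \<bar>fst (\<xi> - \<eta>)\<bar>" using b by simp
        also have "\<dots> \<le> norm (\<xi> - \<eta>)" by (rule abs_coordinates_le_norm)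
        finally show "\<delta> \<le> norm (\<xi> - \<eta>)" .
      qed
    next
      show "real (card {l \<in> ?I. \<bar>int k - int l\<bar> \<le> 2}) \<le> 5" for k by (rule card_close_indices)
    qed (use h M in auto)
  qed (use cap_kernel_integrable[OF \<delta> w] in auto)
  then show ?thesis by simp
qed

text \<open>For a quadruple that violates \<open>cap_quadruple\<close>, one of the two coordinates of a sum of four
frequencies with signs is at least \<open>\<delta>\<close> in absolute value, so that the corresponding integral vanishes.\<close>

lemma cap_strong_bound_4:
  assumes \<delta>: "0 < \<delta>" "\<delta> \<le> 1 / 4" and w: "\<delta> \<le> w"
  shows "strong_bound (cap_kernel \<delta> w) {..<cap_count \<delta>} 4 (2500 * (w / \<delta>\<^sup>2 * \<bar>ln \<delta>\<bar>) * young_const ^ 4)"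
proof -
  let ?K = "cap_kernel \<delta> w" and ?I = "{..<cap_count \<delta>}"
  have w0: "0 < w" using \<delta> w by linarith
  let ?m = "2500 * (w / \<delta>\<^sup>2 * \<bar>ln \<delta>\<bar>)"
  have "strong_bound ?K ?I (real 4) (?m * young_const ^ 4)"
  proof (rule strong_bound_of_orthogonality)
    show "0 \<le> ?m" using w0 by simp
    fix g assume g: "\<And>k. k \<in> ?I \<Longrightarrow> test_function (g k :: plane \<Rightarrow> complex)"
    let ?h = "\<lambda>k. convol (?K k) (g k)"
    let ?H = "\<lambda>k \<xi>. cap_multiplier \<delta> w k \<xi> * fourier (g k) \<xi>"
    obtain M where M: "\<And>k x. k \<in> ?I \<Longrightarrow> norm (?h k x) \<le> M"
    proof -
      have "\<exists>M. \<forall>k\<in>?I. \<forall>x. norm (?h k x) \<le> M"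
        by (rule convol_uniform_bound[OF _ cap_kernel_integrable(1)[OF \<delta>(1) w0] g]) auto
      then show ?thesis using that by blast
    qed
    have h: "integrable lborel (?h k)" if "k \<in> ?I" for k
      by (rule convol_L1[OF cap_kernel_integrable(1)[OF \<delta>(1) w0] g[OF that]])
    have e: "?h k = inv_fourier (?H k)" "integrable lborel (?H k)" if "k \<in> ?I" for k
      using cap_convol_eq[OF \<delta>(1) w0 g[OF that]] by auto
    show "(LINT x|lborel. norm (\<Sum>k\<in>?I. ?h k x) ^ 4) \<le> ?m * (\<Sum>k\<in>?I. LINT x|lborel. norm (?h k x) ^ 4)"
    proof (rule almost_orthogonal_L4[where Q="cap_quadruple \<delta> w"])
      fix k1 k2 k3 k4 assume k: "k1 \<in> ?I" "k2 \<in> ?I" "k3 \<in> ?I" "k4 \<in> ?I"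
          and Q: "\<not> cap_quadruple \<delta> w k1 k2 k3 k4"
      have meas: "?h k \<in> borel_measurable borel" if "k \<in> ?I" for k using h[OF that] by auto
      note [measurable] = meas[OF k(1)] meas[OF k(2)] meas[OF k(3)] meas[OF k(4)]
      have "integrable lborel (\<lambda>x. ?h k1 x * (?h k2 x * (cnj (?h k3 x) * cnj (?h k4 x))))"
      proof (rule integrable_bounded_mult[OF h[OF k(1)], where M="M * (M * M)"])
        show "norm (?h k2 x * (cnj (?h k3 x) * cnj (?h k4 x))) \<le> M * (M * M)" for x
          unfolding norm_mult complex_mod_cnj using M k order_trans[OF norm_ge_zero M[OF k(1)]]
          by (intro mult_mono) auto
      qed measurable
      then have int: "integrable lborel (\<lambda>x. ?h k1 x * ?h k2 x * (cnj (?h k3 x) * cnj (?h k4 x)))"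
        by (simp only: mult.assoc)
      show "(LINT x|lborel. ?h k1 x * ?h k2 x * (cnj (?h k3 x) * cnj (?h k4 x))) = 0"
        unfolding e(1)[OF k(1)] e(1)[OF k(2)] e(1)[OF k(3)] e(1)[OF k(4)]
      proof (rule integral_inv_fourier_quadruple_zero[OF e(2)[OF k(1)] e(2)[OF k(2)] e(2)[OF k(3)]
          e(2)[OF k(4)] \<delta>(1)])
        show "integrable lborel (\<lambda>x. inv_fourier (?H k1) x * inv_fourier (?H k2) x
            * (cnj (inv_fourier (?H k3) x) * cnj (inv_fourier (?H k4) x)))"
          using int unfolding e(1)[OF k(1)] e(1)[OF k(2)] e(1)[OF k(3)] e(1)[OF k(4)] .
        fix \<xi>1 \<xi>2 \<xi>3 \<xi>4 assume nz: "?H k1 \<xi>1 \<noteq> 0" "?H k2 \<xi>2 \<noteq> 0" "?H k3 \<xi>3 \<noteq> 0" "?H k4 \<xi>4 \<noteq> 0"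
        let ?c = "cap_center \<delta>"
        let ?z = "\<xi>1 + \<xi>2 - \<xi>3 - \<xi>4"
        have b: "\<bar>fst \<xi> - ?c k\<bar> < \<delta>" "\<bar>snd \<xi> - (?c k)\<^sup>2\<bar> < 6 * w" if "?H k \<xi> \<noteq> 0" for k \<xi>
          using cap_multiplier_support[OF \<delta>(1) w0, of k \<xi>] that by auto
        note b1 = b[OF nz(1)] and b2 = b[OF nz(2)] and b3 = b[OF nz(3)] and b4 = b[OF nz(4)]
        have z: "fst ?z = fst \<xi>1 + fst \<xi>2 - fst \<xi>3 - fst \<xi>4" "snd ?z = snd \<xi>1 + snd \<xi>2 - snd \<xi>3 - snd \<xi>4"
          by simp_all
        consider "5 \<le> \<bar>int k1 + int k2 - int k3 - int k4\<bar>" | "25 * w < \<bar>(?c k1)\<^sup>2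
            + (?c k2)\<^sup>2 - (?c k3)\<^sup>2 - (?c k4)\<^sup>2\<bar>"
          using Q unfolding cap_quadruple_def by linarith
        then show "\<delta> \<le> norm ?z"
        proof cases
          case 1
          then have "5 \<le> \<bar>real k1 + real k2 - real k3 - real k4\<bar>" by linarith
          then have "5 * \<delta> \<le> \<bar>real k1 + real k2 - real k3 - real k4\<bar> * \<delta>" using \<delta>
              by (intro mult_right_mono) auto
          also have "\<dots> = \<bar>(real k1 + real k2 - real k3 - real k4) * \<delta>\<bar>" using \<delta> by (simp add: abs_mult)
          also have "(real k1 + real k2 - real k3 - real k4) * \<delta> = ?c k1 + ?c k2 - ?c k3 - ?c k4"
            by (simp add: cap_center_def algebra_simps)
          finally have "\<delta> \<le> \<bar>fst ?z\<bar>" unfolding z using b1(1) b2(1) b3(1) b4(1) by linarith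
          then show ?thesis using abs_coordinates_le_norm(1)[of ?z] by linarith
        next
          case 2
          then have "w \<le> \<bar>snd ?z\<bar>" unfolding z using b1(2) b2(2) b3(2) b4(2) by linarith
          then show ?thesis using abs_coordinates_le_norm(2)[of ?z] w by linarith
        qed
      qed
    next
      show "real (card {(k2, k3, k4) \<in> ?I \<times> ?I \<times> ?I. cap_quadruple \<delta> w k1 k2 k3 k4}) \<le> ?m" if "k1 \<in> ?I" for k1
        using card_cap_quadruples[OF \<delta> w, of k1] that by simp
    next
      show "cap_quadruple \<delta> w k1 k2 k3 k4 \<longleftrightarrow> cap_quadruple \<delta> w k2 k1 k3 k4" for k1 k2 k3 k4
        by (rule cap_quadruple_sym)
      show "cap_quadruple \<delta> w k1 k2 k3 k4 \<longleftrightarrow> cap_quadruple \<delta> w k3 k4 k1 k2" for k1 k2 k3 k4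
        by (rule cap_quadruple_sym)
    qed (use h M in auto)
  qed (use cap_kernel_integrable[OF \<delta>(1) w0] in auto)
  then show ?thesis by simp
qed

lemma cap_sup_bound:
  assumes \<delta>: "0 < \<delta>" and w: "0 < w" and g: "\<And>k. k \<in> {..<N} \<Longrightarrow> test_function (g k)"
    and s: "\<And>k y. k \<in> {..<N} \<Longrightarrow> norm (g k y) \<le> s"
  shows "norm (multi_convol (cap_kernel \<delta> w) {..<N} g x) \<le> real N * young_const * s"
proof -
  have "norm (convol (cap_kernel \<delta> w k) (g k) x) \<le> young_const * s" if "k \<in> {..<N}" for k
    using norm_convol_le[OF cap_kernel_integrable(1)[OF \<delta> w] test_function_measurable[OF g[OF that]]
        s[OF that]]
    by (simp add: cap_kernel_integrable(2)[OF \<delta> w])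
  then have "(\<Sum>k\<in>{..<N}. norm (convol (cap_kernel \<delta> w k) (g k) x)) \<le> real (card {..<N}) * (young_const * s)"
    by (rule sum_bounded_above)
  then show ?thesis
    unfolding multi_convol_def by (intro order_trans[OF norm_sum]) (simp add: mult.assoc)
qed

section \<open>Decoupling from operator bounds\<close>

text \<open>For \<open>a > 0\<close> the powers behave as for real numbers, also at \<open>\<infinity>\<close>.\<close>

lemma epowr_inverse: "a > 0 \<Longrightarrow> epowr (epowr x (1 / a)) a = x"
  by (cases x) (auto simp: epowr_def powr_powr)

lemma epowr_mono:
  assumes "x \<le> y" "a > 0" shows "epowr x a \<le> epowr y a"
proof (cases "y = \<infinity>")
  case False
  then have "x \<noteq> \<infinity>" using assms by (auto simp: top_unique)
  moreover have "enn2real x \<le> enn2real y" using assms False by (intro enn2real_mono) (auto simp: less_top)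
  ultimately show ?thesis using False assms by (simp add: epowr_def powr_mono2 ennreal_leI)
qed (simp add: epowr_def)

lemma epowr_cmult:
  assumes "c > 0" "a > 0" shows "epowr (ennreal c * x) a = ennreal (c powr a) * epowr x a"
proof (cases "x = \<infinity>")
  case True
  then show ?thesis using assms by (simp add: epowr_def ennreal_mult_top)
next
  case False
  then show ?thesis using assms
    by (simp add: epowr_def enn2real_mult powr_mult ennreal_mult ennreal_mult_eq_top_iff)
qed

lemma epowr_Lp_norm: "p > 0 \<Longrightarrow> epowr (Lp_norm p f) p = Lp_power p f"
  unfolding Lp_norm_def by (rule epowr_inverse)

lemma decoupling_const_le:
  assumes p: "p > 0" and M: "M > 0"
    and bound: "\<And>f F. has_fourier_transform f F \<Longrightarrow> (\<And>\<xi>. \<xi> \<notin> parabola_nbhd (\<delta> powr \<beta>) \<Longrightarrow> F \<xi> = 0) \<Longrightarrow>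
      Lp_power p f
        \<le> ennreal M * (\<Sum>\<gamma>\<in>small_caps \<delta> \<beta>. Lp_power p (cap_part F \<gamma>))"
  shows "decoupling_const p \<delta> \<beta> \<le> ennreal (M powr (1 / p))"
  unfolding decoupling_const_def
proof (rule Inf_lower, safe)
  fix f F assume "has_fourier_transform f F" "\<forall>\<xi>. \<xi> \<notin> parabola_nbhd (\<delta> powr \<beta>) \<longrightarrow> F \<xi> = 0"
  then have "Lp_power p f
        \<le> ennreal M * (\<Sum>\<gamma>\<in>small_caps \<delta> \<beta>. Lp_power p (cap_part F \<gamma>))"
    using bound by blast
  then have "Lp_norm p f \<le> epowr (ennreal M * (\<Sum>\<gamma>\<in>small_caps \<delta> \<beta>. Lp_power p (cap_part F \<gamma>))) (1 / p)"
    unfolding Lp_norm_def by (rule epowr_mono) (use p in simp)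
  then show "Lp_norm p f \<le> ennreal (M powr (1 / p))
      * epowr (\<Sum>\<gamma>\<in>small_caps \<delta> \<beta>. epowr (Lp_norm p (cap_part F \<gamma>)) p) (1 / p)"
    using p M by (simp add: epowr_cmult epowr_Lp_norm)
qed

definition small_cap :: "real \<Rightarrow> real \<Rightarrow> nat \<Rightarrow> plane set" where
  "small_cap \<delta> \<beta> k = {(\<xi>1, \<xi>2) \<in> parabola_nbhd (\<delta> powr \<beta>). \<xi>1 \<in> cap_interval \<delta> k}"

lemma small_caps_eq: "small_caps \<delta> \<beta> = small_cap \<delta> \<beta> ` {..<cap_count \<delta>}"
  by (simp add: small_caps_def small_cap_def cap_count_def image_def)

lemma cap_interval_bounds:
  assumes "t \<in> cap_interval \<delta> k"
  shows "-1 + real k * \<delta> \<le> t" "t \<le> -1 + real k * \<delta> + \<delta>" "k \<noteq> 0 \<Longrightarrow> -1 + real k * \<delta> < t" "\<bar>t\<bar> \<le> 1"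
  using assms by (auto simp: cap_interval_def algebra_simps split: if_splits)

lemma cap_interval_center:
  assumes "t \<in> cap_interval \<delta> k" shows "\<bar>t - cap_center \<delta> k\<bar> \<le> \<delta> / 2"
proof -
  have "cap_center \<delta> k = -1 + real k * \<delta> + \<delta> / 2" by (simp add: cap_center_def algebra_simps)
  then show ?thesis using cap_interval_bounds(1,2)[OF assms] by linarith
qed

lemma cap_interval_unique:
  assumes \<delta>: "\<delta> > 0" and k: "t \<in> cap_interval \<delta> k" and l: "t \<in> cap_interval \<delta> l"
  shows "k = l"
proof -
  have "\<not> k' < l'" if k': "t \<in> cap_interval \<delta> k'" and l': "t \<in> cap_interval \<delta> l'" for k' l'
  proof
    assume "k' < l'"
    then have "real k' + 1 \<le> real l'" by simp
    then have "(real k' + 1) * \<delta> \<le> real l' * \<delta>" using \<delta> by (intro mult_right_mono) auto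
    moreover have "-1 + real l' * \<delta> < t" using cap_interval_bounds(3)[OF l'] \<open>k' < l'\<close> by simp
    ultimately show False using cap_interval_bounds(2)[OF k'] by (simp add: ring_distribs)
  qed
  from this[OF k l] this[OF l k] show ?thesis by simp
qed

lemma cap_interval_cover:
  assumes \<delta>: "\<delta> > 0" and t: "\<bar>t\<bar> \<le> 1"
  obtains k where "k < cap_count \<delta>" "t \<in> cap_interval \<delta> k"
proof (cases "t = -1")
  case True
  have "0 < 2 / \<delta>" using \<delta> by simp
  then have "0 < cap_count \<delta>" unfolding cap_count_def by simp
  moreover have "t \<in> cap_interval \<delta> 0" using True \<delta> by (simp add: cap_interval_def)
  ultimately show ?thesis by (rule that)
next
  case False
  define m where "m = \<lceil>(t + 1) / \<delta>\<rceil>"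
  have pos: "0 < (t + 1) / \<delta>" using False t \<delta> by simp
  then have m1: "1 \<le> m" unfolding m_def by linarith
  define k where "k = nat (m - 1)"
  have mk: "real_of_int m = real k + 1" using m1 by (simp add: k_def)
  have a: "real k < (t + 1) / \<delta>" "(t + 1) / \<delta> \<le> real k + 1" using mk unfolding m_def by linarith+
  then have b: "-1 + real k * \<delta> < t" "t \<le> -1 + (real k + 1) * \<delta>" using \<delta> by (simp_all add: field_simps)
  then have "t \<in> cap_interval \<delta> k" using t by (auto simp: cap_interval_def algebra_simps)
  moreover have "k < cap_count \<delta>"
  proof -
    have "(t + 1) / \<delta> \<le> 2 / \<delta>" using t \<delta> by (intro divide_right_mono) auto
    then have "m \<le> \<lceil>2 / \<delta>\<rceil>" unfolding m_def by (rule ceiling_mono)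
    then show ?thesis using m1 unfolding k_def cap_count_def by linarith
  qed
  ultimately show ?thesis using that by blast
qed

text \<open>Sums over the set of caps can thus be taken over the indices; each cap contains a point of the
parabola.\<close>

lemma inj_small_cap:
  assumes \<delta>: "\<delta> > 0" shows "inj_on (small_cap \<delta> \<beta>) {..<cap_count \<delta>}"
proof (rule inj_onI)
  fix k l assume k: "k \<in> {..<cap_count \<delta>}" and eq: "small_cap \<delta> \<beta> k = small_cap \<delta> \<beta> l"
  define t where "t = min 1 (-1 + (real k + 1) * \<delta>)"
  have "real k * \<delta> < 2" using cap_index_bound[OF \<delta>] k by simp
  then have "t \<in> cap_interval \<delta> k" using \<delta> by (auto simp: t_def cap_interval_def min_def algebra_simps)
  then have "(t, t\<^sup>2) \<in> small_cap \<delta> \<beta> k"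
    using cap_interval_bounds(4) by (auto simp: small_cap_def parabola_nbhd_def)
  then have "(t, t\<^sup>2) \<in> small_cap \<delta> \<beta> l" using eq by simp
  then have "t \<in> cap_interval \<delta> l" by (simp add: small_cap_def)
  with \<open>t \<in> cap_interval \<delta> k\<close> show "k = l" by (rule cap_interval_unique[OF \<delta>])
qed

lemma small_cap_measurable [measurable]: "small_cap \<delta> \<beta> k \<in> sets borel"
proof -
  have "small_cap \<delta> \<beta> k = {\<xi> \<in> space borel. \<bar>fst \<xi>\<bar> \<le> 1 \<and> \<bar>snd \<xi> - (fst \<xi>)\<^sup>2\<bar> \<le> \<delta> powr \<beta> \<and> fst \<xi>
      \<in> cap_interval \<delta> k}"
    by (auto simp: small_cap_def parabola_nbhd_def)
  moreover have [measurable]: "cap_interval \<delta> k \<in> sets borel" by (simp add: cap_interval_def)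
  ultimately show ?thesis by simp
qed

lemma sum_indicator_small_caps:
  assumes \<delta>: "\<delta> > 0" and \<xi>: "\<xi> \<in> parabola_nbhd (\<delta> powr \<beta>)"
  shows "(\<Sum>k<cap_count \<delta>. indicator (small_cap \<delta> \<beta> k) \<xi> :: complex) = 1"
proof -
  have f: "\<bar>fst \<xi>\<bar> \<le> 1" using \<xi> by (auto simp: parabola_nbhd_def)
  obtain k where k: "k < cap_count \<delta>" "fst \<xi> \<in> cap_interval \<delta> k" using cap_interval_cover[OF \<delta> f] .
  have "indicator (small_cap \<delta> \<beta> l) \<xi> = (if l = k then 1 else 0 :: complex)" for l
  proof -
    have "\<xi> \<in> small_cap \<delta> \<beta> l \<longleftrightarrow> fst \<xi> \<in> cap_interval \<delta> l"
      using \<xi> by (cases \<xi>) (simp add: small_cap_def)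
    also have "\<dots> \<longleftrightarrow> l = k"
      using cap_interval_unique[OF \<delta> k(2)] k(2) by blast
    finally show ?thesis by (simp add: indicator_def)
  qed
  then show ?thesis using k by simp
qed

lemma cap_multiplier_on_small_cap:
  assumes \<delta>: "0 < \<delta>" "\<delta> \<le> 1 / 4" and \<beta>: "0 \<le> \<beta>" "\<beta> \<le> 1" and k: "k < cap_count \<delta>" and \<xi>: "\<xi> \<in> small_cap \<delta> \<beta> k"
  shows "cap_multiplier \<delta> (\<delta> powr \<beta>) k \<xi> = 1"
proof -
  obtain \<xi>1 \<xi>2 where x: "\<xi> = (\<xi>1, \<xi>2)" by (cases \<xi>)
  have n: "\<bar>\<xi>1\<bar> \<le> 1" "\<bar>\<xi>2 - \<xi>1\<^sup>2\<bar> \<le> \<delta> powr \<beta>" "\<xi>1 \<in> cap_interval \<delta> k"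
    using \<xi> by (auto simp: x small_cap_def parabola_nbhd_def)
  have w: "\<delta> \<le> \<delta> powr \<beta>" using powr_mono'[of \<beta> 1 \<delta>] \<beta> \<delta> by simp
  let ?c = "cap_center \<delta> k"
  have d: "\<bar>\<xi>1 - ?c\<bar> \<le> \<delta> / 2" by (rule cap_interval_center[OF n(3)])
  have "\<bar>\<xi>1\<^sup>2 - ?c\<^sup>2\<bar> = \<bar>\<xi>1 - ?c\<bar> * \<bar>\<xi>1 + ?c\<bar>" by (simp add: power2_eq_square abs_mult[symmetric]
      algebra_simps)
  also have "\<dots> \<le> (\<delta> / 2) * 4"
    using d n(1) cap_center_bound[OF \<delta>(1) k] \<delta> by (intro mult_mono) linarith+
  finally have "\<bar>\<xi>1\<^sup>2 - ?c\<^sup>2\<bar> \<le> 2 * \<delta>" by simp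
  then have "\<bar>\<xi>2 - ?c\<^sup>2\<bar> \<le> 3 * \<delta> powr \<beta>" using n(2) w by linarith
  then show ?thesis using d \<delta> by (intro cap_multiplier_eq_1) (auto simp: x)
qed

lemma integrable_of_bounded_support:
  assumes F: "temperate_fun F" and R: "\<And>\<xi>. R < norm \<xi> \<Longrightarrow> F \<xi> = 0"
  shows "integrable lborel F"
proof -
  obtain n where [measurable]: "F \<in> borel_measurable borel"
      and n: "integrable lborel (\<lambda>x. F x /\<^sub>R (1 + norm x) ^ n)"
    using F unfolding temperate_fun_def by blast
  show ?thesis
  proof (rule Bochner_Integration.integrable_bound)
    show "integrable lborel (\<lambda>x. (1 + \<bar>R\<bar>) ^ n *\<^sub>R (F x /\<^sub>R (1 + norm x) ^ n))"
      using n by (rule integrable_scaleR_right)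
    show "AE x in lborel. norm (F x) \<le> norm ((1 + \<bar>R\<bar>) ^ n *\<^sub>R (F x /\<^sub>R (1 + norm x) ^ n))"
    proof (intro always_eventually allI)
      fix x
      show "norm (F x) \<le> norm ((1 + \<bar>R\<bar>) ^ n *\<^sub>R (F x /\<^sub>R (1 + norm x) ^ n))"
      proof (cases "norm x \<le> R")
        case True
        then have "(1 + norm x) ^ n \<le> (1 + \<bar>R\<bar>) ^ n" by (intro power_mono) auto
        moreover have pos: "0 < (1 + norm x) ^ n" by (intro zero_less_power) (simp add: add_pos_nonneg)
        ultimately have "1 \<le> (1 + \<bar>R\<bar>) ^ n / (1 + norm x) ^ n" by (simp add: le_divide_eq)
        then have "1 * norm (F x) \<le> (1 + \<bar>R\<bar>) ^ n / (1 + norm x) ^ n * norm (F x)"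
          by (rule mult_right_mono) simp
        moreover have "norm ((1 + \<bar>R\<bar>) ^ n *\<^sub>R (F x /\<^sub>R (1 + norm x) ^ n)) = (1 + \<bar>R\<bar>) ^ n / (1 + norm x) ^ n
            * norm (F x)"
          using pos by (simp add: divide_inverse abs_inverse)
        ultimately show ?thesis by linarith
      qed (use R in simp)
    qed
  qed measurable
qed

lemma norm_le_on_parabola_nbhd:
  assumes "\<xi> \<in> parabola_nbhd r" "r \<le> 1" shows "norm \<xi> \<le> 3"
proof -
  obtain a b where x: "\<xi> = (a, b)" by (cases \<xi>)
  have a: "\<bar>a\<bar> \<le> 1" "\<bar>b - a\<^sup>2\<bar> \<le> r" using assms by (auto simp: x parabola_nbhd_def)
  then have "a\<^sup>2 \<le> 1" by (simp add: abs_square_le_1)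
  then have "\<bar>b\<bar> \<le> 2" using a assms(2) zero_le_power2[of a] by linarith
  then show ?thesis using norm_Pair_le[of a b] a by (simp add: x)
qed

text \<open>A function with compact Fourier support need not be a test function, but its restrictions to
balls are.\<close>

lemma truncation_tendsto:
  assumes K: "integrable lborel K" and [measurable]: "f \<in> borel_measurable borel" and M: "\<And>x. norm (f x) \<le> M"
  shows "(\<lambda>n. convol K (\<lambda>y. if norm y \<le> real n then f y else 0) x) \<longlonglongrightarrow> convol K f x"
  unfolding convol_def
proof (rule integral_dominated_convergence[where w="\<lambda>y. norm (K (x - y)) * M"])
  have [measurable]: "K \<in> borel_measurable borel" using K by auto
  show "integrable lborel (\<lambda>y. norm (K (x - y)) * M)"
    using integrable_norm[OF integrable_plane_reflect[OF K]] by (rule integrable_mult_left)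
  show "(\<lambda>y. K (x - y) * f y) \<in> borel_measurable lborel"
    "\<And>n. (\<lambda>y. K (x - y) * (if norm y \<le> real n then f y else 0)) \<in> borel_measurable lborel" by measurable
  show "AE y in lborel. (\<lambda>n. K (x - y) * (if norm y \<le> real n then f y else 0)) \<longlonglongrightarrow> K (x - y) * f y"
  proof (intro always_eventually allI tendsto_mult tendsto_const)
    fix y :: plane
    obtain N where "norm y \<le> real N" using real_arch_simple by blast
    then show "(\<lambda>n. if norm y \<le> real n then f y else 0) \<longlonglongrightarrow> f y"
      by (intro tendsto_eventually eventually_sequentiallyI[of N]) auto
  qed
  have M0: "0 \<le> M" using M[of undefined] norm_ge_zero order_trans by blast
  show "AE y in lborel. norm (K (x - y) * (if norm y \<le> real n then f y else 0)) \<le> norm (K (x - y)) * M" for n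
    using M M0 by (intro always_eventually allI) (auto simp: norm_mult intro!: mult_left_mono)
qed

text \<open>With \<open>f\<^sub>\<gamma>\<close> in place of \<open>g\<^sub>\<gamma>\<close> the operator returns \<open>f\<close>, since each kernel reproduces the part of \<open>f\<close>
over its cap. The bound is applied to the restrictions of \<open>f\<^sub>\<gamma>\<close> to balls, and Fatou's lemma passes to
the limit.\<close>

lemma decoupling_of_strong_bound:
  assumes \<delta>: "0 < \<delta>" "\<delta> \<le> 1 / 4" and \<beta>: "0 \<le> \<beta>" "\<beta> \<le> 1" and p: "p > 0"
    and sb: "strong_bound (cap_kernel \<delta> (\<delta> powr \<beta>)) {..<cap_count \<delta>} p M"
    and fF: "has_fourier_transform f F" and supp: "\<And>\<xi>. \<xi> \<notin> parabola_nbhd (\<delta> powr \<beta>) \<Longrightarrow> F \<xi> = 0"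
  shows "Lp_power p f
    \<le> ennreal M * (\<Sum>\<gamma>\<in>small_caps \<delta> \<beta>. Lp_power p (cap_part F \<gamma>))"
proof -
  let ?w = "\<delta> powr \<beta>" and ?I = "{..<cap_count \<delta>}"
  let ?K = "cap_kernel \<delta> ?w"
  have w: "0 < ?w" "?w \<le> 1" using \<delta> \<beta> by (auto simp: powr_le1)
  have F: "integrable lborel F"
  proof (rule integrable_of_bounded_support[where R=3])
    show "temperate_fun F" using fF by (simp add: has_fourier_transform_def)
    show "F \<xi> = 0" if "3 < norm \<xi>" for \<xi>
      using norm_le_on_parabola_nbhd[OF _ w(2), of \<xi>] supp[of \<xi>] that by fastforce
  qed
  let ?F = "\<lambda>k \<xi>. indicator (small_cap \<delta> \<beta> k) \<xi> * F \<xi>"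
  define f' where "f' k = inv_fourier (?F k)" for k
  have [measurable]: "F \<in> borel_measurable borel" using F by auto
  have Fk: "integrable lborel (?F k)" for k
    by (rule Bochner_Integration.integrable_bound[OF F]) (auto simp: norm_mult indicator_def)
  have K: "integrable lborel (?K k)" for k by (rule cap_kernel_integrable(1)[OF \<delta>(1) w(1)])
  have fm [measurable]: "f' k \<in> borel_measurable borel" for k unfolding f'_def
      by (rule inv_fourier_measurable[OF Fk])
  have fb: "norm (f' k x) \<le> (LINT \<xi>|lborel. norm (?F k \<xi>))" for k x unfolding f'_def
      by (rule norm_inv_fourier_le[OF Fk])
  have rep: "convol (?K k) (f' k) = f' k" if "k \<in> ?I" for k
    unfolding f'_def
  proof (rule convol_reproduces_inv_fourier[OF K Fk])
    fix \<xi> assume "?F k \<xi> \<noteq> 0"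
    then have "\<xi> \<in> small_cap \<delta> \<beta> k" by (auto simp: indicator_def split: if_splits)
    then show "fourier (?K k) \<xi> = 1"
      using cap_multiplier_on_small_cap[OF \<delta> \<beta>, of k \<xi>] that fourier_cap_kernel[OF \<delta>(1) w(1)] by simp
  qed
  have decomp: "inv_fourier F x = (\<Sum>k\<in>?I. f' k x)" for x
  proof -
    have "F \<xi> * cis (2 * pi * (x \<bullet> \<xi>)) = (\<Sum>k\<in>?I. ?F k \<xi> * cis (2 * pi * (x \<bullet> \<xi>)))" for \<xi>
    proof (cases "\<xi> \<in> parabola_nbhd ?w")
      case True
      then show ?thesis using sum_indicator_small_caps[OF \<delta>(1) True]
        by (simp only: sum_distrib_right[symmetric] mult_1)
    qed (simp add: supp)
    then have "inv_fourier F x = (LINT \<xi>|lborel. (\<Sum>k\<in>?I. ?F k \<xi> * cis (2 * pi * (x \<bullet> \<xi>))))"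
      by (simp only: inv_fourier_def)
    also have "\<dots> = (\<Sum>k\<in>?I. f' k x)"
      unfolding f'_def inv_fourier_def
      by (rule Bochner_Integration.integral_sum) (rule integrable_mult_cis[OF Fk], measurable)
    finally show ?thesis .
  qed
  let ?g = "\<lambda>n k y. if norm y \<le> real n then f' k y else 0"
  have g: "test_function (?g n k)" for n k
    unfolding test_function_def
  proof (intro conjI exI allI impI)
    show "?g n k \<in> borel_measurable borel" by measurable
    show "norm (?g n k x) \<le> (LINT \<xi>|lborel. norm (?F k \<xi>))" for x using fb by auto
    show "?g n k x = 0" if "norm x > real n" for x using that by simp
  qed
  let ?u = "\<lambda>n x. ennreal (norm (multi_convol ?K ?I (?g n) x) powr p)"
  let ?B = "ennreal M * (\<Sum>k\<in>?I. Lp_power p (f' k))"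
  have lim: "(\<lambda>n. ?u n x) \<longlonglongrightarrow> ennreal (norm (inv_fourier F x) powr p)" for x
  proof (intro tendsto_ennrealI tendsto_powr' tendsto_norm tendsto_const)
    show "(\<lambda>n. multi_convol ?K ?I (?g n) x) \<longlonglongrightarrow> inv_fourier F x"
      unfolding decomp multi_convol_def
    proof (rule tendsto_sum)
      fix k assume k: "k \<in> ?I"
      show "(\<lambda>n. convol (?K k) (?g n k) x) \<longlonglongrightarrow> f' k x"
        using truncation_tendsto[OF K fm fb, of k k x] unfolding rep[OF k] .
    qed
  qed (use p in auto)
  have um: "?u n \<in> borel_measurable lborel" for n
  proof -
    have "multi_convol ?K ?I (?g n) \<in> borel_measurable borel"
      unfolding multi_convol_def[abs_def]
      by (intro borel_measurable_sum convol_measurable K test_function_measurable g)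
    then show ?thesis by measurable
  qed
  have "Lp_power p f = Lp_power p (inv_fourier F)"
    by (rule nn_integral_cong_AE) (use has_fourier_transform_imp_inv_fourier[OF fF F] in eventually_elim,
        simp)
  also have "\<dots> = (\<integral>\<^sup>+ x. liminf (\<lambda>n. ?u n x) \<partial>lborel)"
    by (intro nn_integral_cong) (rule lim_imp_Liminf[OF _ lim, symmetric], simp)
  also have "\<dots> \<le> liminf (\<lambda>n. \<integral>\<^sup>+ x. ?u n x \<partial>lborel)"
    by (rule nn_integral_liminf) (rule um)
  also have "\<dots> \<le> liminf (\<lambda>n. ?B)"
  proof (rule Liminf_mono, intro always_eventually allI)
    fix n
    have "(\<integral>\<^sup>+ x. ?u n x \<partial>lborel) \<le> ennreal M * (\<Sum>k\<in>?I. Lp_power p (?g n k))"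
      using sb[unfolded strong_bound_def, rule_format, of "?g n"] g by blast
    also have "\<dots> \<le> ?B"
      by (intro mult_left_mono sum_mono nn_integral_mono ennreal_leI) auto
    finally show "(\<integral>\<^sup>+ x. ?u n x \<partial>lborel) \<le> ?B" .
  qed
  also have "liminf (\<lambda>n. ?B) = ?B" by (rule Liminf_const) simp
  also have "(\<Sum>k\<in>?I. Lp_power p (f' k))
      = (\<Sum>\<gamma>\<in>small_caps \<delta> \<beta>. Lp_power p (cap_part F \<gamma>))"
    unfolding small_caps_eq by (simp add: sum.reindex[OF inj_small_cap[OF \<delta>(1)]] cap_part_def f'_def)
  finally show ?thesis .
qed

section \<open>The upper bound\<close>

lemma strong_bound_mono:
  assumes "strong_bound K I q B" "B \<le> B'" shows "strong_bound K I q B'"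
  unfolding strong_bound_def
proof (intro allI impI)
  fix g assume "\<forall>k\<in>I. test_function (g k)"
  then have "Lp_power q (multi_convol K I g)
      \<le> ennreal B * (\<Sum>k\<in>I. Lp_power q (g k))"
    using assms(1) by (simp add: strong_bound_def)
  also have "\<dots> \<le> ennreal B' * (\<Sum>k\<in>I. Lp_power q (g k))"
    by (intro mult_right_mono ennreal_leI assms(2)) simp
  finally show "Lp_power q (multi_convol K I g)
      \<le> ennreal B' * (\<Sum>k\<in>I. Lp_power q (g k))" .
qed

text \<open>Up to a constant, the bound for the number of interacting quadruples through a given cap.\<close>

definition quad_size :: "real \<Rightarrow> real \<Rightarrow> real" where
  "quad_size \<delta> \<beta> = \<delta> powr (\<beta> - 2) * \<bar>ln \<delta>\<bar>"

lemma abs_ln_ge_1: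
  assumes "0 < \<delta>" "\<delta> \<le> (1 / 4 :: real)" shows "1 \<le> \<bar>ln \<delta>\<bar>"
proof -
  have "3 \<le> 1 / \<delta>" using assms by (simp add: field_simps)
  then have "exp 1 \<le> 1 / \<delta>" using exp_le by linarith
  then have "1 \<le> ln (1 / \<delta>)" using assms by (subst ln_ge_iff) auto
  then show ?thesis using assms by (simp add: ln_div)
qed

lemma cap_endpoint_bounds:
  assumes \<delta>: "0 < \<delta>" "\<delta> \<le> 1 / 4" and \<beta>: "0 \<le> \<beta>" "\<beta> \<le> 1"
  shows "strong_bound (cap_kernel \<delta> (\<delta> powr \<beta>)) {..<cap_count \<delta>} 2 (5 * (young_const + 1) ^ 2)"
    and "strong_bound (cap_kernel \<delta> (\<delta> powr \<beta>)) {..<cap_count \<delta>} 4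
        (2500 * (young_const + 1) ^ 4 * quad_size \<delta> \<beta>)"
proof -
  have w: "0 < \<delta> powr \<beta>" "\<delta> \<le> \<delta> powr \<beta>" using powr_mono'[of \<beta> 1 \<delta>] \<beta> \<delta> by auto
  have pm: "young_const ^ n \<le> (young_const + 1) ^ n" for n
    using young_const_nonneg by (intro power_mono) auto
  show "strong_bound (cap_kernel \<delta> (\<delta> powr \<beta>)) {..<cap_count \<delta>} 2 (5 * (young_const + 1) ^ 2)"
    by (rule strong_bound_mono[OF cap_strong_bound_2[OF \<delta>(1) w(1)]]) (simp add: pm)
  have "\<delta> powr \<beta> / \<delta>\<^sup>2 = \<delta> powr (\<beta> - 2)" using \<delta> by (simp add: powr_diff)
  then have "2500 * (\<delta> powr \<beta> / \<delta>\<^sup>2 * \<bar>ln \<delta>\<bar>) * young_const ^ 4 = 2500 * quad_size \<delta> \<beta> * young_const ^ 4"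
    by (simp add: quad_size_def)
  also have "\<dots> \<le> 2500 * quad_size \<delta> \<beta> * (young_const + 1) ^ 4"
    by (intro mult_left_mono pm) (simp add: quad_size_def)
  finally show "strong_bound (cap_kernel \<delta> (\<delta> powr \<beta>)) {..<cap_count \<delta>} 4
      (2500 * (young_const + 1) ^ 4 * quad_size \<delta> \<beta>)"
    by (intro strong_bound_mono[OF cap_strong_bound_4[OF \<delta> w(2)]]) (simp add: mult_ac)
qed

lemma quad_size_pos: "0 < \<delta> \<Longrightarrow> \<delta> \<le> 1 / 4 \<Longrightarrow> 0 < quad_size \<delta> \<beta>"
  using abs_ln_ge_1[of \<delta>] unfolding quad_size_def by (intro mult_pos_pos) auto

text \<open>With \<open>A = quad_size \<delta> \<beta>\<close>, the choice \<open>\<alpha> = A powr (- 1/2)\<close> balances the contributions \<open>\<alpha> powr (2 - p)\<close>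
of the exponent 2 and \<open>A * \<alpha> powr (4 - p)\<close> of the exponent 4.\<close>

lemma strong_bound_2_4:
  assumes p: "2 \<le> p" "p \<le> 4"
  shows "\<exists>C>0. \<forall>\<beta> \<delta>. 0 \<le> \<beta> \<and> \<beta> \<le> 1 \<and> 0 < \<delta> \<and> \<delta> \<le> 1 / 4 \<longrightarrow>
    strong_bound (cap_kernel \<delta> (\<delta> powr \<beta>)) {..<cap_count \<delta>} p (C * quad_size \<delta> \<beta> powr ((p - 2) / 2))"
proof -
  define D where "D = young_const + 1"
  have D: "D > 0" using young_const_nonneg by (simp add: D_def)
  consider "p = 2" | "p = 4" | "2 < p" "p < 4" using p by linarith
  then show ?thesis
  proof cases
    case 1
    have "strong_bound (cap_kernel \<delta> (\<delta> powr \<beta>)) {..<cap_count \<delta>} p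
        (5 * D ^ 2 * quad_size \<delta> \<beta> powr ((p - 2) / 2))"
      if "0 \<le> \<beta> \<and> \<beta> \<le> 1 \<and> 0 < \<delta> \<and> \<delta> \<le> 1 / 4" for \<beta> \<delta>
      using cap_endpoint_bounds(1)[of \<delta> \<beta>] quad_size_pos[of \<delta> \<beta>] that 1 by (simp add: D_def)
    then show ?thesis using D by (intro exI[of _ "5 * D ^ 2"]) auto
  next
    case 2
    have "strong_bound (cap_kernel \<delta> (\<delta> powr \<beta>)) {..<cap_count \<delta>} p
        (2500 * D ^ 4 * quad_size \<delta> \<beta> powr ((p - 2) / 2))"
      if "0 \<le> \<beta> \<and> \<beta> \<le> 1 \<and> 0 < \<delta> \<and> \<delta> \<le> 1 / 4" for \<beta> \<delta>
      using cap_endpoint_bounds(2)[of \<delta> \<beta>] quad_size_pos[of \<delta> \<beta>] that 2 by (simp add: D_def)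
    then show ?thesis using D by (intro exI[of _ "2500 * D ^ 4"]) auto
  next
    case 3
    define C where "C = p * (2 powr 2 * (5 * D ^ 2) * (1 / (p - 2)) + 2 powr 4 * (2500 * D ^ 4)
        * (1 / (4 - p)))"
    have "C > 0" using D 3 unfolding C_def by (intro mult_pos_pos add_pos_pos) auto
    moreover have "strong_bound (cap_kernel \<delta> (\<delta> powr \<beta>)) {..<cap_count \<delta>} p
        (C * quad_size \<delta> \<beta> powr ((p - 2) / 2))"
      if h: "0 \<le> \<beta> \<and> \<beta> \<le> 1 \<and> 0 < \<delta> \<and> \<delta> \<le> 1 / 4" for \<beta> \<delta>
    proof -
      let ?A = "quad_size \<delta> \<beta>"
      have A: "0 < ?A" using quad_size_pos h by blast
      define \<alpha> where "\<alpha> = ?A powr (- (1 / 2))"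
      have \<alpha>: "\<alpha> > 0" using A by (simp add: \<alpha>_def)
      have K: "integrable lborel (cap_kernel \<delta> (\<delta> powr \<beta>) k)" for k
        using cap_kernel_integrable(1)[of \<delta> "\<delta> powr \<beta>"] h by auto
      have e1: "\<alpha> powr (2 - p) = ?A powr ((p - 2) / 2)"
      proof -
        have "- (1 / 2) * (2 - p) = (p - 2) / 2" by (simp add: field_simps)
        then show ?thesis by (simp only: \<alpha>_def powr_powr)
      qed
      have "?A powr 1 * ?A powr ((p - 4) / 2) = ?A powr ((p - 2) / 2)"
        unfolding powr_add[symmetric] by (simp add: field_simps)
      moreover have "\<alpha> powr (4 - p) = ?A powr ((p - 4) / 2)"
      proof -
        have "- (1 / 2) * (4 - p) = (p - 4) / 2" by (simp add: field_simps)
        then show ?thesis by (simp only: \<alpha>_def powr_powr)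
      qed
      ultimately have e2: "?A * \<alpha> powr (4 - p) = ?A powr ((p - 2) / 2)" using A by simp
      have "strong_bound (cap_kernel \<delta> (\<delta> powr \<beta>)) {..<cap_count \<delta>} p
        (p * (2 powr 2 * (5 * D ^ 2) * (\<alpha> powr (2 - p) / (p - 2)) + 2 powr 4 * (2500 * D ^ 4 * ?A)
            * (\<alpha> powr (4 - p) / (4 - p))))"
        by (rule marcinkiewicz[OF _ K cap_endpoint_bounds(1)[folded D_def] _
            cap_endpoint_bounds(2)[folded D_def]])
          (use h 3 D A \<alpha> in auto)
      also have "p * (2 powr 2 * (5 * D ^ 2) * (\<alpha> powr (2 - p) / (p - 2)) + 2 powr 4 * (2500 * D ^ 4 * ?A)
          * (\<alpha> powr (4 - p) / (4 - p)))
          = p * (2 powr 2 * (5 * D ^ 2) * (\<alpha> powr (2 - p) / (p - 2)) + 2 powr 4 * (2500 * D ^ 4)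
              * ((?A * \<alpha> powr (4 - p)) / (4 - p)))"
        by (simp only: mult.assoc times_divide_eq_right)
      also have "\<dots> = C * ?A powr ((p - 2) / 2)"
        unfolding e1 e2 C_def by (simp add: algebra_simps)
      finally show ?thesis .
    qed
    ultimately show ?thesis by blast
  qed
qed

lemma strong_bound_gt_4:
  assumes p: "4 < p"
  shows "\<exists>C>0. \<forall>\<beta> \<delta>. 0 \<le> \<beta> \<and> \<beta> \<le> 1 \<and> 0 < \<delta> \<and> \<delta> \<le> 1 / 4 \<longrightarrow>
    strong_bound (cap_kernel \<delta> (\<delta> powr \<beta>)) {..<cap_count \<delta>} p (C * (quad_size \<delta> \<beta> * \<delta> powr (4 - p)))"
proof -
  define D where "D = young_const + 1"
  have D: "D > 0" using young_const_nonneg by (simp add: D_def)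
  define C where "C = p * (2 powr 4 * (2500 * D ^ 4) * ((6 * D) powr (p - 4) / (p - 4)))"
  have "C > 0" using D p unfolding C_def by (intro mult_pos_pos divide_pos_pos) auto
  moreover have "strong_bound (cap_kernel \<delta> (\<delta> powr \<beta>)) {..<cap_count \<delta>} p
      (C * (quad_size \<delta> \<beta> * \<delta> powr (4 - p)))"
    if h: "0 \<le> \<beta> \<and> \<beta> \<le> 1 \<and> 0 < \<delta> \<and> \<delta> \<le> 1 / 4" for \<beta> \<delta>
  proof -
    let ?A = "quad_size \<delta> \<beta>" and ?I = "{..<cap_count \<delta>}"
    have A: "0 < ?A" using quad_size_pos h by blast
    have w: "0 < \<delta> powr \<beta>" using h by simp
    have N: "0 < 3 / \<delta> * D" using h D by simp
    have K: "integrable lborel (cap_kernel \<delta> (\<delta> powr \<beta>) k)" for k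
      using cap_kernel_integrable(1)[of \<delta> "\<delta> powr \<beta>"] h by auto
    have sup: "norm (multi_convol (cap_kernel \<delta> (\<delta> powr \<beta>)) ?I g x) \<le> (3 / \<delta> * D) * s"
      if g: "\<And>k. k \<in> ?I \<Longrightarrow> test_function (g k)" and s: "\<And>k y. k \<in> ?I \<Longrightarrow> norm (g k y) \<le> s" for g s x
    proof -
      have "0 < 2 / \<delta>" using h by simp
      then have "0 < cap_count \<delta>" unfolding cap_count_def by simp
      then have s0: "0 \<le> s" using order_trans[OF norm_ge_zero s[of 0 undefined]] by simp
      have "norm (multi_convol (cap_kernel \<delta> (\<delta> powr \<beta>)) ?I g x) \<le> real (cap_count \<delta>) * young_const * s"
        by (rule cap_sup_bound[OF _ w g s]) (use h in auto)
      also have "\<dots> \<le> (3 / \<delta> * D) * s"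
        using cap_count_bounds(3)[of \<delta>] h young_const_nonneg s0
        by (intro mult_right_mono mult_mono) (auto simp: D_def)
      finally show ?thesis .
    qed
    have "strong_bound (cap_kernel \<delta> (\<delta> powr \<beta>)) ?I p
      (p * (2 powr 4 * (2500 * D ^ 4 * ?A) * ((2 * (3 / \<delta> * D)) powr (p - 4) / (p - 4))))"
      by (rule marcinkiewicz_infinity[OF _ K cap_endpoint_bounds(2)[folded D_def] _ sup N])
        (use h p D A in auto)
    also have "(2 * (3 / \<delta> * D)) powr (p - 4) = (6 * D) powr (p - 4) * \<delta> powr (4 - p)"
    proof -
      have "(2 * (3 / \<delta> * D)) powr (p - 4) = ((6 * D) / \<delta>) powr (p - 4)" by simp
      also have "\<dots> = (6 * D) powr (p - 4) / \<delta> powr (p - 4)" using D h by (simp add: powr_divide)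
      also have "\<dots> = (6 * D) powr (p - 4) * \<delta> powr (4 - p)"
        using powr_minus_divide[of \<delta> "p - 4"] by simp
      finally show ?thesis .
    qed
    also have "p * (2 powr 4 * (2500 * D ^ 4 * ?A) * ((6 * D) powr (p - 4) * \<delta> powr (4 - p) / (p - 4))) = C
        * (?A * \<delta> powr (4 - p))"
      unfolding C_def by (simp add: mult_ac)
    finally show ?thesis .
  qed
  ultimately show ?thesis by blast
qed

theorem decoupling_const_upper:
  assumes p: "2 \<le> p"
  shows "\<exists>C>0. \<forall>\<beta> \<delta>. 0 \<le> \<beta> \<and> \<beta> \<le> 1 \<and> 0 < \<delta> \<and> \<delta> \<le> 1 / 4 \<longrightarrow>
    decoupling_const p \<delta> \<beta> \<le> ennreal (C * \<bar>ln \<delta>\<bar> powr 1 *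
      (\<delta> powr (- (2 - \<beta>) * (1/2 - 1/p)) + \<delta> powr (- (1 - (2 + \<beta>) / p))))"
proof -
  have dc: "decoupling_const p \<delta> \<beta> \<le> ennreal (M powr (1 / p))"
    if h: "0 \<le> \<beta> \<and> \<beta> \<le> 1 \<and> 0 < \<delta> \<and> \<delta> \<le> 1 / 4" and M: "M > 0"
      and sb: "strong_bound (cap_kernel \<delta> (\<delta> powr \<beta>)) {..<cap_count \<delta>} p M" for \<beta> \<delta> M
  proof (rule decoupling_const_le[OF _ M])
    fix f F assume "has_fourier_transform f F" and "\<And>\<xi>. \<xi> \<notin> parabola_nbhd (\<delta> powr \<beta>) \<Longrightarrow> F \<xi> = 0"
    then show "Lp_power p f
        \<le> ennreal M * (\<Sum>\<gamma>\<in>small_caps \<delta> \<beta>. Lp_power p (cap_part F \<gamma>))"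
      using decoupling_of_strong_bound[OF _ _ _ _ _ sb, of f F] h p by auto
  qed (use p in simp)
  have Lp: "\<bar>ln \<delta>\<bar> powr a \<le> \<bar>ln \<delta>\<bar> powr 1" if "0 < \<delta> \<and> \<delta> \<le> 1 / 4" "a \<le> 1" for \<delta> a :: real
    using abs_ln_ge_1[of \<delta>] that by (intro powr_mono) auto
  show ?thesis
  proof (cases "p \<le> 4")
    case True
    obtain C where C: "C > 0" and sb: "\<And>\<beta> \<delta>. 0 \<le> \<beta> \<and> \<beta> \<le> 1 \<and> 0 < \<delta> \<and> \<delta> \<le> 1 / 4 \<Longrightarrow>
        strong_bound (cap_kernel \<delta> (\<delta> powr \<beta>)) {..<cap_count \<delta>} p (C * quad_size \<delta> \<beta> powr ((p - 2) / 2))"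
      using strong_bound_2_4[OF p True] by blast
    have "decoupling_const p \<delta> \<beta> \<le> ennreal (C powr (1 / p) * \<bar>ln \<delta>\<bar> powr 1 *
      (\<delta> powr (- (2 - \<beta>) * (1/2 - 1/p)) + \<delta> powr (- (1 - (2 + \<beta>) / p))))"
      if h: "0 \<le> \<beta> \<and> \<beta> \<le> 1 \<and> 0 < \<delta> \<and> \<delta> \<le> 1 / 4" for \<beta> \<delta>
    proof -
      let ?A = "quad_size \<delta> \<beta>" and ?e = "1/2 - 1/p"
      have A: "0 < ?A" using quad_size_pos h by blast
      have e: "0 \<le> ?e" "?e \<le> 1" using p by (auto simp: field_simps)
      have "(C * ?A powr ((p - 2) / 2)) powr (1 / p) = C powr (1 / p) * ?A powr ?e"
      proof -
        have "(p - 2) / 2 * (1 / p) = ?e" using p by (simp add: field_simps)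
        then show ?thesis using C by (simp only: powr_mult powr_powr)
      qed
      also have "?A powr ?e = \<delta> powr (- (2 - \<beta>) * ?e) * \<bar>ln \<delta>\<bar> powr ?e"
      proof -
        have "(\<beta> - 2) * ?e = - (2 - \<beta>) * ?e" by (simp add: algebra_simps)
        then show ?thesis by (simp only: quad_size_def powr_mult powr_powr)
      qed
      also have "C powr (1 / p) * (\<delta> powr (- (2 - \<beta>) * ?e) * \<bar>ln \<delta>\<bar> powr ?e)
          \<le> C powr (1 / p) * ((\<delta> powr (- (2 - \<beta>) * ?e) + \<delta> powr (- (1 - (2 + \<beta>) / p))) * \<bar>ln \<delta>\<bar> powr 1)"
        using h Lp[of \<delta> ?e] e by (intro mult_left_mono mult_mono) auto
      finally have "(C * ?A powr ((p - 2) / 2)) powr (1 / p)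
          \<le> C powr (1 / p) * \<bar>ln \<delta>\<bar> powr 1 * (\<delta> powr (- (2 - \<beta>) * ?e) + \<delta> powr (- (1 - (2 + \<beta>) / p)))"
        by (simp only: mult_ac)
      then show ?thesis
        using order_trans[OF dc[OF h _ sb[OF h]] ennreal_leI] C A by simp
    qed
    then show ?thesis using C by (intro exI[of _ "C powr (1 / p)"]) auto
  next
    case False
    then have p4: "4 < p" by simp
    obtain C where C: "C > 0" and sb: "\<And>\<beta> \<delta>. 0 \<le> \<beta> \<and> \<beta> \<le> 1 \<and> 0 < \<delta> \<and> \<delta> \<le> 1 / 4 \<Longrightarrow>
        strong_bound (cap_kernel \<delta> (\<delta> powr \<beta>)) {..<cap_count \<delta>} p (C * (quad_size \<delta> \<beta> * \<delta> powr (4 - p)))"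
      using strong_bound_gt_4[OF p4] by blast
    have "decoupling_const p \<delta> \<beta> \<le> ennreal (C powr (1 / p) * \<bar>ln \<delta>\<bar> powr 1 *
      (\<delta> powr (- (2 - \<beta>) * (1/2 - 1/p)) + \<delta> powr (- (1 - (2 + \<beta>) / p))))"
      if h: "0 \<le> \<beta> \<and> \<beta> \<le> 1 \<and> 0 < \<delta> \<and> \<delta> \<le> 1 / 4" for \<beta> \<delta>
    proof -
      let ?A = "quad_size \<delta> \<beta>" and ?e = "- (1 - (2 + \<beta>) / p)"
      have A: "0 < ?A" using quad_size_pos h by blast
      have "?A * \<delta> powr (4 - p) = \<delta> powr (2 + \<beta> - p) * \<bar>ln \<delta>\<bar>"
      proof -
        have "\<delta> powr (\<beta> - 2) * \<delta> powr (4 - p) = \<delta> powr (2 + \<beta> - p)"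
          unfolding powr_add[symmetric] by (simp add: algebra_simps)
        then show ?thesis by (simp add: quad_size_def mult_ac)
      qed
      then have "(C * (?A * \<delta> powr (4 - p))) powr (1 / p) = C powr (1 / p)
          * (\<delta> powr (2 + \<beta> - p) * \<bar>ln \<delta>\<bar>) powr (1 / p)"
        using C by (simp only: powr_mult)
      also have "(\<delta> powr (2 + \<beta> - p) * \<bar>ln \<delta>\<bar>) powr (1 / p) = \<delta> powr ?e * \<bar>ln \<delta>\<bar> powr (1 / p)"
      proof -
        have "(2 + \<beta> - p) * (1 / p) = ?e" using p by (simp add: field_simps)
        then show ?thesis by (simp only: powr_mult powr_powr)
      qed
      also have "C powr (1 / p) * (\<delta> powr ?e * \<bar>ln \<delta>\<bar> powr (1 / p))
          \<le> C powr (1 / p) * ((\<delta> powr (- (2 - \<beta>) * (1/2 - 1/p)) + \<delta> powr ?e) * \<bar>ln \<delta>\<bar> powr 1)"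
        using h Lp[of \<delta> "1 / p"] p by (intro mult_left_mono mult_mono) auto
      finally have "(C * (?A * \<delta> powr (4 - p))) powr (1 / p)
          \<le> C powr (1 / p) * \<bar>ln \<delta>\<bar> powr 1 * (\<delta> powr (- (2 - \<beta>) * (1/2 - 1/p)) + \<delta> powr ?e)"
        by (simp only: mult_ac)
      then show ?thesis
        using order_trans[OF dc[OF h _ sb[OF h]] ennreal_leI] C A h by simp
    qed
    then show ?thesis using C by (intro exI[of _ "C powr (1 / p)"]) auto
  qed
qed

section \<open>The lower bound\<close>

lemma schwartz_integrable:
  assumes "schwartz \<phi>" shows "integrable lborel \<phi>"
proof -
  obtain D where D: "D 0 0 = \<phi>"
    "\<And>i j x. (D i j has_derivative (\<lambda>h. fst h *\<^sub>R D (Suc i) j x + snd h *\<^sub>R D i (Suc j) x)) (at x)"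
    "\<And>i j n. bounded (range (\<lambda>x. norm x ^ n *\<^sub>R D i j x))"
    using assms unfolding schwartz_def by blast
  have "continuous_on UNIV \<phi>"
    using D(2)[of 0 0] unfolding D(1) by (intro has_derivative_continuous_on)
        (auto intro: has_derivative_at_withinI)
  then have [measurable]: "\<phi> \<in> borel_measurable borel" by (rule borel_measurable_continuous_onI)
  obtain A where A: "norm (norm x ^ 0 *\<^sub>R \<phi> x) \<le> A" for x
    using D(3)[of 0 0 0] unfolding D(1) bounded_iff by auto
  obtain B where B: "norm (norm x ^ 4 *\<^sub>R \<phi> x) \<le> B" for x
    using D(3)[of 4 0 0] unfolding D(1) bounded_iff by auto
  let ?P = "\<lambda>x::plane. complex_of_real (1 / (1 + (fst x)\<^sup>2)) * complex_of_real (1 / (1 + (snd x)\<^sup>2))"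
  have P: "integrable lborel ?P"
    using integrable_of_real[OF integrable_inverse_quadratic] by (intro integrable_product_lborel)
  show ?thesis
  proof (rule Bochner_Integration.integrable_bound)
    show "integrable lborel (\<lambda>x. complex_of_real (2 * (A + B)) * ?P x)" using P
        by (rule integrable_mult_right)
    show "AE x in lborel. norm (\<phi> x) \<le> norm (complex_of_real (2 * (A + B)) * ?P x)"
    proof (intro always_eventually allI)
      fix x :: plane
      define N where "N = norm x"
      define R where "R = (1 + (fst x)\<^sup>2) * (1 + (snd x)\<^sup>2)"
      have R: "0 < R" unfolding R_def by (intro mult_pos_pos add_pos_nonneg) auto
      have "(fst x)\<^sup>2 \<le> N\<^sup>2" "(snd x)\<^sup>2 \<le> N\<^sup>2"
        using power_mono[OF abs_coordinates_le_norm(1)[of x] abs_ge_zero, of 2]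
            power_mono[OF abs_coordinates_le_norm(2)[of x] abs_ge_zero, of 2]
        by (auto simp: N_def)
      then have "R \<le> (1 + N\<^sup>2) * (1 + N\<^sup>2)" unfolding R_def by (intro mult_mono) auto
      also have "\<dots> \<le> 2 * (1 + N ^ 4)"
        using zero_le_power2[of "N\<^sup>2 - 1"] by (simp add: power2_diff algebra_simps flip: power_mult)
      finally have "R * norm (\<phi> x) \<le> 2 * (1 + N ^ 4) * norm (\<phi> x)" by (rule mult_right_mono) simp
      also have "\<dots> = 2 * (norm (\<phi> x) + N ^ 4 * norm (\<phi> x))" by (simp add: algebra_simps)
      also have "\<dots> \<le> 2 * (A + B)" using A[of x] B[of x] by (simp add: N_def)
      finally have "norm (\<phi> x) \<le> 2 * (A + B) / R" using R by (simp add: le_divide_eq mult.commute)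
      also have "\<dots> \<le> \<bar>2 * (A + B)\<bar> / R" using R by (intro divide_right_mono) auto
      also have "\<dots> = norm (complex_of_real (2 * (A + B)) * ?P x)"
        using R unfolding of_real_mult[symmetric] norm_of_real R_def by (simp add: abs_mult)
      finally show "norm (\<phi> x) \<le> norm (complex_of_real (2 * (A + B)) * ?P x)" .
    qed
  qed measurable
qed

text \<open>For integrable functions the defining identity of the distributional transform is an
interchange of integrations.\<close>

lemma has_fourier_transform_of_integrable:
  assumes f: "integrable lborel f" and F: "integrable lborel F" and eq: "\<And>\<xi>. fourier f \<xi> = F \<xi>"
  shows "has_fourier_transform f F"
  unfolding has_fourier_transform_def
proof (intro conjI allI impI)
  show "temperate_fun f" unfolding temperate_fun_def using f by (auto intro!: exI[of _ 0])
  show "temperate_fun F" unfolding temperate_fun_def using F by (auto intro!: exI[of _ 0])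
  fix \<phi> assume "schwartz \<phi>"
  then have \<phi>: "integrable lborel \<phi>" by (rule schwartz_integrable)
  have "(LINT x|lborel. f x * fourier \<phi> x) = (LINT x|lborel. f x
      * (LINT \<xi>|lborel. \<phi> \<xi> * cis (- 2 * pi * (\<xi> \<bullet> x))))"
    by (simp only: fourier_def)
  also have "\<dots> = (LINT \<xi>|lborel. \<phi> \<xi> * (LINT x|lborel. f x * cis (- 2 * pi * (\<xi> \<bullet> x))))"
    by (rule integral_swap_bounded_kernel[where C=1]) (use f \<phi> in auto)
  also have "\<dots> = (LINT \<xi>|lborel. F \<xi> * \<phi> \<xi>)"
    unfolding eq[symmetric] fourier_def by (simp only: inner_commute mult.commute)
  finally show "(LINT x|lborel. f x * fourier \<phi> x) = (LINT \<xi>|lborel. F \<xi> * \<phi> \<xi>)" .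
qed

lemma decoupling_const_ge:
  assumes p: "p > 0" and c: "c > 0" and fF: "has_fourier_transform f F"
    and supp: "\<And>\<xi>. \<xi> \<notin> parabola_nbhd (\<delta> powr \<beta>) \<Longrightarrow> F \<xi> = 0"
    and fin: "(\<Sum>\<gamma>\<in>small_caps \<delta> \<beta>. Lp_power p (cap_part F \<gamma>)) < \<infinity>"
    and nz: "Lp_power p f \<noteq> 0"
    and le: "ennreal c * (\<Sum>\<gamma>\<in>small_caps \<delta> \<beta>. Lp_power p (cap_part F \<gamma>))
      \<le> Lp_power p f"
  shows "ennreal (c powr (1 / p)) \<le> decoupling_const p \<delta> \<beta>"
  unfolding decoupling_const_def
proof (rule Inf_greatest, safe)
  let ?V = "\<Sum>\<gamma>\<in>small_caps \<delta> \<beta>. Lp_power p (cap_part F \<gamma>)"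
  let ?U = "Lp_power p f"
  fix D assume "\<forall>f F. has_fourier_transform f F \<and> (\<forall>\<xi>. \<xi> \<notin> parabola_nbhd (\<delta> powr \<beta>) \<longrightarrow> F \<xi> = 0) \<longrightarrow>
     Lp_norm p f \<le> D * epowr (\<Sum>\<gamma>\<in>small_caps \<delta> \<beta>. epowr (Lp_norm p (cap_part F \<gamma>)) p) (1 / p)"
  then have "Lp_norm p f \<le> D * epowr (\<Sum>\<gamma>\<in>small_caps \<delta> \<beta>. epowr (Lp_norm p (cap_part F \<gamma>)) p) (1 / p)"
    using fF supp by blast
  then have D: "epowr ?U (1 / p) \<le> D * epowr ?V (1 / p)"
    using p by (simp only: epowr_Lp_norm) (simp add: Lp_norm_def)
  have pos: "epowr x (1 / p) \<noteq> 0" if "x \<noteq> 0" for x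
    using that by (cases x) (auto simp: epowr_def)
  have V0: "?V \<noteq> 0"
  proof
    assume "?V = 0"
    then have "epowr ?V (1 / p) = 0" by (simp add: epowr_def)
    then show False using D pos[OF nz] by simp
  qed
  have "ennreal (c powr (1 / p)) * epowr ?V (1 / p) = epowr (ennreal c * ?V) (1 / p)"
    using c p by (simp add: epowr_cmult)
  also have "\<dots> \<le> epowr ?U (1 / p)" using le p by (intro epowr_mono) auto
  also note D
  finally have "epowr ?V (1 / p) * ennreal (c powr (1 / p)) \<le> epowr ?V (1 / p) * D"
      by (simp only: mult.commute)
  moreover have "epowr ?V (1 / p) < \<infinity>" using fin by (auto simp: epowr_def)
  ultimately show "ennreal (c powr (1 / p)) \<le> D"
    using ennreal_mult_le_mult_iff[of "epowr ?V (1 / p)"] pos[OF V0] by (auto simp: less_top)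
qed

text \<open>Its sides are small enough for the support to stay inside the small cap.\<close>

definition tent_piece :: "real \<Rightarrow> real \<Rightarrow> nat \<Rightarrow> plane \<Rightarrow> complex" where
  "tent_piece \<delta> w k = profile_box tent (cap_center \<delta> k, (cap_center \<delta> k)\<^sup>2) (\<delta> / 8) (w / 2)"

text \<open>Since \<open>s \<le> 1\<close> in all applications, these caps stay away from the ends of the parabola, where the
last cap may be short.\<close>

definition central_caps :: "real \<Rightarrow> real \<Rightarrow> nat set" where
  "central_caps \<delta> s = {k. k < cap_count \<delta> \<and> \<bar>cap_center \<delta> k\<bar> \<le> s / 2}"

lemma tent_piece_support:
  assumes \<delta>: "0 < \<delta>" "\<delta> \<le> 1 / 4" and w: "\<delta> \<le> \<delta> powr \<beta>" and s: "s \<le> 1" and k: "k \<in> central_caps \<delta> s"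
    and nz: "tent_piece \<delta> (\<delta> powr \<beta>) k \<xi> \<noteq> 0"
  shows "\<xi> \<in> small_cap \<delta> \<beta> k"
proof -
  obtain \<xi>1 \<xi>2 where x: "\<xi> = (\<xi>1, \<xi>2)" by (cases \<xi>)
  let ?c = "cap_center \<delta> k" and ?w = "\<delta> powr \<beta>"
  have "tent ((\<xi>1 - ?c) / (\<delta> / 8)) \<noteq> 0" "tent ((\<xi>2 - ?c\<^sup>2) / (?w / 2)) \<noteq> 0"
    using nz by (auto simp: x tent_piece_def profile_box_def)
  then have "\<bar>(\<xi>1 - ?c) / (\<delta> / 8)\<bar> < 1" "\<bar>(\<xi>2 - ?c\<^sup>2) / (?w / 2)\<bar> < 1"
    using tent_bounds(3) by (meson not_le)+
  then have b: "\<bar>\<xi>1 - ?c\<bar> < \<delta> / 8" "\<bar>\<xi>2 - ?c\<^sup>2\<bar> < ?w / 2"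
    unfolding abs_divide using \<delta>(1) by (simp_all add: divide_less_eq)
  have c: "\<bar>?c\<bar> \<le> 1 / 2" using k s by (simp add: central_caps_def)
  have "?c = -1 + real k * \<delta> + \<delta> / 2" by (simp add: cap_center_def algebra_simps)
  then have "-1 + real k * \<delta> < \<xi>1" "\<xi>1 \<le> -1 + real k * \<delta> + \<delta>" using b(1) \<delta> by linarith+
  moreover have x1: "\<bar>\<xi>1\<bar> \<le> 1" using b(1) c \<delta> by linarith
  ultimately have "\<xi>1 \<in> cap_interval \<delta> k" by (auto simp: cap_interval_def algebra_simps)
  moreover have "\<bar>\<xi>2 - \<xi>1\<^sup>2\<bar> \<le> ?w"
  proof -
    have "\<bar>\<xi>1\<^sup>2 - ?c\<^sup>2\<bar> = \<bar>\<xi>1 - ?c\<bar> * \<bar>\<xi>1 + ?c\<bar>" by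
        (simp add: power2_eq_square abs_mult[symmetric] algebra_simps)
    also have "\<dots> \<le> (\<delta> / 8) * 2" using b(1) x1 c by (intro mult_mono) linarith+
    finally show ?thesis using b(2) w \<delta> by linarith
  qed
  ultimately show ?thesis using x1 by (simp add: x small_cap_def parabola_nbhd_def)
qed

lemma card_central_caps:
  assumes \<delta>: "0 < \<delta>" and s: "0 < s" "s \<le> 1" "2 * \<delta> \<le> s"
  shows "s / (2 * \<delta>) \<le> real (card (central_caps \<delta> s))"
proof -
  define A where "A = (1 - s / 2) / \<delta> - 1 / 2"
  define B where "B = (1 + s / 2) / \<delta> - 1 / 2"
  have "1 / 2 \<le> (1 - s / 2) / \<delta>" using \<delta> s by (simp add: field_simps)
  then have A0: "0 \<le> A" by (simp add: A_def)
  have BA: "B - A = s / \<delta>" using \<delta> by (simp add: A_def B_def field_simps)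
  have s2: "2 \<le> s / \<delta>" using s \<delta> by (simp add: field_simps)
  have sub: "{nat \<lceil>A\<rceil>..nat \<lfloor>B\<rfloor>} \<subseteq> central_caps \<delta> s"
  proof
    fix k assume "k \<in> {nat \<lceil>A\<rceil>..nat \<lfloor>B\<rfloor>}"
    then have "A \<le> real k" "real k \<le> B" using A0 BA s2 by (auto simp: nat_le_iff le_nat_iff) linarith+
    then have kk: "(1 - s / 2) \<le> (real k + 1 / 2) * \<delta>" "(real k + 1 / 2) * \<delta> \<le> 1 + s / 2"
      using \<delta> by (simp_all add: A_def B_def field_simps)
    moreover have "\<bar>-1 + X\<bar> \<le> s / 2" if "1 - s / 2 \<le> X" "X \<le> 1 + s / 2" for X using that by linarith
    ultimately have "\<bar>cap_center \<delta> k\<bar> \<le> s / 2" unfolding cap_center_def by blast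
    moreover have "k < cap_count \<delta>"
    proof -
      have "real k * \<delta> < 2" using kk(2) s \<delta> by (simp add: ring_distribs)
      then have "real k < 2 / \<delta>" using \<delta> by (simp add: field_simps)
      then show ?thesis unfolding cap_count_def by linarith
    qed
    ultimately show "k \<in> central_caps \<delta> s" by (simp add: central_caps_def)
  qed
  have "finite (central_caps \<delta> s)" by (simp add: central_caps_def)
  then have "card {nat \<lceil>A\<rceil>..nat \<lfloor>B\<rfloor>} \<le> card (central_caps \<delta> s)" using sub by (rule card_mono)
  moreover have "B - A - 1 \<le> real (card {nat \<lceil>A\<rceil>..nat \<lfloor>B\<rfloor>})"
  proof -
    have "0 \<le> \<lceil>A\<rceil>" using A0 by linarith
    then have "real (nat \<lceil>A\<rceil>) \<le> A + 1" by simp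
    moreover have "B - 1 \<le> real (nat \<lfloor>B\<rfloor>)" by linarith
    moreover have "real (nat \<lfloor>B\<rfloor>) + 1 - real (nat \<lceil>A\<rceil>) \<le> real (card {nat \<lceil>A\<rceil>..nat \<lfloor>B\<rfloor>})" by simp
    ultimately show ?thesis by linarith
  qed
  ultimately show ?thesis using BA s2 by (simp add: field_simps)
qed

definition tent_L1 :: real where "tent_L1 = (LINT t|lborel. norm (profile_hat tent t))\<^sup>2"

lemma inv_fourier_tent_piece:
  assumes "0 < \<delta>" "0 < w"
  shows "inv_fourier (tent_piece \<delta> w k) x = complex_of_real (\<delta> / 8 * (w / 2))
      * cis (2 * pi * (x \<bullet> (cap_center \<delta> k, (cap_center \<delta> k)\<^sup>2)))
      * (profile_hat tent (\<delta> / 8 * fst x) * profile_hat tent (w / 2 * snd x))"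
  unfolding tent_piece_def using assms by (intro inv_fourier_profile_box[OF integrable_tent]) auto

lemma tent_piece_integrable:
  assumes "0 < \<delta>" "0 < w"
  shows "integrable lborel (tent_piece \<delta> w k)" "integrable lborel (inv_fourier (tent_piece \<delta> w k))"
    "(LINT x|lborel. norm (inv_fourier (tent_piece \<delta> w k) x)) = tent_L1"
  using inv_fourier_profile_box_integrable[OF integrable_tent integrable_tent_hat, of "\<delta> / 8" "w / 2"]
    integrable_profile_box[OF integrable_tent, of "\<delta> / 8" "w / 2"] assms
  by (auto simp: tent_piece_def tent_L1_def)

lemma tent_piece_continuous:
  assumes "0 < \<delta>" "0 < w"
  shows "continuous_on UNIV (tent_piece \<delta> w k)" "norm (tent_piece \<delta> w k \<xi>) \<le> 1"
proof -
  show "continuous_on UNIV (tent_piece \<delta> w k)"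
    unfolding tent_piece_def profile_box_def[abs_def] using assms
    by (intro continuous_intros continuous_on_compose2[OF continuous_tent]) auto
  show "norm (tent_piece \<delta> w k \<xi>) \<le> 1"
    unfolding tent_piece_def profile_box_def norm_mult norm_of_real
    by (intro mult_le_one) (auto simp: abs_le_iff tent_bounds order_trans[OF _ tent_bounds(1)])
qed

text \<open>The function is bounded by \<open>\<delta> * w / 16\<close>, the area factor of its tent, and has \<open>L\<^sup>1\<close> norm \<open>tent_L1\<close>.\<close>

lemma inv_fourier_tent_piece_powr:
  assumes \<delta>: "0 < \<delta>" and w: "0 < w" and p: "1 \<le> p"
  shows "Lp_power p (inv_fourier (tent_piece \<delta> w k))
    \<le> ennreal ((\<delta> * w / 16) powr (p - 1) * tent_L1)"
proof -
  let ?f = "inv_fourier (tent_piece \<delta> w k)" and ?m = "\<delta> * w / 16"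
  have m: "0 < ?m" using \<delta> w by simp
  have bd: "norm (?f x) \<le> ?m" for x
  proof -
    have "norm (profile_hat tent (\<delta> / 8 * fst x)) * norm (profile_hat tent (w / 2 * snd x)) \<le> 1"
      by (intro mult_le_one tent_hat_bounds) auto
    then have "?m * (norm (profile_hat tent (\<delta> / 8 * fst x)) * norm (profile_hat tent (w / 2 * snd x))) \<le> ?m
        * 1"
      using m by (intro mult_left_mono) auto
    moreover have "norm (complex_of_real (\<delta> / 8 * (w / 2))) = ?m"
      unfolding norm_of_real using \<delta> w by simp
    ultimately show ?thesis
      unfolding inv_fourier_tent_piece[OF \<delta> w] norm_mult by simp
  qed
  have "Lp_power p ?f \<le> (\<integral>\<^sup>+ x. ennreal (?m powr (p - 1)) * ennreal (norm (?f x)) \<partial>lborel)"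
  proof (intro nn_integral_mono)
    fix x
    have "norm (?f x) powr p = norm (?f x) powr (p - 1) * norm (?f x)"
      using powr_add[of "norm (?f x)" "p - 1" 1] by simp
    also have "\<dots> \<le> ?m powr (p - 1) * norm (?f x)"
      using bd[of x] p by (intro mult_right_mono powr_mono2) auto
    finally show "ennreal (norm (?f x) powr p) \<le> ennreal (?m powr (p - 1)) * ennreal (norm (?f x))"
      by (simp add: ennreal_mult[symmetric] ennreal_leI)
  qed
  also have "\<dots> = ennreal (?m powr (p - 1)) * (\<integral>\<^sup>+ x. ennreal (norm (?f x)) \<partial>lborel)"
    by (rule nn_integral_cmult) (use tent_piece_integrable(2)[OF \<delta> w] in measurable)
  also have "(\<integral>\<^sup>+ x. ennreal (norm (?f x)) \<partial>lborel) = ennreal tent_L1"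
    using nn_integral_eq_integral[OF integrable_norm[OF tent_piece_integrable(2)[OF \<delta> w]]]
        tent_piece_integrable(3)[OF \<delta> w] by simp
  finally show ?thesis by (simp add: ennreal_mult tent_L1_def)
qed

text \<open>On the box the phase \<open>2 * pi * (x \<bullet> (c, c\<^sup>2))\<close> is at most \<open>\<pi> / 4\<close> because \<open>\<bar>c\<bar> \<le> s\<close>, and both Fejer
factors are bounded below because their arguments are at most \<open>1 / 16\<close>.\<close>

lemma Re_inv_fourier_tent_piece:
  assumes \<delta>: "0 < \<delta>" "\<delta> \<le> s" and w: "0 < w" "w \<le> s\<^sup>2" and s: "0 < s" "s \<le> 1" and k: "k \<in> central_caps \<delta> s"
    and x: "\<bar>fst x\<bar> \<le> 1 / (16 * s)" "\<bar>snd x\<bar> \<le> 1 / (16 * s\<^sup>2)"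
  shows "\<delta> * w / 16 / 32 \<le> Re (inv_fourier (tent_piece \<delta> w k) x)"
proof -
  let ?c = "cap_center \<delta> k" and ?\<theta> = "2 * pi * (x \<bullet> (cap_center \<delta> k, (cap_center \<delta> k)\<^sup>2))"
  let ?a = "profile_hat tent (\<delta> / 8 * fst x)" and ?b = "profile_hat tent (w / 2 * snd x)"
  have c: "\<bar>?c\<bar> \<le> s / 2" using k by (simp add: central_caps_def)
  have sx: "s * \<bar>fst x\<bar> \<le> 1 / 16" "s\<^sup>2 * \<bar>snd x\<bar> \<le> 1 / 16"
    using x s by (simp_all add: field_simps)
  have "\<bar>\<delta> / 8 * fst x\<bar> \<le> s * \<bar>fst x\<bar>" unfolding abs_mult using \<delta> by (intro mult_right_mono) auto
  then have a: "1 / 4 \<le> Re ?a" "Im ?a = 0" using tent_hat_near_0[of "\<delta> / 8 * fst x"] sx by auto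
  have "\<bar>w / 2 * snd x\<bar> \<le> s\<^sup>2 * \<bar>snd x\<bar>" unfolding abs_mult using w by (intro mult_right_mono) auto
  then have b: "1 / 4 \<le> Re ?b" "Im ?b = 0" using tent_hat_near_0[of "w / 2 * snd x"] sx by auto
  have "\<bar>x \<bullet> (?c, ?c\<^sup>2)\<bar> \<le> \<bar>fst x\<bar> * \<bar>?c\<bar> + \<bar>snd x\<bar> * ?c\<^sup>2"
    unfolding inner_prod_def using abs_triangle_ineq[of "fst x * ?c" "snd x * ?c\<^sup>2"] by (simp add: abs_mult)
  also have "\<dots> \<le> \<bar>fst x\<bar> * s + \<bar>snd x\<bar> * s\<^sup>2"
  proof (intro add_mono mult_left_mono)
    show "\<bar>?c\<bar> \<le> s" using c s by linarith
    then show "?c\<^sup>2 \<le> s\<^sup>2" using power_mono[of "\<bar>?c\<bar>" s 2] by simp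
  qed auto
  also have "\<dots> \<le> 1 / 8" using sx by (simp add: mult.commute)
  finally have th: "\<bar>?\<theta>\<bar> \<le> 2 * pi * (1 / 8)" by (simp add: abs_mult)
  have "cos (pi / 3) \<le> cos \<bar>?\<theta>\<bar>" using th pi_gt_zero by (intro cos_monotone_0_pi_le) auto
  then have cs: "1 / 2 \<le> cos ?\<theta>" by (simp add: cos_60)
  have "Re (cis ?\<theta> * (?a * ?b)) = cos ?\<theta> * (Re ?a * Re ?b)"
    unfolding times_complex.sel a(2) b(2) by simp
  moreover have "1 / 2 * (1 / 4 * (1 / 4)) \<le> cos ?\<theta> * (Re ?a * Re ?b)"
    using a b cs by (intro mult_mono) auto
  ultimately have "1 / 32 \<le> Re (cis ?\<theta> * (?a * ?b))" by simp
  then have "\<delta> * w / 16 * (1 / 32) \<le> \<delta> * w / 16 * Re (cis ?\<theta> * (?a * ?b))"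
    using \<delta> w by (intro mult_left_mono) auto
  also have "\<dots> = Re (inv_fourier (tent_piece \<delta> w k) x)"
  proof -
    have "Re (complex_of_real r * z * z') = r * Re (z * z')" for r z z' by (simp add: mult.assoc)
    moreover have "\<delta> / 8 * (w / 2) = \<delta> * w / 16" by simp
    ultimately show ?thesis unfolding inv_fourier_tent_piece[OF \<delta>(1) w(1)] by (simp only:)
  qed
  finally show ?thesis by simp
qed

text \<open>Let \<open>n\<close> be the number of pieces and \<open>m\<close> the common maximum of their moduli. On a box of area
\<open>1 / (64 * s ^ 3)\<close> the sum of the pieces has size at least \<open>n * m / 32\<close>, while the \<open>p\<close>-th powers of the
norms of the pieces add up to at most a constant times \<open>n * m powr (p - 1)\<close>. The lower bound for \<open>n\<close> is
of order \<open>s / \<delta>\<close>.\<close>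

lemma tent_example:
  assumes \<delta>: "0 < \<delta>" "\<delta> \<le> 1 / 4" and \<beta>: "0 \<le> \<beta>" "\<beta> \<le> 1" and p: "1 \<le> p"
    and s: "\<delta> powr (\<beta> / 2) \<le> s" "s \<le> 1"
  shows "ennreal (((\<delta> powr (1 + \<beta>) / 16) * (s / (2 * \<delta>)) powr (p - 1) /
      (64 * 32 powr p * (tent_L1 + 1) * s ^ 3)) powr (1 / p))
    \<le> decoupling_const p \<delta> \<beta>"
proof -
  let ?w = "\<delta> powr \<beta>" and ?S = "central_caps \<delta> s"
  define m where "m = \<delta> * ?w / 16"
  define n where "n = real (card ?S)"
  have w: "0 < ?w" "\<delta> \<le> ?w" "?w \<le> 1" using powr_mono'[of \<beta> 1 \<delta>] \<beta> \<delta> by (auto simp: powr_le1)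
  have m: "0 < m" using \<delta> w by (simp add: m_def)
  have m_eq: "m = \<delta> powr (1 + \<beta>) / 16" using \<delta> by (simp add: m_def powr_add)
  have s0: "0 < s"
  proof -
    have "0 < \<delta> powr (\<beta> / 2)" using \<delta> by simp
    then show ?thesis using s(1) by linarith
  qed
  have ws: "?w \<le> s\<^sup>2"
  proof -
    have "(\<delta> powr (\<beta> / 2))\<^sup>2 \<le> s\<^sup>2" using s(1) by (intro power_mono) auto
    moreover have "(\<delta> powr (\<beta> / 2))\<^sup>2 = ?w" by (simp add: power2_eq_square flip: powr_add)
    ultimately show ?thesis by simp
  qed
  have s2: "2 * \<delta> \<le> s"
  proof -
    have "\<delta> powr (1 / 2) \<le> \<delta> powr (\<beta> / 2)" using \<delta> \<beta> by (intro powr_mono') auto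
    then have a: "sqrt \<delta> \<le> s" using s(1) \<delta> by (simp add: powr_half_sqrt)
    have "2 * sqrt \<delta> \<le> 1"
    proof -
      have "sqrt \<delta> \<le> sqrt (1 / 4)" using \<delta> by (intro real_sqrt_le_mono)
      then show ?thesis by (simp add: real_sqrt_divide)
    qed
    then have "2 * sqrt \<delta> * sqrt \<delta> \<le> 1 * sqrt \<delta>" using \<delta> by (intro mult_right_mono) auto
    then have "2 * \<delta> \<le> sqrt \<delta>" using \<delta> by (simp add: mult.assoc)
    then show ?thesis using a by linarith
  qed
  have n: "s / (2 * \<delta>) \<le> n" unfolding n_def by (rule card_central_caps[OF \<delta>(1) s0 s(2) s2])
  have n0: "0 < n" using n s0 \<delta> by (meson divide_pos_pos less_le_trans mult_pos_pos zero_less_numeral)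
  have finS: "finite ?S" by (simp add: central_caps_def)
  have SI: "?S \<subseteq> {..<cap_count \<delta>}" by (auto simp: central_caps_def)
  let ?F = "tent_piece \<delta> ?w"
  define F where "F \<xi> = (\<Sum>k\<in>?S. ?F k \<xi>)" for \<xi>
  let ?f = "\<lambda>k. inv_fourier (?F k)"
  note Fk = tent_piece_integrable[OF \<delta>(1) w(1)]
  have F: "integrable lborel F" unfolding F_def[abs_def] by (intro Bochner_Integration.integrable_sum Fk)
  have f_eq: "inv_fourier F x = (\<Sum>k\<in>?S. ?f k x)" for x
    unfolding inv_fourier_def F_def sum_distrib_right
    by (rule Bochner_Integration.integral_sum) (rule integrable_mult_cis[OF Fk(1)], measurable)
  have f: "integrable lborel (inv_fourier F)"
    unfolding f_eq[abs_def] by (intro Bochner_Integration.integrable_sum Fk)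
  have Fc: "continuous_on UNIV F"
    unfolding F_def[abs_def] by (intro continuous_on_sum tent_piece_continuous[OF \<delta>(1) w(1)])
  have Fb: "norm (F \<xi>) \<le> n * 1" for \<xi>
    unfolding F_def n_def
    by (rule order_trans[OF norm_sum sum_bounded_above]) (rule tent_piece_continuous[OF \<delta>(1) w(1)])
  have fF: "has_fourier_transform (inv_fourier F) F"
    by (rule has_fourier_transform_of_integrable[OF f F fourier_inv_fourier[OF F Fc Fb f]])
  have Fsupp: "\<xi> \<in> small_cap \<delta> \<beta> k" if "k \<in> ?S" "?F k \<xi> \<noteq> 0" for k \<xi>
    using tent_piece_support[OF \<delta> w(2) s(2)] that by blast
  have supp: "F \<xi> = 0" if "\<xi> \<notin> parabola_nbhd ?w" for \<xi>
    unfolding F_def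
  proof (intro sum.neutral ballI)
    fix k assume "k \<in> ?S"
    then show "?F k \<xi> = 0" using Fsupp[of k \<xi>] that by (auto simp: small_cap_def)
  qed
  have part: "cap_part F (small_cap \<delta> \<beta> k) = (if k \<in> ?S then ?f k else (\<lambda>x. 0))" for k
  proof -
    have "indicator (small_cap \<delta> \<beta> k) \<xi> * F \<xi> = (if k \<in> ?S then ?F k \<xi> else 0)" for \<xi>
    proof -
      have "indicator (small_cap \<delta> \<beta> k) \<xi> * F \<xi> = (\<Sum>l\<in>?S. indicator (small_cap \<delta> \<beta> k) \<xi> * ?F l \<xi>)"
        by (simp add: F_def sum_distrib_left)
      also have "\<dots> = (\<Sum>l\<in>?S. if l = k then ?F k \<xi> else 0)"
      proof (rule sum.cong[OF refl])
        fix l assume l: "l \<in> ?S"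
        show "indicator (small_cap \<delta> \<beta> k) \<xi> * ?F l \<xi> = (if l = k then ?F k \<xi> else 0)"
        proof (cases "?F l \<xi> = 0")
          case False
          then have a: "\<xi> \<in> small_cap \<delta> \<beta> l" by (rule Fsupp[OF l])
          have "l = k" if "\<xi> \<in> small_cap \<delta> \<beta> k"
            using a that by (auto simp: small_cap_def intro: cap_interval_unique[OF \<delta>(1)])
          then show ?thesis using a by (auto simp: indicator_def)
        qed auto
      qed
      also have "\<dots> = (if k \<in> ?S then ?F k \<xi> else 0)" using finS by simp
      finally show ?thesis .
    qed
    then show ?thesis by (auto simp: cap_part_def inv_fourier_def fun_eq_iff)
  qed
  define U where "U = Lp_power p (inv_fourier F)"
  define V where "V = (\<Sum>\<gamma>\<in>small_caps \<delta> \<beta>. Lp_power p (cap_part F \<gamma>))"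
  have tL: "0 \<le> tent_L1" by (simp add: tent_L1_def)
  have V: "V \<le> ennreal (n * (m powr (p - 1) * (tent_L1 + 1)))"
  proof -
    have "V = (\<Sum>k<cap_count \<delta>. Lp_power p (cap_part F (small_cap \<delta> \<beta> k)))"
      unfolding V_def small_caps_eq by (simp add: sum.reindex[OF inj_small_cap[OF \<delta>(1)]])
    also have "\<dots> = (\<Sum>k\<in>?S. Lp_power p (?f k))"
      by (rule sum.mono_neutral_cong_right) (use SI p in \<open>auto simp: part\<close>)
    also have "\<dots> \<le> (\<Sum>k\<in>?S. ennreal (m powr (p - 1) * tent_L1))"
      unfolding m_def by (intro sum_mono inv_fourier_tent_piece_powr[OF \<delta>(1) w(1) p])
    also have "\<dots> = ennreal (n * (m powr (p - 1) * tent_L1))"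
      using tL by (simp add: n_def ennreal_mult ennreal_of_nat_eq_real_of_nat)
    also have "\<dots> \<le> ennreal (n * (m powr (p - 1) * (tent_L1 + 1)))"
      using n0 by (intro ennreal_leI mult_left_mono) auto
    finally show ?thesis .
  qed
  define B where "B = {x :: plane. \<bar>fst x\<bar> \<le> 1 / (16 * s) \<and> \<bar>snd x\<bar> \<le> 1 / (16 * s\<^sup>2)}"
  have U: "ennreal ((n * m / 32) powr p / (64 * s ^ 3)) \<le> U"
  proof -
    have "B = {- (1 / (16 * s))..1 / (16 * s)} \<times> {- (1 / (16 * s\<^sup>2))..1 / (16 * s\<^sup>2)}"
      by (auto simp: B_def abs_le_iff)
    then have "B = cbox (- (1 / (16 * s)), - (1 / (16 * s\<^sup>2))) (1 / (16 * s), 1 / (16 * s\<^sup>2))"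
      by (simp only: cbox_Pair_eq box_real)
    then have "emeasure lborel B = ennreal (2 * (1 / (16 * s)) * (2 * (1 / (16 * s\<^sup>2))))" and [measurable]: "B
        \<in> sets borel"
      using s0 by (simp_all add: emeasure_lborel_cbox_eq Basis_prod_def prod.union_disjoint)
    moreover have "2 * (1 / (16 * s)) * (2 * (1 / (16 * s\<^sup>2))) = 1 / (64 * s ^ 3)"
      using s0 by (simp add: power2_eq_square power3_eq_cube)
    ultimately have area: "emeasure lborel B = ennreal (1 / (64 * s ^ 3))" by simp
    have low: "n * m / 32 \<le> norm (inv_fourier F x)" if "x \<in> B" for x
    proof -
      have "n * m / 32 = (\<Sum>k\<in>?S. m / 32)" by (simp add: n_def)
      also have "\<dots> \<le> (\<Sum>k\<in>?S. Re (?f k x))"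
        unfolding m_def using that s2 \<delta> ws
        by (intro sum_mono Re_inv_fourier_tent_piece[OF \<delta>(1) _ w(1) ws s0 s(2)]) (auto simp: B_def)
      also have "\<dots> = Re (inv_fourier F x)" by (simp add: f_eq)
      also have "\<dots> \<le> norm (inv_fourier F x)" by (rule complex_Re_le_cmod)
      finally show ?thesis .
    qed
    have "ennreal ((n * m / 32) powr p / (64 * s ^ 3)) = ennreal ((n * m / 32) powr p) * emeasure lborel B"
      using s0 unfolding area by (simp flip: ennreal_mult)
    also have "\<dots> = (\<integral>\<^sup>+ x. ennreal ((n * m / 32) powr p) * indicator B x \<partial>lborel)"
      by (simp add: nn_integral_cmult_indicator)
    also have "\<dots> \<le> U"
      unfolding U_def
    proof (intro nn_integral_mono)
      fix x
      show "ennreal ((n * m / 32) powr p) * indicator B x \<le> ennreal (norm (inv_fourier F x) powr p)"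
        using low[of x] n0 m p by (cases "x \<in> B") (auto intro!: ennreal_leI powr_mono2)
    qed
    finally show ?thesis .
  qed
  let ?c = "(\<delta> powr (1 + \<beta>) / 16) * (s / (2 * \<delta>)) powr (p - 1) / (64 * 32 powr p * (tent_L1 + 1) * s ^ 3)"
  have c: "0 < ?c" using \<delta> s0 tL by (intro divide_pos_pos mult_pos_pos) auto
  have "ennreal ?c * V \<le> ennreal ?c * ennreal (n * (m powr (p - 1) * (tent_L1 + 1)))"
    by (intro mult_left_mono V) simp
  also have "\<dots> = ennreal (?c * (n * (m powr (p - 1) * (tent_L1 + 1))))"
    using c n0 tL by (intro ennreal_mult[symmetric]) auto
  also have "\<dots> \<le> ennreal ((n * m / 32) powr p / (64 * s ^ 3))"
  proof (intro ennreal_leI)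
    have "?c * (n * (m powr (p - 1) * (tent_L1 + 1)))
        = (s / (2 * \<delta>)) powr (p - 1) * (m * m powr (p - 1) * n) / (64 * 32 powr p * s ^ 3)"
    proof -
      have "a * b / (64 * P * T * S) * (x * (y * T)) = b * (a * y * x) / (64 * P * S)" if "T \<noteq> 0"
          for a b P T S x y :: real
        using that by (simp add: divide_simps)
      moreover have "tent_L1 + 1 \<noteq> 0" using tL by linarith
      ultimately show ?thesis unfolding m_eq[symmetric] by blast
    qed
    also have "\<dots> \<le> n powr (p - 1) * (m * m powr (p - 1) * n) / (64 * 32 powr p * s ^ 3)"
      using n s0 \<delta> p m n0 by (intro divide_right_mono mult_right_mono powr_mono2) auto
    also have "\<dots> = (n * n powr (p - 1)) * (m * m powr (p - 1)) / (64 * 32 powr p * s ^ 3)"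
      by (simp only: mult_ac)
    also have "\<dots> = n powr p * m powr p / (64 * 32 powr p * s ^ 3)"
      using n0 m powr_add[of n 1 "p - 1"] powr_add[of m 1 "p - 1"] by simp
    also have "\<dots> = (n * m / 32) powr p / (64 * s ^ 3)"
      using n0 m by (simp add: powr_mult powr_divide)
    finally show "?c * (n * (m powr (p - 1) * (tent_L1 + 1))) \<le> (n * m / 32) powr p / (64 * s ^ 3)" .
  qed
  also note U
  finally have le: "ennreal ?c * V \<le> U" .
  show ?thesis
  proof (rule decoupling_const_ge[OF _ c fF supp])
    show "0 < p" using p by simp
    show "ennreal ?c * (\<Sum>\<gamma>\<in>small_caps \<delta> \<beta>. Lp_power p (cap_part F \<gamma>))
        \<le> Lp_power p (inv_fourier F)" using le unfolding U_def V_def .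
    show "(\<Sum>\<gamma>\<in>small_caps \<delta> \<beta>. Lp_power p (cap_part F \<gamma>)) < \<infinity>"
      using order_le_less_trans[OF V] unfolding V_def by simp
    have "0 < (n * m / 32) powr p / (64 * s ^ 3)" using n0 m s0 by simp
    then show "Lp_power p (inv_fourier F) \<noteq> 0"
      using U unfolding U_def by (metis ennreal_eq_0_iff le_zero_eq not_le)
  qed
qed

text \<open>The example with \<open>s = \<delta> powr a\<close>, for \<open>a = \<beta> / 2\<close> and for \<open>a = 0\<close>.\<close>

theorem decoupling_const_lower:
  assumes p: "1 \<le> p"
  shows "\<exists>c>0. \<forall>\<beta> \<delta>. 0 \<le> \<beta> \<and> \<beta> \<le> 1 \<and> 0 < \<delta> \<and> \<delta> \<le> 1 / 4 \<longrightarrow>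
    ennreal (c * (\<delta> powr (- (2 - \<beta>) * (1/2 - 1/p)) + \<delta> powr (- (1 - (2 + \<beta>) / p))))
      \<le> decoupling_const p \<delta> \<beta>"
proof -
  define c0 where "c0 = (1 / 16) * (1 / 2) powr (p - 1) / (64 * 32 powr p * (tent_L1 + 1))"
  have tL: "0 \<le> tent_L1" by (simp add: tent_L1_def)
  have c0: "0 < c0" using tL unfolding c0_def by (intro divide_pos_pos mult_pos_pos) auto
  have main: "ennreal (c0 powr (1 / p) * \<delta> powr ((a * (p - 4) + 2 + \<beta> - p) / p)) \<le> decoupling_const p \<delta> \<beta>"
    if h: "0 \<le> \<beta> \<and> \<beta> \<le> 1 \<and> 0 < \<delta> \<and> \<delta> \<le> 1 / 4" and a: "0 \<le> a" "a \<le> \<beta> / 2" for \<beta> \<delta> a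
  proof -
    let ?s = "\<delta> powr a"
    have s: "\<delta> powr (\<beta> / 2) \<le> ?s" "?s \<le> 1" using h a by (auto intro!: powr_mono' powr_le1)
    have "(\<delta> powr (1 + \<beta>) / 16) * (?s / (2 * \<delta>)) powr (p - 1) / (64 * 32 powr p * (tent_L1 + 1) * ?s ^ 3)
        = c0 * (\<delta> powr (1 + \<beta>) * (?s / \<delta>) powr (p - 1) / ?s ^ 3)"
    proof -
      have "(?s / (2 * \<delta>)) powr (p - 1) = (1 / 2) powr (p - 1) * (?s / \<delta>) powr (p - 1)"
        using h by (simp flip: powr_mult)
      then show ?thesis by (simp add: c0_def mult_ac)
    qed
    also have "\<delta> powr (1 + \<beta>) * (?s / \<delta>) powr (p - 1) / ?s ^ 3 = \<delta> powr (a * (p - 4) + 2 + \<beta> - p)"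
    proof -
      have "?s / \<delta> = \<delta> powr (a - 1)" using h by (simp add: powr_diff)
      moreover have "?s ^ 3 = \<delta> powr (3 * a)" using h
          by (simp add: powr_powr flip: powr_numeral) (simp add: mult.commute)
      ultimately have "\<delta> powr (1 + \<beta>) * (?s / \<delta>) powr (p - 1) / ?s ^ 3
          = \<delta> powr ((1 + \<beta>) + (a - 1) * (p - 1) - 3 * a)"
        by (simp only: powr_powr powr_add[symmetric] powr_diff[symmetric])
      also have "(1 + \<beta>) + (a - 1) * (p - 1) - 3 * a = a * (p - 4) + 2 + \<beta> - p" by (simp add: algebra_simps)
      finally show ?thesis .
    qed
    finally have "((\<delta> powr (1 + \<beta>) / 16) * (?s / (2 * \<delta>)) powr (p - 1) /
        (64 * 32 powr p * (tent_L1 + 1) * ?s ^ 3)) powr (1 / p)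
        = c0 powr (1 / p) * \<delta> powr ((a * (p - 4) + 2 + \<beta> - p) / p)"
      by (simp add: powr_mult powr_powr)
    then show ?thesis using tent_example[of \<delta> \<beta> p ?s] h p s by simp
  qed
  show ?thesis
  proof (intro exI[of _ "c0 powr (1 / p) / 2"] conjI allI impI)
    show "0 < c0 powr (1 / p) / 2" using c0 by simp
    fix \<beta> \<delta> :: real
    assume h: "0 \<le> \<beta> \<and> \<beta> \<le> 1 \<and> 0 < \<delta> \<and> \<delta> \<le> 1 / 4"
    let ?X = "\<delta> powr (- (2 - \<beta>) * (1/2 - 1/p))" and ?Y = "\<delta> powr (- (1 - (2 + \<beta>) / p))" and ?k
        = "c0 powr (1 / p)"
    have "(\<beta> / 2 * (p - 4) + 2 + \<beta> - p) / p = - (2 - \<beta>) * (1/2 - 1/p)" using p by (simp add: field_simps)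
    then have X: "ennreal (?k * ?X) \<le> decoupling_const p \<delta> \<beta>" using main[OF h, of "\<beta> / 2"] h by simp
    have "(0 * (p - 4) + 2 + \<beta> - p) / p = - (1 - (2 + \<beta>) / p)" using p by (simp add: field_simps)
    then have Y: "ennreal (?k * ?Y) \<le> decoupling_const p \<delta> \<beta>" using main[OF h, of 0] h by simp
    have "?k / 2 * (?X + ?Y) \<le> max (?k * ?X) (?k * ?Y)" by (simp add: ring_distribs max_def)
    then have "ennreal (?k / 2 * (?X + ?Y)) \<le> ennreal (max (?k * ?X) (?k * ?Y))" by (rule ennreal_leI)
    also have "\<dots> \<le> decoupling_const p \<delta> \<beta>" using X Y by (auto simp: max_def)
    finally show "ennreal (?k / 2 * (?X + ?Y)) \<le> decoupling_const p \<delta> \<beta>" .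
  qed
qed

theorem theorem1p2:
  shows "\<exists>c \<delta>0 :: real. c > 0 \<and> 0 < \<delta>0 \<and> \<delta>0 < 1 \<and>
    (\<forall>p::real. 2 \<le> p \<longrightarrow> (\<exists>C c' :: real. C > 0 \<and> c' > 0 \<and>
      (\<forall>\<beta> \<delta> :: real. 0 \<le> \<beta> \<and> \<beta> \<le> 1 \<and> 0 < \<delta> \<and> \<delta> \<le> \<delta>0 \<longrightarrow>
        decoupling_const p \<delta> \<beta>
          \<le> ennreal (C * \<bar>ln \<delta>\<bar> powr c *
              (\<delta> powr (- (2 - \<beta>) * (1/2 - 1/p)) + \<delta> powr (- (1 - (2 + \<beta>) / p)))) \<and>
        decoupling_const p \<delta> \<beta>
          \<ge> ennreal (c' *
              (\<delta> powr (- (2 - \<beta>) * (1/2 - 1/p)) + \<delta> powr (- (1 - (2 + \<beta>) / p)))))))"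
proof (rule exI[of _ 1], rule exI[of _ "1 / 4"], intro conjI allI impI)
  fix p :: real assume p: "2 \<le> p"
  obtain C where C: "C > 0" "\<And>\<beta> \<delta>. 0 \<le> \<beta> \<and> \<beta> \<le> 1 \<and> 0 < \<delta> \<and> \<delta> \<le> 1 / 4 \<Longrightarrow>
      decoupling_const p \<delta> \<beta> \<le> ennreal (C * \<bar>ln \<delta>\<bar> powr 1 *
        (\<delta> powr (- (2 - \<beta>) * (1/2 - 1/p)) + \<delta> powr (- (1 - (2 + \<beta>) / p))))"
    using decoupling_const_upper[OF p] by blast
  have p1: "1 \<le> p" using p by simp
  obtain c' where c': "c' > 0" "\<And>\<beta> \<delta>. 0 \<le> \<beta> \<and> \<beta> \<le> 1 \<and> 0 < \<delta> \<and> \<delta> \<le> 1 / 4 \<Longrightarrow>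
      ennreal (c' * (\<delta> powr (- (2 - \<beta>) * (1/2 - 1/p)) + \<delta> powr (- (1 - (2 + \<beta>) / p))))
        \<le> decoupling_const p \<delta> \<beta>"
    using decoupling_const_lower[OF p1] by blast
  show "\<exists>C c' :: real. C > 0 \<and> c' > 0 \<and>
      (\<forall>\<beta> \<delta> :: real. 0 \<le> \<beta> \<and> \<beta> \<le> 1 \<and> 0 < \<delta> \<and> \<delta> \<le> 1 / 4 \<longrightarrow>
        decoupling_const p \<delta> \<beta>
          \<le> ennreal (C * \<bar>ln \<delta>\<bar> powr 1 *
              (\<delta> powr (- (2 - \<beta>) * (1/2 - 1/p)) + \<delta> powr (- (1 - (2 + \<beta>) / p)))) \<and>
        decoupling_const p \<delta> \<beta>
          \<ge> ennreal (c' *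
              (\<delta> powr (- (2 - \<beta>) * (1/2 - 1/p)) + \<delta> powr (- (1 - (2 + \<beta>) / p)))))"
  proof (rule exI[of _ C], rule exI[of _ c'], intro conjI allI impI)
    show "C > 0" by (rule C(1))
    show "c' > 0" by (rule c'(1))
    fix \<beta> \<delta> :: real assume h: "0 \<le> \<beta> \<and> \<beta> \<le> 1 \<and> 0 < \<delta> \<and> \<delta> \<le> 1 / 4"
    show "decoupling_const p \<delta> \<beta> \<le> ennreal (C * \<bar>ln \<delta>\<bar> powr 1 *
        (\<delta> powr (- (2 - \<beta>) * (1/2 - 1/p)) + \<delta> powr (- (1 - (2 + \<beta>) / p))))"
      by (rule C(2)[OF h])
    show "decoupling_const p \<delta> \<beta> \<ge> ennreal (c' *
        (\<delta> powr (- (2 - \<beta>) * (1/2 - 1/p)) + \<delta> powr (- (1 - (2 + \<beta>) / p))))"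
      by (rule c'(2)[OF h])
  qed
qed simp_all

end
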